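(* For any $p>2,M>0$, there exist $C_{p,M}>0,C'>0$ such that for $0<b\le1$, $\vartheta\in[0,\frac\pi2[$, and all $Y_0$, $$\left\|\sup_{0\le t\le M}|U^0_{b,\vartheta,t}|\right\|_p\le C_{p,M}\exp\left(C'\left(\cos(\vartheta)|Y_0^{TX}|^2+|Y_0^N|^2\right)\right),$$ where $\|\cdot\|_p$ is the $L_p$ norm with respect to the probability law $Q$.
   Context: $\mathfrak g=\mathfrak p\oplus\mathfrak k$ is the Cartan decomposition of the Lie algebra of a connected, simply connected real reductive Lie group $G$ with Cartan involution $\theta$, $\dim\mathfrak p$ odd; $B$ is a nondegenerate symmetric bilinear form on $\mathfrak g$, $G$- and $\theta$-invariant, positive on $\mathfrak p$, negative on $\mathfrak k$; $\langle\cdot,\cdot\rangle=-B(\cdot,\theta\cdot)$. $\overline{\mathfrak p}$ is another copy of $\mathfrak p$ (oriented), $e\mapsto\overline e$; $S^{\overline{\mathfrak p}}$ its spinor space with Clifford multiplication $c(\overline e)^2=-|e|^2$, $\widehat c(\overline e)=ic(\overline e)$. On $\Lambda^\cdot(\mathfrak g^* )$, with $\varphi:\mathfrak g\to\mathfrak g^*$ given by $B$, $c(e)=\varphi e\wedge-i_e$, $\widehat c(e)=\varphi e\wedge+i_e$; acting on $\Lambda^\cdot(\mathfrak g^* )\otimes S^{\overline{\mathfrak p}}$, $\widehat c(\overline e)$ anticommutes with these. $\beta=B\oplus\langle\cdot,\cdot\rangle$ on $\mathfrak g\oplus\overline{\mathfrak p}$. For antisymmetric $A$, $c(A)=\frac14B(Ae_i^*,e_j^*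 )c(e_i)c(e_j)$ ($A\in\mathrm{End}(\mathfrak g)$), $\widehat c(A)=-\frac14\beta(Ae_i^*,e_j^* )\widehat c(e_i)\widehat c(e_j)$ ($A\in\mathrm{End}(\mathfrak g\oplus\overline{\mathfrak p})$). $R_\vartheta e=\cos\vartheta\,e+\sin\vartheta\,\overline e$, $R_\vartheta\overline e=-\sin\vartheta\,e+\cos\vartheta\,\overline e$ ($e\in\mathfrak p$), $R_\vartheta=1$ on $\mathfrak k$; $\widehat c_\vartheta(A)=\widehat c(R_\vartheta AR_\vartheta^{-1})$. For $Y=Y^{TX}+Y^N$ with $Y^{TX}\in\mathfrak p$, $Y^N\in\mathfrak k$, $$R^0_\vartheta(Y)=\cos\vartheta\left(\widehat c_\vartheta(\mathrm{ad}(Y^{TX})|_{\mathfrak g})-c(\mathrm{ad}(Y^{TX}))\right)-i\cos^{1/2}\vartheta\left(c(\theta\,\mathrm{ad}(Y^N))+\widehat c_\vartheta(\mathrm{ad}(Y^N)|_{\overline{\mathfrak p}})\right),$$ where $\mathrm{ad}(Y^{TX})|_{\mathfrak g}$ is extended by $0$ on $\overline{\mathfrak p}$ and $\mathrm{ad}(Y^N)|_{\overline{\mathfrak p}}$ by $0$ on $\mathfrak g$. $\mathcal N_\vartheta=N^{\Lambda^\cdot(\mathfrak p^* )}+\cos\vartheta N^{\Lambda^\cdot(\mathfrak k^* )}$ (number operators). Under the probability law $Q$, $w^{\mathfrak p},w^{\mathfrak k}$ are independent standard Brownian motions in $\mathfrak p,\mathfrak k$ and $Y_\cdot=Y^{TX}_\cdot+Y^N_\cdot$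 solves, with deterministic initial value $Y_0=Y_0^{TX}+Y_0^N\in\mathfrak p\oplus\mathfrak k$, $$dY^{TX}=-\frac{Y^{TX}}{b^2}dt+\frac{dw^{\mathfrak p}}b,\qquad dY^N=-\frac{\cos\vartheta}{b^2}Y^Ndt+\frac{\cos^{1/2}\vartheta}bdw^{\mathfrak k}.$$ $U^0_{b,\vartheta,\cdot}\in\mathrm{End}(\Lambda^\cdot(\mathfrak g^* )\otimes S^{\overline{\mathfrak p}})$ solves $$\frac{dU^0_{b,\vartheta}}{ds}=U^0_{b,\vartheta}\left[-\frac{\mathcal N_\vartheta}{b^2}+\frac{R^0_\vartheta(Y)}b\right],\qquad U^0_{b,\vartheta,0}=1,$$ and $|\cdot|$ is the operator norm. *)

theory Defs
  imports "HOL-Probability.Probability" "HOL-Algebra.Group"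
begin

section \<open>Lie groups\<close>

text \<open>
  A Lie group is a submanifold of some Euclidean space \<open>'m\<close> with a smooth group law; by Whitney's
  embedding theorem this is no restriction (a connected Lie group is second countable).
  Smoothness on an arbitrary subset is the existence of local smooth extensions.
\<close>

primrec Ck_on :: "nat \<Rightarrow> ('a::euclidean_space \<Rightarrow> 'b::euclidean_space) \<Rightarrow> 'a set \<Rightarrow> bool" where
  "Ck_on 0 f U \<longleftrightarrow> continuous_on U f"
| "Ck_on (Suc k) f U \<longleftrightarrow>
     f differentiable_on U \<and> (\<forall>v. Ck_on k (\<lambda>x. frechet_derivative f (at x) v) U)"

definition smooth_map :: "'a::euclidean_space set \<Rightarrow> ('a \<Rightarrow> 'b::euclidean_space) \<Rightarrow> bool" where
  "smooth_map A f \<longleftrightarrow>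
     (\<forall>x\<in>A. \<exists>U F. open U \<and> x \<in> U \<and> (\<forall>k. Ck_on k F U) \<and> (\<forall>y\<in>U \<inter> A. F y = f y))"

definition diffeomorphism ::
  "'a::euclidean_space set \<Rightarrow> 'b::euclidean_space set \<Rightarrow> ('a \<Rightarrow> 'b) \<Rightarrow> bool" where
  "diffeomorphism A B f \<longleftrightarrow> bij_betw f A B \<and> smooth_map A f \<and> smooth_map B (inv_into A f)"

text \<open>Submanifolds of \<open>'m\<close> modelled on the vector space \<open>'g\<close>, i.e. of dimension \<open>DIM('g)\<close>.\<close>

definition submanifold :: "'g::euclidean_space itself \<Rightarrow> 'm::euclidean_space set \<Rightarrow> bool" where
  "submanifold T X \<longleftrightarrow>
     (\<forall>x\<in>X. \<exists>V U (f :: 'g \<Rightarrow> 'm).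
        openin (top_of_set X) V \<and> x \<in> V \<and> open U \<and> diffeomorphism U V f)"

definition lie_group :: "'g::euclidean_space itself \<Rightarrow> 'm::euclidean_space monoid \<Rightarrow> bool" where
  "lie_group T G \<longleftrightarrow> group G \<and> submanifold T (carrier G) \<and>
     smooth_map (carrier G \<times> carrier G) (\<lambda>(x, y). x \<otimes>\<^bsub>G\<^esub> y) \<and>
     smooth_map (carrier G) (\<lambda>x. inv\<^bsub>G\<^esub> x)"

definition lie_algebra :: "('g::real_vector \<Rightarrow> 'g \<Rightarrow> 'g) \<Rightarrow> bool" where
  "lie_algebra br \<longleftrightarrow> (\<forall>x. linear (br x)) \<and> (\<forall>y. linear (\<lambda>x. br x y)) \<and> (\<forall>x. br x x = 0) \<and>
     (\<forall>x y z. br x (br y z) + br y (br z x) + br z (br x y) = 0)"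

text \<open>
  \<open>Ad ex G g x\<close> is the generator of the one-parameter group \<open>t \<mapsto> g exp(t x) g\<inverse>\<close>.
\<close>

definition Ad :: "('g::real_vector \<Rightarrow> 'm) \<Rightarrow> 'm monoid \<Rightarrow> 'm \<Rightarrow> 'g \<Rightarrow> 'g" where
  "Ad ex G g x = (THE y. \<forall>t::real. ex (t *\<^sub>R y) = g \<otimes>\<^bsub>G\<^esub> ex (t *\<^sub>R x) \<otimes>\<^bsub>G\<^esub> inv\<^bsub>G\<^esub> g)"

text \<open>
  The space \<open>'g\<close> with bracket \<open>br\<close> is the Lie algebra of \<open>G\<close>, with exponential map \<open>ex\<close>: the
  derivative of \<open>ex\<close> at \<open>0\<close> identifies \<open>'g\<close> with the tangent space at the identity (an injection
  between spaces of the same dimension), \<open>ex\<close> is a homomorphism on each line, and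
  \<open>[x, y]\<close> is the derivative at \<open>0\<close> of \<open>Ad(exp(t x)) y\<close>.
\<close>

definition lie_algebra_of ::
  "('g::euclidean_space \<Rightarrow> 'g \<Rightarrow> 'g) \<Rightarrow> ('g \<Rightarrow> 'm::euclidean_space) \<Rightarrow> 'm monoid \<Rightarrow> bool" where
  "lie_algebra_of br ex G \<longleftrightarrow>
     lie_group TYPE('g) G \<and> lie_algebra br \<and>
     range ex \<subseteq> carrier G \<and> smooth_map UNIV ex \<and> inj (frechet_derivative ex (at 0)) \<and>
     (\<forall>s t x. ex ((s + t) *\<^sub>R x) = ex (s *\<^sub>R x) \<otimes>\<^bsub>G\<^esub> ex (t *\<^sub>R x)) \<and>
     (\<forall>x y. ((\<lambda>t. Ad ex G (ex (t *\<^sub>R x)) y) has_vector_derivative br x y) (at 0))"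

definition lie_ideal :: "('g::real_vector \<Rightarrow> 'g \<Rightarrow> 'g) \<Rightarrow> 'g set \<Rightarrow> bool" where
  "lie_ideal br I \<longleftrightarrow> subspace I \<and> (\<forall>x. \<forall>y\<in>I. br x y \<in> I)"

definition reductive_lie_algebra :: "('g::real_vector \<Rightarrow> 'g \<Rightarrow> 'g) \<Rightarrow> bool" where
  "reductive_lie_algebra br \<longleftrightarrow>
     (\<forall>I. lie_ideal br I \<longrightarrow>
        (\<exists>J. lie_ideal br J \<and> I \<inter> J = {0} \<and> (\<forall>x. \<exists>y\<in>I. \<exists>z\<in>J. x = y + z)))"

section \<open>Real reductive groups\<close>

definition p_part :: "('g::real_vector \<Rightarrow> 'g) \<Rightarrow> 'g set" where
  "p_part \<theta> = {x. \<theta> x = - x}"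

definition k_part :: "('g::real_vector \<Rightarrow> 'g) \<Rightarrow> 'g set" where
  "k_part \<theta> = {x. \<theta> x = x}"

definition pr_p :: "('g::real_vector \<Rightarrow> 'g) \<Rightarrow> 'g \<Rightarrow> 'g" where
  "pr_p \<theta> x = (1/2) *\<^sub>R (x - \<theta> x)"

definition pr_k :: "('g::real_vector \<Rightarrow> 'g) \<Rightarrow> 'g \<Rightarrow> 'g" where
  "pr_k \<theta> x = (1/2) *\<^sub>R (x + \<theta> x)"

text \<open>
  Knapp's definition of a reductive Lie group \<open>(G, K, \<theta>, B)\<close>, for connected \<open>G\<close>: connectedness is a
  separate assumption, and it makes Knapp's last axiom (that each \<open>Ad g\<close> is an inner automorphism of
  the complexification) automatic.
\<close>

definition real_reductive_group ::
  "'m::euclidean_space monoid \<Rightarrow> 'm set \<Rightarrow> ('g::euclidean_space \<Rightarrow> 'm) \<Rightarrow> ('g \<Rightarrow> 'g \<Rightarrow> 'g) \<Rightarrow>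
   ('g \<Rightarrow> 'g) \<Rightarrow> ('g \<Rightarrow> 'g \<Rightarrow> real) \<Rightarrow> bool" where
  "real_reductive_group G K ex br \<theta> B \<longleftrightarrow>
     lie_algebra_of br ex G \<and> reductive_lie_algebra br \<and>
     linear \<theta> \<and> (\<forall>x. \<theta> (\<theta> x) = x) \<and> (\<forall>x y. \<theta> (br x y) = br (\<theta> x) (\<theta> y)) \<and>
     subgroup K G \<and> compact K \<and> {x. \<forall>t. ex (t *\<^sub>R x) \<in> K} = k_part \<theta> \<and>
     diffeomorphism (K \<times> p_part \<theta>) (carrier G) (\<lambda>(h, x). h \<otimes>\<^bsub>G\<^esub> ex x) \<and>
     (\<forall>x. linear (B x)) \<and> (\<forall>x y. B x y = B y x) \<and>
     (\<forall>x. (\<forall>y. B x y = 0) \<longrightarrow> x = 0) \<and>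
     (\<forall>g\<in>carrier G. \<forall>x y. B (Ad ex G g x) (Ad ex G g y) = B x y) \<and>
     (\<forall>x y. B (\<theta> x) (\<theta> y) = B x y) \<and>
     (\<forall>x\<in>p_part \<theta>. x \<noteq> 0 \<longrightarrow> B x x > 0) \<and> (\<forall>x\<in>k_part \<theta>. x \<noteq> 0 \<longrightarrow> B x x < 0)"

definition ip :: "('g \<Rightarrow> 'g \<Rightarrow> real) \<Rightarrow> ('g \<Rightarrow> 'g) \<Rightarrow> 'g \<Rightarrow> 'g \<Rightarrow> real" where
  "ip B \<theta> x y = - B x (\<theta> y)"

text \<open>The norm of the type \<open>'g\<close> plays no role; the Euclidean structure is always \<open>ip B \<theta>\<close>.\<close>

definition adapted_basis ::
  "('g::real_vector \<Rightarrow> 'g \<Rightarrow> real) \<Rightarrow> ('g \<Rightarrow> 'g) \<Rightarrow> ('n \<Rightarrow> 'g) \<Rightarrow> bool" where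
  "adapted_basis B \<theta> e \<longleftrightarrow>
     (\<forall>i j. ip B \<theta> (e i) (e j) = (if i = j then 1 else 0)) \<and> span (range e) = UNIV \<and>
     (\<forall>i. e i \<in> p_part \<theta> \<or> e i \<in> k_part \<theta>)"

section \<open>Spinors of the second copy of \<open>\<pp>\<close>\<close>

definition adjoint_mat :: "complex^'s^'s \<Rightarrow> complex^'s^'s" where
  "adjoint_mat A = (\<chi> i j. cnj (A $ j $ i))"

text \<open>
  Complex spinors: an irreducible Clifford module, with Clifford multiplication \<open>cS\<close> skew-adjoint for
  the Hermitian product of \<open>complex^'s\<close>. In odd dimension there are two such modules up to
  isomorphism, one for each orientation; both are allowed.
\<close>

definition spinor_module ::
  "('g::real_vector \<Rightarrow> 'g \<Rightarrow> real) \<Rightarrow> ('g \<Rightarrow> 'g) \<Rightarrow> ('g \<Rightarrow> complex^'s^'s) \<Rightarrow> bool" where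
  "spinor_module B \<theta> cS \<longleftrightarrow>
     (\<forall>x\<in>p_part \<theta>. \<forall>y\<in>p_part \<theta>. cS (x + y) = cS x + cS y) \<and>
     (\<forall>a. \<forall>x\<in>p_part \<theta>. cS (a *\<^sub>R x) = a *\<^sub>R cS x) \<and>
     (\<forall>x\<in>p_part \<theta>. cS x ** cS x = mat (- of_real (ip B \<theta> x x))) \<and>
     (\<forall>x\<in>p_part \<theta>. adjoint_mat (cS x) = - cS x) \<and>
     (\<forall>W. vec.subspace W \<and> (\<forall>x\<in>p_part \<theta>. \<forall>v\<in>W. cS x *v v \<in> W) \<longrightarrow> W = {0} \<or> W = UNIV)"

section \<open>The exterior algebra tensored with spinors\<close>

text \<open>
  With \<open>e\<^sub>i\<close> (\<open>i :: 'n\<close>) an adapted basis of \<open>'g\<close> and \<open>e\<^sup>i\<close> its dual basis, \<open>\<omega> :: ('n, 's) ext_spin\<close>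
  stands for the sum over \<open>J\<close> of \<open>e\<^sup>J \<otimes> (\<omega> $ J)\<close>, where \<open>e\<^sup>J\<close> is the wedge product of the \<open>e\<^sup>j\<close>,
  \<open>j \<in> J\<close>, in increasing order. As the basis is orthonormal, so are the \<open>e\<^sup>J\<close>, and the norm of
  this type is the one induced by the metric of \<open>'g\<close> and the Hermitian metric on spinors.
  Operators are bounded real-linear maps, normed by the operator norm.
\<close>

type_synonym ('n, 's) ext_spin = "complex^'s^('n set)"
type_synonym ('n, 's) ext_op = "('n, 's) ext_spin \<Rightarrow>\<^sub>L ('n, 's) ext_spin"

definition wedge_sign :: "'n::{finite,linorder} \<Rightarrow> 'n set \<Rightarrow> real" where
  "wedge_sign i J = (-1) ^ card {j \<in> J. j < i}"

text \<open>Exterior multiplication by \<open>e\<^sup>i\<close>, and contraction with \<open>e\<^sub>i\<close>.\<close>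

lift_definition ext_basis :: "'n::{finite,linorder} \<Rightarrow> ('n, 's::finite) ext_op" is
  "\<lambda>i \<omega>. \<chi> J. if i \<in> J then wedge_sign i J *\<^sub>R (\<omega> $ (J - {i})) else 0"
  by (auto intro!: linearI simp: linear_conv_bounded_linear[symmetric] vec_eq_iff algebra_simps)

lift_definition int_basis :: "'n::{finite,linorder} \<Rightarrow> ('n, 's::finite) ext_op" is
  "\<lambda>i \<omega>. \<chi> J. if i \<in> J then 0 else wedge_sign i J *\<^sub>R (\<omega> $ insert i J)"
  by (auto intro!: linearI simp: linear_conv_bounded_linear[symmetric] vec_eq_iff algebra_simps)

definition ext_mult ::
  "('n::{finite,linorder} \<Rightarrow> 'g) \<Rightarrow> ('g \<Rightarrow> real) \<Rightarrow> ('n, 's::finite) ext_op" where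
  "ext_mult e \<alpha> = (\<Sum>i\<in>UNIV. \<alpha> (e i) *\<^sub>R ext_basis i)"

definition int_mult ::
  "('g \<Rightarrow> 'g \<Rightarrow> real) \<Rightarrow> ('g \<Rightarrow> 'g) \<Rightarrow> ('n::{finite,linorder} \<Rightarrow> 'g) \<Rightarrow> 'g \<Rightarrow>
   ('n, 's::finite) ext_op" where
  "int_mult B \<theta> e x = (\<Sum>i\<in>UNIV. ip B \<theta> x (e i) *\<^sub>R int_basis i)"

lift_definition times_ii :: "('n::finite, 's::finite) ext_op" is
  "\<lambda>\<omega>. \<chi> J. \<i> *s (\<omega> $ J)"
  by (auto intro!: linearI simp: linear_conv_bounded_linear[symmetric] vec_eq_iff algebra_simps)

text \<open>The sign is that of the graded tensor product: odd operators on spinors anticommute with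
  odd operators on the exterior algebra.\<close>

lift_definition spin_op :: "complex^'s^'s \<Rightarrow> ('n::finite, 's::finite) ext_op" is
  "\<lambda>A \<omega>. \<chi> J. (-1) ^ card J *\<^sub>R (A *v (\<omega> $ J))"
  by (auto intro!: linearI simp: linear_conv_bounded_linear[symmetric] vec_eq_iff
        matrix_vector_mult_def sum.distrib scaleR_sum_right algebra_simps)

lift_definition number_op :: "'n set \<Rightarrow> ('n::finite, 's::finite) ext_op" is
  "\<lambda>I \<omega>. \<chi> J. real (card (J \<inter> I)) *\<^sub>R (\<omega> $ J)"
  by (auto intro!: linearI simp: linear_conv_bounded_linear[symmetric] vec_eq_iff algebra_simps)

section \<open>Clifford operators\<close>

definition cl :: "('g \<Rightarrow> 'g \<Rightarrow> real) \<Rightarrow> ('g \<Rightarrow> 'g) \<Rightarrow> ('n::{finite,linorder} \<Rightarrow> 'g) \<Rightarrow> 'g \<Rightarrow>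
   ('n, 's::finite) ext_op" where
  "cl B \<theta> e x = ext_mult e (B x) - int_mult B \<theta> e x"

definition clh :: "('g \<Rightarrow> 'g \<Rightarrow> real) \<Rightarrow> ('g \<Rightarrow> 'g) \<Rightarrow> ('n::{finite,linorder} \<Rightarrow> 'g) \<Rightarrow> 'g \<Rightarrow>
   ('n, 's::finite) ext_op" where
  "clh B \<theta> e x = ext_mult e (B x) + int_mult B \<theta> e x"

definition clh_bar :: "('g \<Rightarrow> complex^'s^'s) \<Rightarrow> 'g \<Rightarrow> ('n::finite, 's::finite) ext_op" where
  "clh_bar cS y = times_ii o\<^sub>L spin_op (cS y)"

text \<open>
  A vector \<open>x + \<bar>y\<close> of the sum of \<open>'g\<close> and the second copy of \<open>\<pp>\<close> is the pair \<open>(x, y)\<close>, with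
  \<open>y \<in> p_part \<theta>\<close>.
\<close>

definition clh_sum :: "('g \<Rightarrow> 'g \<Rightarrow> real) \<Rightarrow> ('g \<Rightarrow> 'g) \<Rightarrow> ('n::{finite,linorder} \<Rightarrow> 'g) \<Rightarrow>
   ('g \<Rightarrow> complex^'s^'s) \<Rightarrow> 'g \<times> 'g \<Rightarrow> ('n, 's::finite) ext_op" where
  "clh_sum B \<theta> e cS u = clh B \<theta> e (fst u) + clh_bar cS (snd u)"

definition beta_form :: "('g \<Rightarrow> 'g \<Rightarrow> real) \<Rightarrow> ('g \<Rightarrow> 'g) \<Rightarrow> 'g \<times> 'g \<Rightarrow> 'g \<times> 'g \<Rightarrow> real" where
  "beta_form B \<theta> u v = B (fst u) (fst v) + ip B \<theta> (snd u) (snd v)"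

text \<open>
  As \<open>ip B \<theta> x y = B x (- \<theta> y)\<close>, the basis dual to an orthonormal basis \<open>e\<^sub>i\<close> with respect to \<open>B\<close>
  is \<open>- \<theta> e\<^sub>i\<close>. On the second copy of \<open>\<pp>\<close> an orthonormal basis is its own dual.
\<close>

definition cl_End :: "('g::real_vector \<Rightarrow> 'g \<Rightarrow> real) \<Rightarrow> ('g \<Rightarrow> 'g) \<Rightarrow>
   ('n::{finite,linorder} \<Rightarrow> 'g) \<Rightarrow> ('g \<Rightarrow> 'g) \<Rightarrow> ('n, 's::finite) ext_op" where
  "cl_End B \<theta> e A = (1/4) *\<^sub>R
     (\<Sum>i\<in>UNIV. \<Sum>j\<in>UNIV.
        B (A (- \<theta> (e i))) (- \<theta> (e j)) *\<^sub>R (cl B \<theta> e (e i) o\<^sub>L cl B \<theta> e (e j)))"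

definition sum_basis :: "('g::real_vector \<Rightarrow> 'g) \<Rightarrow> ('n \<Rightarrow> 'g) \<Rightarrow> ('g \<times> 'g) set" where
  "sum_basis \<theta> e = {(e i, 0) | i. True} \<union> {(0, e i) | i. e i \<in> p_part \<theta>}"

definition sum_dual :: "('g::real_vector \<Rightarrow> 'g) \<Rightarrow> 'g \<times> 'g \<Rightarrow> 'g \<times> 'g" where
  "sum_dual \<theta> u = (- \<theta> (fst u), snd u)"

definition clh_End :: "('g::real_vector \<Rightarrow> 'g \<Rightarrow> real) \<Rightarrow> ('g \<Rightarrow> 'g) \<Rightarrow>
   ('n::{finite,linorder} \<Rightarrow> 'g) \<Rightarrow> ('g \<Rightarrow> complex^'s^'s) \<Rightarrow> ('g \<times> 'g \<Rightarrow> 'g \<times> 'g) \<Rightarrow>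
   ('n, 's::finite) ext_op" where
  "clh_End B \<theta> e cS A = - (1/4) *\<^sub>R
     (\<Sum>u\<in>sum_basis \<theta> e. \<Sum>v\<in>sum_basis \<theta> e.
        beta_form B \<theta> (A (sum_dual \<theta> u)) (sum_dual \<theta> v) *\<^sub>R
        (clh_sum B \<theta> e cS u o\<^sub>L clh_sum B \<theta> e cS v))"

definition rot :: "('g::real_vector \<Rightarrow> 'g) \<Rightarrow> real \<Rightarrow> 'g \<times> 'g \<Rightarrow> 'g \<times> 'g" where
  "rot \<theta> \<phi> u =
     (pr_k \<theta> (fst u) + cos \<phi> *\<^sub>R pr_p \<theta> (fst u) - sin \<phi> *\<^sub>R snd u,
      sin \<phi> *\<^sub>R pr_p \<theta> (fst u) + cos \<phi> *\<^sub>R snd u)"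

text \<open>The inverse of \<open>rot \<theta> \<phi>\<close> on pairs with second component in \<open>p_part \<theta>\<close> is \<open>rot \<theta> (- \<phi>)\<close>.\<close>

definition clh_rot :: "('g::real_vector \<Rightarrow> 'g \<Rightarrow> real) \<Rightarrow> ('g \<Rightarrow> 'g) \<Rightarrow>
   ('n::{finite,linorder} \<Rightarrow> 'g) \<Rightarrow> ('g \<Rightarrow> complex^'s^'s) \<Rightarrow> real \<Rightarrow>
   ('g \<times> 'g \<Rightarrow> 'g \<times> 'g) \<Rightarrow> ('n, 's::finite) ext_op" where
  "clh_rot B \<theta> e cS \<phi> A = clh_End B \<theta> e cS (rot \<theta> \<phi> \<circ> A \<circ> rot \<theta> (- \<phi>))"

definition R0 :: "('g::real_vector \<Rightarrow> 'g \<Rightarrow> 'g) \<Rightarrow> ('g \<Rightarrow> 'g \<Rightarrow> real) \<Rightarrow> ('g \<Rightarrow> 'g) \<Rightarrow>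
   ('n::{finite,linorder} \<Rightarrow> 'g) \<Rightarrow> ('g \<Rightarrow> complex^'s^'s) \<Rightarrow> real \<Rightarrow> 'g \<Rightarrow>
   ('n, 's::finite) ext_op" where
  "R0 br B \<theta> e cS \<phi> Y =
     cos \<phi> *\<^sub>R (clh_rot B \<theta> e cS \<phi> (\<lambda>(x, y). (br (pr_p \<theta> Y) x, 0))
               - cl_End B \<theta> e (br (pr_p \<theta> Y)))
     - sqrt (cos \<phi>) *\<^sub>R (times_ii o\<^sub>L
         (cl_End B \<theta> e (\<lambda>x. \<theta> (br (pr_k \<theta> Y) x))
          + clh_rot B \<theta> e cS \<phi> (\<lambda>(x, y). (0, br (pr_k \<theta> Y) y))))"

definition number_rot :: "('g::real_vector \<Rightarrow> 'g) \<Rightarrow> ('n::finite \<Rightarrow> 'g) \<Rightarrow> real \<Rightarrow>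
   ('n, 's::finite) ext_op" where
  "number_rot \<theta> e \<phi> =
     number_op {i. e i \<in> p_part \<theta>} + cos \<phi> *\<^sub>R number_op {i. e i \<in> k_part \<theta>}"

section \<open>The processes\<close>

text \<open>
  Standard Brownian motion, started at \<open>0\<close>, in the Euclidean space \<open>V\<close> with scalar product \<open>q\<close>. The
  last clause says that \<open>w t - w s\<close> is centred Gaussian in \<open>V\<close> with covariance \<open>(t - s) q\<close>.
\<close>

definition standard_brownian ::
  "'w measure \<Rightarrow> 'g::euclidean_space set \<Rightarrow> ('g \<Rightarrow> 'g \<Rightarrow> real) \<Rightarrow> (real \<Rightarrow> 'w \<Rightarrow> 'g) \<Rightarrow> bool" where
  "standard_brownian Q V q w \<longleftrightarrow>
     (\<forall>t\<ge>0. w t \<in> borel_measurable Q) \<and>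
     (AE \<omega> in Q. w 0 \<omega> = 0 \<and> continuous_on {0..} (\<lambda>t. w t \<omega>) \<and> (\<forall>t\<ge>0. w t \<omega> \<in> V)) \<and>
     (\<forall>t n. 0 \<le> t 0 \<and> mono t \<longrightarrow>
        prob_space.indep_vars Q (\<lambda>_. borel) (\<lambda>i \<omega>. w (t (Suc i)) \<omega> - w (t i) \<omega>) {..<n::nat}) \<and>
     (\<forall>s t v. 0 \<le> s \<and> s < t \<and> v \<in> V \<and> v \<noteq> 0 \<longrightarrow>
        distributed Q lborel (\<lambda>\<omega>. q v (w t \<omega> - w s \<omega>))
          (\<lambda>x. ennreal (normal_density 0 (sqrt ((t - s) * q v v)) x)))"

definition independent_processes ::
  "'w measure \<Rightarrow> (real \<Rightarrow> 'w \<Rightarrow> 'g::euclidean_space) \<Rightarrow> (real \<Rightarrow> 'w \<Rightarrow> 'g) \<Rightarrow> bool" where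
  "independent_processes Q w w' \<longleftrightarrow>
     prob_space.indep_var Q
       (PiM {0..} (\<lambda>_. borel)) (\<lambda>\<omega>. \<lambda>t\<in>{0..}. w t \<omega>)
       (PiM {0..} (\<lambda>_. borel)) (\<lambda>\<omega>. \<lambda>t\<in>{0..}. w' t \<omega>)"

text \<open>The noise is additive, so the stochastic differential equations are integral equations that
  hold pathwise.\<close>

definition solves_Y :: "'w measure \<Rightarrow> ('g::euclidean_space \<Rightarrow> 'g) \<Rightarrow> real \<Rightarrow> real \<Rightarrow>
   (real \<Rightarrow> 'w \<Rightarrow> 'g) \<Rightarrow> (real \<Rightarrow> 'w \<Rightarrow> 'g) \<Rightarrow> 'g \<Rightarrow> (real \<Rightarrow> 'w \<Rightarrow> 'g) \<Rightarrow> bool" where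
  "solves_Y Q \<theta> b \<phi> wp wk Y0 Y \<longleftrightarrow>
     (AE \<omega> in Q. continuous_on {0..} (\<lambda>t. Y t \<omega>) \<and>
       (\<forall>t\<ge>0.
         pr_p \<theta> (Y t \<omega>) = pr_p \<theta> Y0
           - integral {0..t} (\<lambda>s. (1 / b\<^sup>2) *\<^sub>R pr_p \<theta> (Y s \<omega>))
           + (1 / b) *\<^sub>R wp t \<omega> \<and>
         pr_k \<theta> (Y t \<omega>) = pr_k \<theta> Y0
           - integral {0..t} (\<lambda>s. (cos \<phi> / b\<^sup>2) *\<^sub>R pr_k \<theta> (Y s \<omega>))
           + (sqrt (cos \<phi>) / b) *\<^sub>R wk t \<omega>))"

definition solves_U :: "'w measure \<Rightarrow> ('g::euclidean_space \<Rightarrow> 'g \<Rightarrow> 'g) \<Rightarrow> ('g \<Rightarrow> 'g \<Rightarrow> real) \<Rightarrow>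
   ('g \<Rightarrow> 'g) \<Rightarrow> ('n::{finite,linorder} \<Rightarrow> 'g) \<Rightarrow> ('g \<Rightarrow> complex^'s^'s) \<Rightarrow> real \<Rightarrow> real \<Rightarrow>
   (real \<Rightarrow> 'w \<Rightarrow> 'g) \<Rightarrow> (real \<Rightarrow> 'w \<Rightarrow> ('n, 's::finite) ext_op) \<Rightarrow> bool" where
  "solves_U Q br B \<theta> e cS b \<phi> Y U \<longleftrightarrow>
     (AE \<omega> in Q. U 0 \<omega> = id_blinfun \<and>
       (\<forall>s\<ge>0. ((\<lambda>s. U s \<omega>) has_vector_derivative
          (U s \<omega> o\<^sub>L (- (1 / b\<^sup>2) *\<^sub>R number_rot \<theta> e \<phi> + (1 / b) *\<^sub>R R0 br B \<theta> e cS \<phi> (Y s \<omega>))))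
          (at s within {0..})))"

text \<open>
  An extended-valued norm, so that a bound contains integrability; \<open>pw\<close> is the real power
  extended by \<open>\<infinity>\<close>. The lower integral \<open>nn_integral\<close> does not change on null sets, also for functions
  that are only almost everywhere equal to a measurable one.
\<close>

definition Lp_norm :: "'w measure \<Rightarrow> real \<Rightarrow> ('w \<Rightarrow> ennreal) \<Rightarrow> ennreal" where
  "Lp_norm Q p f =
     (let pw = (\<lambda>x r. if x = \<infinity> then \<infinity> else ennreal (enn2real x powr r))
      in pw (\<integral>\<^sup>+\<omega>. pw (f \<omega>) p \<partial>Q) (1 / p))"

end

theory Submission
  imports Defs
begin

text \<open>
  The flow is expanded in the driving noise. Write \<open>x = U\<^sup>* \<xi>\<close>; since \<open>\<N>\<close> is nonnegative and self-adjoint,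
  \<open>|x|\<^sup>2\<close> grows at most like \<open>2 \<integral> \<langle>R(Y) x, x\<rangle> / b\<close>. Both \<open>x\<close> and \<open>Y\<close> are limits of Euler schemes, which are
  polynomials in the Brownian increments. All joint moments of Gaussian increments are dominated by
  the moments of one scalar Gaussian per time step, which are nonnegative, so every operator
  coefficient may be replaced by its norm: the moments of the non-commutative process are bounded by
  those of a commutative one, where the product of the factors \<open>1 + Z\<^sub>k\<close> is dominated by the exponential of
  the Gaussian variable \<open>\<Sum> Z\<^sub>k\<close>. As \<open>\<Sum> Z\<^sub>k\<close> approximates \<open>\<integral> |R(Y)| / b\<close> for a scalar Ornstein-Uhlenbeck process
  of relaxation time \<open>b\<^sup>2\<close> (resp. \<open>b\<^sup>2 / cos \<phi>\<close>), its variance over \<open>[s, t]\<close> is \<open>O(t - s)\<close> uniformly in \<open>b\<close>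
  and \<open>\<phi>\<close>. Dyadic chaining gives the supremum in time.
\<close>

section \<open>Majorants of polynomials with vector coefficients\<close>

text \<open>A bound path by path would involve the exponential of the integral of |Y| / b, and as
  |Y| stays of order one its exponent is of order 1/b. The signs of Y provide the missing
  cancellation, but the operators R(e_i) do not commute, so there is no closed formula for the flow
  in which to use it. Moments recover it: expectations of words in the noise are compared one by
  one, whatever the order of the operators, and in the commutative majorant the noise still has both
  signs. The comparison is compatible with nonnegative coefficients, which is why the schemes are
  explicit and why majorants are ordered coefficientwise. Chaining is applied to the accumulated
  noise part of |x|^2 and not to x. As x relaxes on the time scale b^2, its increments over [s, t]
  are not small uniformly in b; in the energy the dissipation can be discarded, and the 2m-th moment
  of what remains is O((t - s)^m).\<close>

text \<open>
  \<open>X\<close> is a polynomial in the symbols \<open>(k, i)\<close>; in its majorant all symbols \<open>(k, i)\<close> are replaced by the single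
  symbol \<open>k\<close>.
\<close>

definition majorized ::
  "(('k \<times> 'i \<Rightarrow> real) \<Rightarrow> 'v::real_normed_vector) \<Rightarrow> (('k \<Rightarrow> real) \<Rightarrow> real) \<Rightarrow> bool" where
  "majorized X x \<longleftrightarrow> (\<exists>L :: ('v \<times> real \<times> ('k \<times> 'i) list) list.
     (\<forall>(c, d, w)\<in>set L. norm c \<le> d) \<and>
     X = (\<lambda>z. \<Sum>(c, d, w)\<leftarrow>L. prod_list (map z w) *\<^sub>R c) \<and>
     x = (\<lambda>z. \<Sum>(c, d, w)\<leftarrow>L. d * prod_list (map (z \<circ> fst) w)))"

lemma majorizedI:
  assumes "\<And>c d w. (c, d, w) \<in> set L \<Longrightarrow> norm c \<le> d"
    and "\<And>z. X z = (\<Sum>(c, d, w)\<leftarrow>L. prod_list (map z w) *\<^sub>R c)"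
    and "\<And>z. x z = (\<Sum>(c, d, w)\<leftarrow>L. d * prod_list (map (z \<circ> fst) w))"
  shows "majorized X x"
  unfolding majorized_def using assms by (intro exI[of _ L]) (auto simp: fun_eq_iff)

lemma majorizedE:
  assumes "majorized X x"
  obtains L where "\<And>c d w. (c, d, w) \<in> set L \<Longrightarrow> norm c \<le> d"
    and "\<And>z. X z = (\<Sum>(c, d, w)\<leftarrow>L. prod_list (map z w) *\<^sub>R c)"
    and "\<And>z. x z = (\<Sum>(c, d, w)\<leftarrow>L. d * prod_list (map (z \<circ> fst) w))"
  using assms unfolding majorized_def fun_eq_iff by fast

lemma majorized_const: "norm c \<le> d \<Longrightarrow> majorized (\<lambda>_. c) (\<lambda>_. d)"
  by (rule majorizedI[where L = "[(c, d, [])]"]) auto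

lemma majorized_symbol: "majorized (\<lambda>z. z (k, i)) (\<lambda>z. z k)"
  by (rule majorizedI[where L = "[(1, 1, [(k, i)])]"]) auto

lemma majorized_add:
  assumes "majorized X x" "majorized Y y"
  shows "majorized (\<lambda>z. X z + Y z) (\<lambda>z. x z + y z)"
proof -
  obtain L where L: "\<And>c d w. (c, d, w) \<in> set L \<Longrightarrow> norm c \<le> d"
    "\<And>z. X z = (\<Sum>(c, d, w)\<leftarrow>L. prod_list (map z w) *\<^sub>R c)"
    "\<And>z. x z = (\<Sum>(c, d, w)\<leftarrow>L. d * prod_list (map (z \<circ> fst) w))"
    using assms(1) by (rule majorizedE) blast
  obtain M where M: "\<And>c d w. (c, d, w) \<in> set M \<Longrightarrow> norm c \<le> d"
    "\<And>z. Y z = (\<Sum>(c, d, w)\<leftarrow>M. prod_list (map z w) *\<^sub>R c)"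
    "\<And>z. y z = (\<Sum>(c, d, w)\<leftarrow>M. d * prod_list (map (z \<circ> fst) w))"
    using assms(2) by (rule majorizedE) blast
  show ?thesis
    by (rule majorizedI[where L = "L @ M"]) (use L M in auto)
qed

lemma bilinear_sum_list:
  assumes "bounded_bilinear f"
  shows "f (\<Sum>p\<leftarrow>L. g p) (\<Sum>q\<leftarrow>M. g' q) = (\<Sum>(p, q)\<leftarrow>List.product L M. f (g p) (g' q))"
proof -
  interpret bounded_bilinear f by fact
  have 1: "f u (\<Sum>q\<leftarrow>M. g' q) = (\<Sum>q\<leftarrow>M. f u (g' q))" for u
    by (induction M) (auto simp: add_right zero_right)
  show ?thesis
    by (induction L) (auto simp: add_left zero_left 1 o_def sum_list_addf)
qed

text \<open>Products concatenate words, and the order of the factors stays inside the coefficients,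
  so no commutation of the values of \<open>f\<close> is used. The constant 1 in the bound for
  \<open>f\<close> is what lets the majorants simply multiply.\<close>

lemma majorized_bilinear:
  fixes f :: "'a::real_normed_vector \<Rightarrow> 'b::real_normed_vector \<Rightarrow> 'c::real_normed_vector"
  assumes f: "bounded_bilinear f" "\<And>a b. norm (f a b) \<le> norm a * norm b"
    and "majorized X x" "majorized Y y"
  shows "majorized (\<lambda>z. f (X z) (Y z)) (\<lambda>z. x z * y z)"
proof -
  interpret f: bounded_bilinear f by fact
  obtain L where L: "\<And>c d w. (c, d, w) \<in> set L \<Longrightarrow> norm c \<le> d"
    "\<And>z. X z = (\<Sum>(c, d, w)\<leftarrow>L. prod_list (map z w) *\<^sub>R c)"
    "\<And>z. x z = (\<Sum>(c, d, w)\<leftarrow>L. d * prod_list (map (z \<circ> fst) w))"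
    using assms(3) by (rule majorizedE) blast
  obtain M where M: "\<And>c d w. (c, d, w) \<in> set M \<Longrightarrow> norm c \<le> d"
    "\<And>z. Y z = (\<Sum>(c, d, w)\<leftarrow>M. prod_list (map z w) *\<^sub>R c)"
    "\<And>z. y z = (\<Sum>(c, d, w)\<leftarrow>M. d * prod_list (map (z \<circ> fst) w))"
    using assms(4) by (rule majorizedE) blast
  define F where "F = (\<lambda>((c::'a, d::real, w :: ('d \<times> 'e) list), (c'::'b, d'::real, w')). (f c c', d * d', w @ w'))"
  show ?thesis
  proof (rule majorizedI[where L = "map F (List.product L M)"])
    fix c d w assume "(c, d, w) \<in> set (map F (List.product L M))"
    then obtain c1 d1 w1 c2 d2 w2 where *: "(c1, d1, w1) \<in> set L" "(c2, d2, w2) \<in> set M"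
      and c: "c = f c1 c2" "d = d1 * d2"
      by (auto simp: F_def)
    have "norm c1 \<le> d1" "norm c2 \<le> d2" using L(1)[OF *(1)] M(1)[OF *(2)] by auto
    then have "norm c1 * norm c2 \<le> d1 * d2"
      by (intro mult_mono) (auto intro: order_trans[OF norm_ge_zero])
    then show "norm c \<le> d"
      using f(2)[of c1 c2] unfolding c by linarith
  next
    fix z
    show "f (X z) (Y z) = (\<Sum>(c, d, w)\<leftarrow>map F (List.product L M). prod_list (map z w) *\<^sub>R c)"
      unfolding L(2) M(2) bilinear_sum_list[OF f(1)] map_map
      by (intro arg_cong[where f = sum_list] map_cong)
        (auto simp: F_def f.scaleR_left f.scaleR_right algebra_simps)
  next
    fix z
    show "x z * y z = (\<Sum>(c, d, w)\<leftarrow>map F (List.product L M). d * prod_list (map (z \<circ> fst) w))"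
      unfolding L(3) M(3) bilinear_sum_list[OF bounded_bilinear_mult] map_map
      by (intro arg_cong[where f = sum_list] map_cong)
        (auto simp: F_def algebra_simps)
  qed
qed

lemma majorized_mult:
  fixes X Y :: "('k \<times> 'i \<Rightarrow> real) \<Rightarrow> real"
  shows "majorized X x \<Longrightarrow> majorized Y y \<Longrightarrow> majorized (\<lambda>z. X z * Y z) (\<lambda>z. x z * y z)"
  by (rule majorized_bilinear[OF bounded_bilinear_mult]) (auto simp: abs_mult)

lemma majorized_scaleR:
  "majorized X x \<Longrightarrow> majorized Y y \<Longrightarrow> majorized (\<lambda>z. X z *\<^sub>R Y z) (\<lambda>z. x z * y z)"
  by (rule majorized_bilinear[OF bounded_bilinear_scaleR]) auto

lemma majorized_inner:
  "majorized X x \<Longrightarrow> majorized Y y \<Longrightarrow> majorized (\<lambda>z. X z \<bullet> Y z) (\<lambda>z. x z * y z)"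
  by (rule majorized_bilinear[OF bounded_bilinear_inner]) (auto simp: Cauchy_Schwarz_ineq2)

lemma majorized_linear:
  assumes f: "linear f" "\<And>v. norm (f v) \<le> c * norm v" and True: "c \<ge> 0" and "majorized X x"
  shows "majorized (\<lambda>z. f (X z)) (\<lambda>z. c * x z)"
proof -
  obtain L where L: "\<And>c d w. (c, d, w) \<in> set L \<Longrightarrow> norm c \<le> d"
    "\<And>z. X z = (\<Sum>(c, d, w)\<leftarrow>L. prod_list (map z w) *\<^sub>R c)"
    "\<And>z. x z = (\<Sum>(c, d, w)\<leftarrow>L. d * prod_list (map (z \<circ> fst) w))"
    using assms(4) by (rule majorizedE) blast
  have 1: "f (\<Sum>p\<leftarrow>M. g p) = (\<Sum>p\<leftarrow>M. f (g p))" for M :: "('a \<times> real \<times> ('c \<times> 'd) list) list" and g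
    by (induction M) (auto simp: linear_add[OF f(1)] linear_0[OF f(1)])
  show ?thesis
  proof (rule majorizedI[where L = "map (\<lambda>(u, d, w). (f u, c * d, w)) L"])
    fix u d w assume "(u, d, w) \<in> set (map (\<lambda>(u, d, w). (f u, c * d, w)) L)"
    then obtain u' d' where "(u', d', w) \<in> set L" and u: "u = f u'" "d = c * d'" by auto
    then have "c * norm u' \<le> c * d'" using True by (intro mult_left_mono L(1)) auto
    then show "norm u \<le> d" unfolding u using f(2)[of u'] by linarith
  next
    fix z show "f (X z) = (\<Sum>(u, d, w)\<leftarrow>map (\<lambda>(u, d, w). (f u, c * d, w)) L. prod_list (map z w) *\<^sub>R u)"
      unfolding L(2) 1 map_map
      by (intro arg_cong[where f = sum_list] map_cong) (auto simp: linear_cmul[OF f(1)])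
  next
    fix z show "c * x z = (\<Sum>(u, d, w)\<leftarrow>map (\<lambda>(u, d, w). (f u, c * d, w)) L. d * prod_list (map (z \<circ> fst) w))"
      unfolding L(3) sum_list_const_mult[symmetric] map_map
      by (intro arg_cong[where f = sum_list] map_cong) (auto simp: algebra_simps)
  qed
qed

lemma majorized_sum:
  "(\<And>j. j \<in> J \<Longrightarrow> majorized (X j) (x j)) \<Longrightarrow>
    majorized (\<lambda>z. \<Sum>j\<in>J. X j z) (\<lambda>z. \<Sum>j\<in>J. x j z)"
  by (induction J rule: infinite_finite_induct) (auto intro: majorized_const majorized_add)

lemma majorized_power:
  fixes X :: "('k \<times> 'i \<Rightarrow> real) \<Rightarrow> real"
  shows "majorized X x \<Longrightarrow> majorized (\<lambda>z. X z ^ n) (\<lambda>z. x z ^ n)"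
  by (induction n) (auto intro: majorized_const majorized_mult)

section \<open>Polynomials with nonnegative coefficients and the coefficientwise order\<close>

inductive nonneg_coeffs :: "(('k \<Rightarrow> real) \<Rightarrow> real) \<Rightarrow> bool" where
  const: "0 \<le> c \<Longrightarrow> nonneg_coeffs (\<lambda>_. c)"
| symbol: "nonneg_coeffs (\<lambda>z. z k)"
| add: "nonneg_coeffs x \<Longrightarrow> nonneg_coeffs y \<Longrightarrow> nonneg_coeffs (\<lambda>z. x z + y z)"
| mult: "nonneg_coeffs x \<Longrightarrow> nonneg_coeffs y \<Longrightarrow> nonneg_coeffs (\<lambda>z. x z * y z)"

lemma nonneg_coeffs_majorizes_zero:
  "nonneg_coeffs x \<Longrightarrow> majorized (\<lambda>_ :: 'k \<times> 'i \<Rightarrow> real. 0 :: real) x"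
proof (induction rule: nonneg_coeffs.induct)
  case (symbol k)
  \<comment> \<open>The second index of the letter is immaterial: its coefficient in the polynomial
    is 0, and the majorant only sees \<open>k\<close>.\<close>
  show ?case by (rule majorizedI[where L = "[(0, 1, [(k, undefined)])]"]) auto
next
  case (add x y)
  show ?case using majorized_add[OF add.IH] by simp
next
  case (mult x y)
  show ?case using majorized_mult[OF mult.IH] by simp
qed (auto intro: majorized_const)

lemma nonneg_coeffs_sum:
  "(\<And>j. j \<in> J \<Longrightarrow> nonneg_coeffs (x j)) \<Longrightarrow> nonneg_coeffs (\<lambda>z. \<Sum>j\<in>J. x j z)"
  by (induction J rule: infinite_finite_induct)
    (auto intro: nonneg_coeffs.const nonneg_coeffs.add)

lemma nonneg_coeffs_power:
  "nonneg_coeffs x \<Longrightarrow> nonneg_coeffs (\<lambda>z. x z ^ n)"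
  by (induction n) (auto intro: nonneg_coeffs.const nonneg_coeffs.mult)

text \<open>This is the order for which majorants may be enlarged (\<open>majorized_mono\<close>).
  Unlike the pointwise order it is compatible with products of polynomials whose variables take both
  signs.\<close>

definition coeff_le :: "(('k \<Rightarrow> real) \<Rightarrow> real) \<Rightarrow> (('k \<Rightarrow> real) \<Rightarrow> real) \<Rightarrow> bool" where
  "coeff_le x y \<longleftrightarrow> nonneg_coeffs (\<lambda>z. y z - x z)"

lemma coeff_le_refl: "coeff_le x x"
  unfolding coeff_le_def by (simp add: nonneg_coeffs.const)

lemma coeff_le_trans: "coeff_le x y \<Longrightarrow> coeff_le y z \<Longrightarrow> coeff_le x z"
  unfolding coeff_le_def by (drule (1) nonneg_coeffs.add) simp

lemma coeff_le_add:
  assumes "coeff_le x x'" "coeff_le y y'"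
  shows "coeff_le (\<lambda>z. x z + y z) (\<lambda>z. x' z + y' z)"
  using nonneg_coeffs.add[OF assms[unfolded coeff_le_def]]
  unfolding coeff_le_def by (simp add: algebra_simps)

lemma coeff_le_sum:
  "(\<And>j. j \<in> J \<Longrightarrow> coeff_le (x j) (y j)) \<Longrightarrow>
    coeff_le (\<lambda>z. \<Sum>j\<in>J. x j z) (\<lambda>z. \<Sum>j\<in>J. y j z)"
  by (induction J rule: infinite_finite_induct) (auto intro: coeff_le_refl coeff_le_add)

lemma coeff_le_mult:
  assumes "coeff_le x x'" "coeff_le y y'" "nonneg_coeffs x" "nonneg_coeffs y'"
  shows "coeff_le (\<lambda>z. x z * y z) (\<lambda>z. x' z * y' z)"
proof -
  have "nonneg_coeffs (\<lambda>z. (x' z - x z) * y' z + x z * (y' z - y z))"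
    using assms unfolding coeff_le_def by (intro nonneg_coeffs.add nonneg_coeffs.mult)
  then show ?thesis unfolding coeff_le_def by (simp add: algebra_simps)
qed

lemma coeff_le_nonneg: "coeff_le x y \<Longrightarrow> nonneg_coeffs x \<Longrightarrow> nonneg_coeffs y"
  unfolding coeff_le_def by (drule (1) nonneg_coeffs.add) simp

lemma coeff_le_power:
  assumes "coeff_le x y" "nonneg_coeffs x"
  shows "coeff_le (\<lambda>z. x z ^ n) (\<lambda>z. y z ^ n)"
proof (induction n)
  case (Suc n)
  show ?case unfolding power_Suc
    by (intro coeff_le_mult Suc assms nonneg_coeffs_power coeff_le_nonneg[OF assms])
qed (simp add: coeff_le_refl)

lemma coeff_le_add_nonneg: "nonneg_coeffs y \<Longrightarrow> coeff_le x (\<lambda>z. x z + y z)"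
  unfolding coeff_le_def by simp

lemma majorized_mono:
  fixes X :: "('k \<times> 'i \<Rightarrow> real) \<Rightarrow> real"
  assumes "majorized X x" "coeff_le x y"
  shows "majorized X y"
  using majorized_add[OF assms(1) nonneg_coeffs_majorizes_zero[OF assms(2)[unfolded coeff_le_def]]]
  by simp

text \<open>
  The product of the \<open>1 + x\<^sub>j\<close> has to be replaced, coefficient by coefficient, by a polynomial that is
  pointwise bounded by an exponential; \<open>1 + x \<le> exp x\<close> is of no use for this, as \<open>|1 + x|\<close> is not bounded by \<open>exp x\<close>.
\<close>

definition exp_trunc :: "nat \<Rightarrow> real \<Rightarrow> real" where
  "exp_trunc n t = (\<Sum>l\<le>n. t ^ l / fact l)"

lemma abs_exp_trunc_le: "\<bar>exp_trunc n t\<bar> \<le> exp \<bar>t\<bar>"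
proof -
  have "\<bar>exp_trunc n t\<bar> \<le> (\<Sum>l\<le>n. \<bar>t\<bar> ^ l / fact l)"
    unfolding exp_trunc_def by (rule order_trans[OF sum_abs]) (simp add: power_abs)
  also have "\<dots> \<le> (\<Sum>l. \<bar>t\<bar> ^ l / fact l)"
    using summable_exp[of "\<bar>t\<bar>"] by (intro sum_le_suminf) (auto simp: field_simps)
  also have "\<dots> = exp \<bar>t\<bar>"
    by (simp add: exp_def field_simps scaleR_conv_of_real)
  finally show ?thesis .
qed

lemma nonneg_coeffs_exp_trunc:
  "nonneg_coeffs x \<Longrightarrow> nonneg_coeffs (\<lambda>z. exp_trunc n (x z))"
  unfolding exp_trunc_def divide_inverse
  by (intro nonneg_coeffs_sum nonneg_coeffs.mult nonneg_coeffs_power nonneg_coeffs.const) auto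

lemma exp_trunc_mono:
  assumes "coeff_le x y" "nonneg_coeffs x" "m \<le> n"
  shows "coeff_le (\<lambda>z. exp_trunc m (x z)) (\<lambda>z. exp_trunc n (y z))"
proof -
  have "{..n} = {..m} \<union> {m<..n}" using assms(3) by auto
  then have "exp_trunc n t = exp_trunc m t + (\<Sum>l\<in>{m<..n}. t ^ l / fact l)" for t
    unfolding exp_trunc_def by (simp only:) (rule sum.union_disjoint; auto)
  moreover have "nonneg_coeffs (\<lambda>z. \<Sum>l\<in>{m<..n}. y z ^ l / fact l)"
    unfolding divide_inverse
    by (intro nonneg_coeffs_sum nonneg_coeffs.mult nonneg_coeffs_power nonneg_coeffs.const
        coeff_le_nonneg[OF assms(1,2)]) auto
  moreover have "coeff_le (\<lambda>z. exp_trunc m (x z)) (\<lambda>z. exp_trunc m (y z))"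
    unfolding exp_trunc_def divide_inverse
    by (intro coeff_le_sum coeff_le_mult coeff_le_power assms coeff_le_refl nonneg_coeffs_power
        nonneg_coeffs.const) auto
  ultimately show ?thesis
    by (simp add: coeff_le_trans[OF _ coeff_le_add_nonneg])
qed

lemma coeff_le_power_add:
  assumes "nonneg_coeffs x" "nonneg_coeffs y"
  shows "coeff_le (\<lambda>z. x z ^ Suc l + real (Suc l) * y z * x z ^ l) (\<lambda>z. (x z + y z) ^ Suc l)"
proof (induction l)
  case (Suc l)
  have eq: "(x z + y z) * (x z ^ Suc l + real (Suc l) * y z * x z ^ l) =
      (x z ^ Suc (Suc l) + real (Suc (Suc l)) * y z * x z ^ Suc l) + real (Suc l) * y z * y z * x z ^ l" for z
    by (simp add: algebra_simps)
  have "coeff_le (\<lambda>z. x z ^ Suc (Suc l) + real (Suc (Suc l)) * y z * x z ^ Suc l)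
      (\<lambda>z. (x z + y z) * (x z ^ Suc l + real (Suc l) * y z * x z ^ l))"
    unfolding eq
    by (intro coeff_le_add_nonneg nonneg_coeffs.mult nonneg_coeffs.const assms nonneg_coeffs_power) auto
  moreover have "coeff_le (\<lambda>z. (x z + y z) * (x z ^ Suc l + real (Suc l) * y z * x z ^ l))
     (\<lambda>z. (x z + y z) ^ Suc (Suc l))"
    unfolding power_Suc[of "x _ + y _" "Suc l"]
    by (intro coeff_le_mult Suc coeff_le_refl nonneg_coeffs.add assms nonneg_coeffs_power)
  ultimately show ?case by (rule coeff_le_trans)
qed (simp add: coeff_le_refl)

text \<open>Of the expansion of exp (x + y) only the terms of degree at most one in y are kept, by
  \<open>coeff_le_power_add\<close>; these already add up to \<open>exp_trunc n x * (1 + y)\<close>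
  and a leftover top power of x. The factor 1 + y raises the degree by one, hence the order
  \<open>Suc n\<close>.\<close>

lemma exp_trunc_step:
  assumes "nonneg_coeffs x" "nonneg_coeffs y"
  shows "coeff_le (\<lambda>z. exp_trunc n (x z) * (1 + y z)) (\<lambda>z. exp_trunc (Suc n) (x z + y z))"
proof -
  have e: "exp_trunc (Suc n) t = 1 + (\<Sum>l\<le>n. t ^ Suc l / fact (Suc l))" for t
    unfolding exp_trunc_def by (subst sum.atMost_Suc_shift) simp
  have eq: "1 + (\<Sum>l\<le>n. (s ^ Suc l + real (Suc l) * t * s ^ l) / fact (Suc l))
      = exp_trunc n s * (1 + t) + s ^ Suc n / fact (Suc n)" for s t
  proof -
    have "1 + (\<Sum>l\<le>n. (s ^ Suc l + real (Suc l) * t * s ^ l) / fact (Suc l)) =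
        exp_trunc (Suc n) s + (\<Sum>l\<le>n. t * (s ^ l / fact l))"
      unfolding e add_divide_distrib sum.distrib by (simp add: field_simps del: of_nat_Suc)
    then show ?thesis
      unfolding sum_distrib_left[symmetric] by (simp add: exp_trunc_def algebra_simps)
  qed
  have "coeff_le (\<lambda>z. 1 + (\<Sum>l\<le>n. (x z ^ Suc l + real (Suc l) * y z * x z ^ l) / fact (Suc l)))
    (\<lambda>z. exp_trunc (Suc n) (x z + y z))"
    unfolding e divide_inverse
    by (intro coeff_le_add coeff_le_refl coeff_le_sum coeff_le_mult coeff_le_power_add assms
        nonneg_coeffs.const nonneg_coeffs.add nonneg_coeffs.mult nonneg_coeffs_power) auto
  moreover have "coeff_le (\<lambda>z. exp_trunc n (x z) * (1 + y z))
     (\<lambda>z. exp_trunc n (x z) * (1 + y z) + x z ^ Suc n / fact (Suc n))"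
    unfolding divide_inverse
    by (intro coeff_le_add_nonneg nonneg_coeffs.mult nonneg_coeffs_power assms nonneg_coeffs.const) auto
  ultimately show ?thesis unfolding eq by (rule coeff_le_trans[rotated])
qed

lemma prod_le_exp_trunc:
  assumes "\<And>j. nonneg_coeffs (x j)"
  shows "coeff_le (\<lambda>z. \<Prod>j<k. 1 + x j z) (\<lambda>z. exp_trunc k (\<Sum>j<k. x j z))"
proof (induction k)
  case (Suc k)
  have nn: "nonneg_coeffs (\<lambda>z. \<Prod>j<n. 1 + x j z)" for n
    by (induction n) (auto intro!: nonneg_coeffs.const nonneg_coeffs.mult nonneg_coeffs.add assms)
  have "coeff_le (\<lambda>z. (\<Prod>j<k. 1 + x j z) * (1 + x k z)) (\<lambda>z. exp_trunc k (\<Sum>j<k. x j z) * (1 + x k z))"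
    by (intro coeff_le_mult Suc coeff_le_refl nn nonneg_coeffs.add nonneg_coeffs.const assms) auto
  from coeff_le_trans[OF this exp_trunc_step] show ?case
    by (auto intro: nonneg_coeffs_sum assms)
qed (simp add: exp_trunc_def coeff_le_refl)

text \<open>The difference consists of the cross terms \<open>2 * x i * x j\<close>. The summands
  have the shape of the bound for one energy step, so the bound for several steps becomes a function
  of the sum of the \<open>x j\<close> alone.\<close>

lemma coeff_le_sum_squares:
  assumes "\<And>j. nonneg_coeffs (x j)"
  shows "coeff_le (\<lambda>z. \<Sum>j\<in>J. 2 * x j z + (x j z)\<^sup>2) (\<lambda>z. 2 * (\<Sum>j\<in>J. x j z) + (\<Sum>j\<in>J. x j z)\<^sup>2)"
proof (induction J rule: infinite_finite_induct)
  case (insert j J)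
  let ?a = "\<lambda>z. 2 * x j z + (x j z)\<^sup>2" and ?b = "\<lambda>z. 2 * (\<Sum>j\<in>J. x j z) + (\<Sum>j\<in>J. x j z)\<^sup>2"
    and ?c = "\<lambda>z. \<Sum>j\<in>J. 2 * x j z + (x j z)\<^sup>2"
  have "coeff_le (\<lambda>z. ?a z + ?c z)
    (\<lambda>z. ?a z + ?b z)"
    by (intro coeff_le_add insert coeff_le_refl)
  moreover have "coeff_le (\<lambda>z. ?a z + ?b z)
     (\<lambda>z. (?a z + ?b z) + 2 * x j z * (\<Sum>j\<in>J. x j z))"
    by (intro coeff_le_add_nonneg nonneg_coeffs.mult nonneg_coeffs.const nonneg_coeffs_sum assms) auto
  ultimately have "coeff_le (\<lambda>z. ?a z + ?c z)
     (\<lambda>z. (?a z + ?b z) + 2 * x j z * (\<Sum>j\<in>J. x j z))"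
    by (rule coeff_le_trans)
  then show ?case using insert by (simp add: algebra_simps power2_eq_square)
qed (simp_all add: coeff_le_refl)


text \<open>One explicit Euler step for both equations: \<open>a\<close> holds the relaxation rates
  of the coordinates of Y, \<open>s\<close> their noise intensities, \<open>D\<close> is the step of
  the dissipative part and \<open>A i\<close> the operator that multiplies coordinate i. The
  condition \<open>a i * h \<le> 1\<close> keeps \<open>1 - a i * h\<close> nonnegative, so that the
  majorants have nonnegative coefficients.\<close>

locale euler_scheme =
  fixes h :: real and a s r y0 :: "'i::finite \<Rightarrow> real"
    and D :: "'v::euclidean_space \<Rightarrow> 'v" and A :: "'i \<Rightarrow> 'v \<Rightarrow> 'v" and x0 :: 'v
  assumes h_pos: "0 < h" and a_pos: "\<And>i. 0 < a i" and a_h: "\<And>i. a i * h \<le> 1"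
    and s_nonneg: "\<And>i. 0 \<le> s i" and r_nonneg: "\<And>i. 0 \<le> r i"
    and linear_D: "linear D" and norm_D: "\<And>v. norm (D v) \<le> norm v"
    and linear_A: "\<And>i. linear (A i)" and norm_A: "\<And>i v. norm (A i v) \<le> r i * norm v"
    and norm_x0: "norm x0 \<le> 1"
begin

primrec y :: "nat \<Rightarrow> 'i \<Rightarrow> (nat \<times> 'i \<Rightarrow> real) \<Rightarrow> real" where
  "y 0 i z = y0 i"
| "y (Suc k) i z = (1 - a i * h) * y k i z + s i * z (k, i)"

primrec x :: "nat \<Rightarrow> (nat \<times> 'i \<Rightarrow> real) \<Rightarrow> 'v" where
  "x 0 z = x0"
| "x (Suc k) z = D (x k z) + (\<Sum>i\<in>UNIV. (h * y k i z) *\<^sub>R A i (x k z))"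

primrec y_maj :: "nat \<Rightarrow> 'i \<Rightarrow> (nat \<Rightarrow> real) \<Rightarrow> real" where
  "y_maj 0 i z = \<bar>y0 i\<bar>"
| "y_maj (Suc k) i z = (1 - a i * h) * y_maj k i z + s i * z k"

text \<open>The \<open>Z\<^sub>k\<close> of the overview: it majorizes the factor that relates the
  noise part of step k to the size of x.\<close>

definition z_maj :: "nat \<Rightarrow> (nat \<Rightarrow> real) \<Rightarrow> real" where
  "z_maj k z = (\<Sum>i\<in>UNIV. h * r i * y_maj k i z)"

text \<open>Equal to \<open>|x (Suc k)|^2 - |D (x k)|^2\<close>, so the loss of norm under
  \<open>D\<close> does not enter. It is written out as a polynomial in order to be
  majorized.\<close>

definition energy_step :: "nat \<Rightarrow> (nat \<times> 'i \<Rightarrow> real) \<Rightarrow> real" where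
  "energy_step k z = 2 * (D (x k z) \<bullet> (x (Suc k) z - D (x k z))) + (norm (x (Suc k) z - D (x k z)))\<^sup>2"

lemma norm_x_le_energy: "(norm (x k z))\<^sup>2 \<le> 1 + (\<Sum>j<k. energy_step j z)"
proof (induction k)
  case 0
  show ?case using norm_x0 by (simp add: power_le_one)
next
  case (Suc k)
  have "(norm (x (Suc k) z))\<^sup>2 = (norm (D (x k z) + (x (Suc k) z - D (x k z))))\<^sup>2" by simp
  also have "\<dots> = (norm (D (x k z)))\<^sup>2 + energy_step k z"
    unfolding energy_step_def by (simp add: power2_norm_eq_inner algebra_simps inner_commute)
  also have "(norm (D (x k z)))\<^sup>2 \<le> (norm (x k z))\<^sup>2"
    by (intro power_mono norm_D) auto
  finally show ?case using Suc by simp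
qed

lemma y_majorized: "majorized (y k i) (y_maj k i)"
proof (induction k)
  case 0
  show ?case by (simp add: majorized_const fun_eq_iff y.simps(1)[abs_def] y_maj.simps(1)[abs_def])
next
  case (Suc k)
  show ?case unfolding y.simps(2)[abs_def] y_maj.simps(2)[abs_def]
    by (intro majorized_add majorized_mult majorized_const Suc majorized_symbol)
      (use a_h s_nonneg in \<open>auto simp: mult.commute\<close>)
qed

lemma y_maj_nonneg: "nonneg_coeffs (y_maj k i)"
proof (induction k)
  case (Suc k)
  show ?case unfolding y_maj.simps(2)[abs_def]
    by (intro nonneg_coeffs.add nonneg_coeffs.mult nonneg_coeffs.const Suc nonneg_coeffs.symbol)
      (use a_h s_nonneg in auto)
qed (simp add: y_maj.simps(1)[abs_def] nonneg_coeffs.const)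

lemma z_maj_nonneg: "nonneg_coeffs (z_maj k)"
  unfolding z_maj_def[abs_def] using h_pos
  by (intro nonneg_coeffs_sum nonneg_coeffs.mult nonneg_coeffs.const y_maj_nonneg)
    (auto simp: r_nonneg)

lemma increment_majorized:
  assumes "majorized (x k) p"
  shows "majorized (\<lambda>z. x (Suc k) z - D (x k z)) (\<lambda>z. z_maj k z * p z)"
proof -
  have "majorized (\<lambda>z. \<Sum>i\<in>UNIV. (h * y k i z) *\<^sub>R A i (x k z))
      (\<lambda>z. \<Sum>i\<in>UNIV. (h * y_maj k i z) * (r i * p z))"
    using h_pos
    by (intro majorized_sum majorized_scaleR majorized_mult majorized_const y_majorized
        majorized_linear linear_A norm_A r_nonneg assms) auto
  then show ?thesis
    unfolding z_maj_def sum_distrib_right by (simp add: mult_ac)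
qed

lemma x_majorized: "majorized (x k) (\<lambda>z. \<Prod>j<k. 1 + z_maj j z)"
proof (induction k)
  case 0
  show ?case by (simp add: x.simps(1)[abs_def] majorized_const norm_x0)
next
  case (Suc k)
  have "majorized (\<lambda>z. D (x k z) + (x (Suc k) z - D (x k z)))
    (\<lambda>z. 1 * (\<Prod>j<k. 1 + z_maj j z) + z_maj k z * (\<Prod>j<k. 1 + z_maj j z))"
    by (intro majorized_add increment_majorized Suc majorized_linear linear_D) (auto simp: norm_D)
  then show ?case by (simp add: algebra_simps)
qed

lemma energy_step_majorized:
  "majorized (energy_step k) (\<lambda>z. (2 * z_maj k z + (z_maj k z)\<^sup>2) * (\<Prod>j<k. 1 + z_maj j z)\<^sup>2)"
proof -
  have "majorized (\<lambda>z. 2 * (D (x k z) \<bullet> (x (Suc k) z - D (x k z)))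
      + (x (Suc k) z - D (x k z)) \<bullet> (x (Suc k) z - D (x k z)))
    (\<lambda>z. 2 * ((1 * (\<Prod>j<k. 1 + z_maj j z)) * (z_maj k z * (\<Prod>j<k. 1 + z_maj j z)))
      + (z_maj k z * (\<Prod>j<k. 1 + z_maj j z)) * (z_maj k z * (\<Prod>j<k. 1 + z_maj j z)))"
    by (intro majorized_add majorized_mult majorized_const majorized_inner increment_majorized
        x_majorized majorized_linear linear_D) (auto simp: norm_D)
  moreover have "2 * (p * (u * p)) + (u * p) * (u * p) = (2 * u + u\<^sup>2) * p\<^sup>2" for u p :: real
    by (simp add: power2_eq_square algebra_simps)
  ultimately show ?thesis
    unfolding energy_step_def[abs_def] power2_norm_eq_inner by simp
qed

text \<open>The prefix sums of the \<open>z_maj j\<close> lie coefficientwise below the full sum, so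
  all products up to k < n have one common bound, which factors out of the sum over
  \<open>J\<close>. The dependence on \<open>J\<close> is left in the first factor, which will be
  small when \<open>J\<close> is short.\<close>

lemma energy_increment_majorized:
  assumes "J \<subseteq> {..<n}"
  shows "majorized (\<lambda>z. (\<Sum>k\<in>J. energy_step k z) ^ q)
    (\<lambda>z. ((2 * (\<Sum>k\<in>J. z_maj k z) + (\<Sum>k\<in>J. z_maj k z)\<^sup>2)
       * (exp_trunc n (\<Sum>k<n. z_maj k z))\<^sup>2) ^ q)"
proof -
  let ?e = "\<lambda>z. exp_trunc n (\<Sum>k<n. z_maj k z)"
  have nn: "nonneg_coeffs (\<lambda>z. \<Prod>j<k. 1 + z_maj j z)" for k
    by (induction k)
      (auto intro!: nonneg_coeffs.const nonneg_coeffs.mult nonneg_coeffs.add z_maj_nonneg)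
  have nn2: "nonneg_coeffs (\<lambda>z. 2 * z_maj k z + (z_maj k z)\<^sup>2)" for k
    by (intro nonneg_coeffs.const nonneg_coeffs.mult nonneg_coeffs.add z_maj_nonneg
        nonneg_coeffs_power) auto
  have nne: "nonneg_coeffs (\<lambda>z. (?e z)\<^sup>2)"
    by (intro nonneg_coeffs_power nonneg_coeffs_exp_trunc nonneg_coeffs_sum z_maj_nonneg)
  have "coeff_le (\<lambda>z. \<Prod>j<k. 1 + z_maj j z) ?e" if "k < n" for k
  proof -
    have eq: "(\<Sum>j<n. z_maj j z) = (\<Sum>j<k. z_maj j z) + (\<Sum>j\<in>{k..<n}. z_maj j z)" for z
      using sum.atLeastLessThan_concat[of 0 k n "\<lambda>j. z_maj j z"] that
      by (simp add: lessThan_atLeast0)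
    have "coeff_le (\<lambda>z. \<Sum>j<k. z_maj j z) (\<lambda>z. \<Sum>j<n. z_maj j z)"
      unfolding eq by (intro coeff_le_add_nonneg nonneg_coeffs_sum z_maj_nonneg)
    then have "coeff_le (\<lambda>z. exp_trunc k (\<Sum>j<k. z_maj j z)) ?e"
      using that by (intro exp_trunc_mono nonneg_coeffs_sum z_maj_nonneg) auto
    with prod_le_exp_trunc[OF z_maj_nonneg] show ?thesis
      by (rule coeff_le_trans)
  qed
  then have "majorized (energy_step k) (\<lambda>z. (2 * z_maj k z + (z_maj k z)\<^sup>2) * (?e z)\<^sup>2)"
    if "k \<in> J" for k
    using that assms
    by (intro majorized_mono[OF energy_step_majorized] coeff_le_mult coeff_le_refl coeff_le_power
        nn nn2 nne) auto
  then have "majorized (\<lambda>z. \<Sum>k\<in>J. energy_step k z)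
      (\<lambda>z. \<Sum>k\<in>J. (2 * z_maj k z + (z_maj k z)\<^sup>2) * (?e z)\<^sup>2)"
    by (intro majorized_sum) auto
  moreover have "coeff_le (\<lambda>z. (\<Sum>k\<in>J. 2 * z_maj k z + (z_maj k z)\<^sup>2) * (?e z)\<^sup>2)
     (\<lambda>z. (2 * (\<Sum>k\<in>J. z_maj k z) + (\<Sum>k\<in>J. z_maj k z)\<^sup>2) * (?e z)\<^sup>2)"
    by (intro coeff_le_mult coeff_le_sum_squares coeff_le_refl nne nonneg_coeffs_sum nn2 z_maj_nonneg)
  ultimately show ?thesis
    unfolding sum_distrib_right[symmetric] by (intro majorized_power) (rule majorized_mono)
qed

end

section \<open>Moments of the Euler scheme\<close>

text \<open>The comparison is assumed for single words and extends to polynomials by linearity. It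
  also forces the mean of each word in the reference variables to be nonnegative, so that a
  coefficient \<open>c\<close> may be replaced by the bound \<open>d\<close> of its norm.\<close>

lemma majorized_expectation:
  fixes X :: "('k \<times> 'i \<Rightarrow> real) \<Rightarrow> real" and \<xi> :: "'k \<times> 'i \<Rightarrow> 'w \<Rightarrow> real" and \<zeta> :: "'k \<Rightarrow> 'w \<Rightarrow> real"
  assumes "majorized X x"
    and int: "\<And>w. integrable M (\<lambda>\<omega>. prod_list (map (\<lambda>s. \<xi> s \<omega>) w))"
      "\<And>w. integrable M (\<lambda>\<omega>. prod_list (map (\<lambda>k. \<zeta> k \<omega>) w))"
    and le: "\<And>w. \<bar>\<integral>\<omega>. prod_list (map (\<lambda>s. \<xi> s \<omega>) w) \<partial>M\<bar>
      \<le> (\<integral>\<omega>. prod_list (map (\<lambda>s. \<zeta> (fst s) \<omega>) w) \<partial>M)"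
  shows "integrable M (\<lambda>\<omega>. X (\<lambda>s. \<xi> s \<omega>))" (is ?A) "integrable M (\<lambda>\<omega>. x (\<lambda>k. \<zeta> k \<omega>))" (is ?B)
    "\<bar>\<integral>\<omega>. X (\<lambda>s. \<xi> s \<omega>) \<partial>M\<bar> \<le> (\<integral>\<omega>. x (\<lambda>k. \<zeta> k \<omega>) \<partial>M)" (is ?C)
proof -
  obtain L where L: "\<And>c d w. (c, d, w) \<in> set L \<Longrightarrow> norm c \<le> d"
    "\<And>z. X z = (\<Sum>(c, d, w)\<leftarrow>L. prod_list (map z w) *\<^sub>R c)"
    "\<And>z. x z = (\<Sum>(c, d, w)\<leftarrow>L. d * prod_list (map (z \<circ> fst) w))"
    using assms(1) by (rule majorizedE) blast
  define XL where "XL L' z = (\<Sum>(c::real, d::real, w)\<leftarrow>L'. prod_list (map z w) *\<^sub>R c)"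
    for L' and z :: "'k \<times> 'i \<Rightarrow> real"
  define xL where "xL L' z = (\<Sum>(c::real, d::real, w)\<leftarrow>L'. d * prod_list (map (z \<circ> fst) w))"
    for L' :: "(real \<times> real \<times> ('k \<times> 'i) list) list" and z :: "'k \<Rightarrow> real"
  have int2: "integrable M (\<lambda>\<omega>. prod_list (map ((\<lambda>k. \<zeta> k \<omega>) \<circ> fst) w))" for w :: "('k \<times> 'i) list"
    using int(2)[of "map fst w"] by simp
  have "integrable M (\<lambda>\<omega>. XL L' (\<lambda>s. \<xi> s \<omega>)) \<and> integrable M (\<lambda>\<omega>. xL L' (\<lambda>k. \<zeta> k \<omega>)) \<and>
    \<bar>\<integral>\<omega>. XL L' (\<lambda>s. \<xi> s \<omega>) \<partial>M\<bar> \<le> (\<integral>\<omega>. xL L' (\<lambda>k. \<zeta> k \<omega>) \<partial>M)"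
    if "\<And>c d w. (c, d, w) \<in> set L' \<Longrightarrow> norm c \<le> d" for L'
    using that
  proof (induction L')
    case Nil
    show ?case by (simp add: XL_def xL_def)
  next
    case (Cons p L')
    obtain c d w where p: "p = (c, d, w)" by (cases p)
    have IH: "integrable M (\<lambda>\<omega>. XL L' (\<lambda>s. \<xi> s \<omega>))" "integrable M (\<lambda>\<omega>. xL L' (\<lambda>k. \<zeta> k \<omega>))"
      "\<bar>\<integral>\<omega>. XL L' (\<lambda>s. \<xi> s \<omega>) \<partial>M\<bar> \<le> (\<integral>\<omega>. xL L' (\<lambda>k. \<zeta> k \<omega>) \<partial>M)"
      using Cons by auto
    have XC: "XL (p # L') z = prod_list (map z w) *\<^sub>R c + XL L' z" for z
      by (simp add: XL_def p)
    have xC: "xL (p # L') z = d * prod_list (map (z \<circ> fst) w) + xL L' z" for z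
      by (simp add: xL_def p)
    have c: "\<bar>c\<bar> \<le> d" using Cons(2)[of c d w] p by auto
    have "\<bar>\<integral>\<omega>. XL (p # L') (\<lambda>s. \<xi> s \<omega>) \<partial>M\<bar>
        = \<bar>c * (\<integral>\<omega>. prod_list (map (\<lambda>s. \<xi> s \<omega>) w) \<partial>M) + (\<integral>\<omega>. XL L' (\<lambda>s. \<xi> s \<omega>) \<partial>M)\<bar>"
      unfolding XC using int(1) IH(1) by (simp add: mult.commute)
    also have "\<dots> \<le> \<bar>c\<bar> * \<bar>\<integral>\<omega>. prod_list (map (\<lambda>s. \<xi> s \<omega>) w) \<partial>M\<bar> + \<bar>\<integral>\<omega>. XL L' (\<lambda>s. \<xi> s \<omega>) \<partial>M\<bar>"
      by (rule order_trans[OF abs_triangle_ineq]) (simp add: abs_mult)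
    also have "\<dots> \<le> d * (\<integral>\<omega>. prod_list (map (\<lambda>s. \<zeta> (fst s) \<omega>) w) \<partial>M) + (\<integral>\<omega>. xL L' (\<lambda>k. \<zeta> k \<omega>) \<partial>M)"
      using c by (intro add_mono mult_mono le IH) auto
    also have "\<dots> = (\<integral>\<omega>. xL (p # L') (\<lambda>k. \<zeta> k \<omega>) \<partial>M)"
      unfolding xC using int2 IH(2) by (simp add: o_def)
    finally show ?case using IH int(1) int2 unfolding XC xC by simp
  qed
  from this[OF L(1)] show ?A ?B ?C
    unfolding L(2,3) XL_def xL_def by auto
qed

section \<open>Geometric weights and dyadic decomposition of partial sums\<close>

lemma geometric_weights_le_1:
  fixes q :: real
  assumes "0 < q" "q \<le> 1"
  shows "(\<Sum>l<n. q * (1 - q) ^ l) \<le> 1"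
proof -
  have "(\<Sum>l<n. q * (1 - q) ^ l) = 1 - (1 - q) ^ n"
    by (induction n) (auto simp: algebra_simps)
  then show ?thesis using assms by simp
qed

text \<open>The binary expansion of K writes \<open>{..<K}\<close> as a union of dyadic blocks, at
  most one of each level. Passing from level j to j + 1, an even number i of blocks gives the same
  prefix as i div 2 coarser ones, and an odd number leaves over one block, the one with index i -
  1.\<close>

lemma dyadic_partial_sum_le:
  fixes f :: "nat \<Rightarrow> real"
  assumes "\<And>j i. j \<le> N \<Longrightarrow> i < 2 ^ j \<Longrightarrow> \<bar>\<Sum>k\<in>{i * 2 ^ (N - j)..<Suc i * 2 ^ (N - j)}. f k\<bar> \<le> b j"
    and "K \<le> 2 ^ N"
  shows "\<bar>\<Sum>k<K. f k\<bar> \<le> (\<Sum>j\<le>N. b j)"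
proof -
  have b: "0 \<le> b j" if "j \<le> N" for j
    using order_trans[OF abs_ge_zero assms(1)[OF that, of 0]] by simp
  have "\<bar>\<Sum>k<i * 2 ^ (N - j). f k\<bar> \<le> (\<Sum>l\<le>j. b l)" if "j \<le> N" "i \<le> 2 ^ j" for i j
    using that
  proof (induction j arbitrary: i)
    case 0
    then consider "i = 0" | "i = 1" by force
    then show ?case
    proof cases
      case 2
      then show ?thesis using assms(1)[of 0 0] by (simp add: lessThan_atLeast0)
    qed (use b in auto)
  next
    case (Suc j)
    define i' where "i' = i div 2"
    have i': "i' \<le> 2 ^ j" using Suc.prems(2) unfolding i'_def by simp
    have pow: "2 ^ (N - j) = (2::nat) * 2 ^ (N - Suc j)"
      using Suc.prems(1) by (metis Suc_diff_le Suc_le_lessD diff_Suc_Suc power_Suc Suc_diff_Suc)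
    have IH: "\<bar>\<Sum>k<i' * 2 ^ (N - j). f k\<bar> \<le> (\<Sum>l\<le>j. b l)"
      using Suc i' by simp
    show ?case
    proof (cases "even i")
      case True
      then have "i * 2 ^ (N - Suc j) = i' * 2 ^ (N - j)" unfolding pow i'_def by auto
      then show ?thesis using IH b[OF Suc.prems(1)] by simp
    next
      case False
      then have i: "i = 2 * i' + 1" unfolding i'_def by presburger
      let ?J = "{(i - 1) * 2 ^ (N - Suc j)..<Suc (i - 1) * 2 ^ (N - Suc j)}"
      have e: "i' * 2 ^ (N - j) = (i - 1) * 2 ^ (N - Suc j)" unfolding pow i by simp
      have "(\<Sum>k<i * 2 ^ (N - Suc j). f k) = (\<Sum>k<i' * 2 ^ (N - j). f k)
          + (\<Sum>k\<in>?J. f k)"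
        unfolding e lessThan_atLeast0 by (subst sum.atLeastLessThan_concat) (auto simp: i)
      moreover have "\<bar>\<Sum>k\<in>?J. f k\<bar> \<le> b (Suc j)"
        using Suc.prems i by (intro assms(1)) auto
      ultimately show ?thesis using IH unfolding sum.atMost_Suc by linarith
    qed
  qed
  from this[of N K] assms(2) show ?thesis by simp
qed

text \<open>The weights \<open>(25/16)\<^sup>m = (5/4)\<^sup>2\<^sup>m\<close> are chosen so that \<open>\<Sum> (4/5)\<^sup>j = 5\<close> and \<open>2 (25/32)\<^sup>m < 1\<close> for \<open>m \<ge> 3\<close>.\<close>

lemma dyadic_partial_sum_power_le:
  fixes f :: "nat \<Rightarrow> real"
  assumes "K \<le> 2 ^ N" "0 < m"
  shows "(\<Sum>k<K. f k) ^ (2 * m) \<le> 25 ^ m * (\<Sum>j\<le>N. \<Sum>i<2 ^ j. ((25 / 16) ^ m) ^ j *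
      (\<Sum>k\<in>{i * 2 ^ (N - j)..<Suc i * 2 ^ (N - j)}. f k) ^ (2 * m))"
    (is "_ \<le> _ * ?W")
proof -
  define \<Delta> where "\<Delta> j i = (\<Sum>k\<in>{i * 2 ^ (N - j)..<Suc i * 2 ^ (N - j)}. f k)" for j i
  \<comment> \<open>With this root every block of level j is at most
    \<open>(4 / 5) ^ j * \<rho>\<close>, because its weighted power is one nonnegative term of the
    double sum. This takes the place of a maximum over blocks.\<close>
  define \<rho> where "\<rho> = root (2 * m) ?W"
  have nn: "0 \<le> ((25 / 16) ^ m) ^ j * \<Delta> j i ^ (2 * m)" for i j by simp
  have W0: "0 \<le> ?W" unfolding \<Delta>_def[symmetric] by (intro sum_nonneg nn)
  then have \<rho>: "\<rho> ^ (2 * m) = ?W" "0 \<le> \<rho>" unfolding \<rho>_def using assms by auto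
  have "\<bar>\<Delta> j i\<bar> \<le> (4 / 5) ^ j * \<rho>" if "j \<le> N" "i < 2 ^ j" for j i
  proof -
    have "((25 / 16) ^ m) ^ j * \<Delta> j i ^ (2 * m) \<le> (\<Sum>i<2 ^ j. ((25 / 16) ^ m) ^ j * \<Delta> j i ^ (2 * m))"
      using that by (intro member_le_sum nn) auto
    also have "\<dots> \<le> ?W" unfolding \<Delta>_def[symmetric]
      using that by (intro member_le_sum[where f = "\<lambda>j. \<Sum>i<2 ^ j. ((25 / 16) ^ m) ^ j * \<Delta> j i ^ (2 * m)"] sum_nonneg nn) auto
    finally have 1: "((25 / 16) ^ m) ^ j * \<Delta> j i ^ (2 * m) \<le> \<rho> ^ (2 * m)" using \<rho> by simp
    have "((25 / 16) ^ m) ^ j = ((5 / 4 :: real) ^ j) ^ (2 * m)"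
    proof -
      have "(25 / 16 :: real) = (5 / 4) ^ 2" by (simp add: power2_eq_square)
      then show ?thesis by (simp only: power_mult[symmetric]) (simp add: mult_ac)
    qed
    then have "((5 / 4) ^ j * \<bar>\<Delta> j i\<bar>) ^ (2 * m) \<le> \<rho> ^ (2 * m)"
      using 1 by (simp add: power_mult_distrib power_even_abs)
    then have "(5 / 4) ^ j * \<bar>\<Delta> j i\<bar> \<le> \<rho>"
      using \<rho>(2) assms(2) by (simp add: power_mono_iff)
    then have "(4 / 5) ^ j * ((5 / 4) ^ j * \<bar>\<Delta> j i\<bar>) \<le> (4 / 5) ^ j * \<rho>"
      by (intro mult_left_mono) auto
    then show ?thesis by (simp add: mult.assoc[symmetric] power_mult_distrib[symmetric])
  qed
  then have "\<bar>\<Sum>k<K. f k\<bar> \<le> (\<Sum>j\<le>N. (4 / 5) ^ j * \<rho>)"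
    using assms(1) unfolding \<Delta>_def by (intro dyadic_partial_sum_le) auto
  also have "\<dots> = 5 * (\<Sum>j<Suc N. 1 / 5 * (1 - 1 / 5) ^ j) * \<rho>"
    by (simp add: lessThan_Suc_atMost sum_distrib_right sum_distrib_left)
  also have "\<dots> \<le> 5 * 1 * \<rho>"
    using geometric_weights_le_1[of "1 / 5" "Suc N"] \<rho>(2) by (intro mult_right_mono mult_left_mono) auto
  finally have "\<bar>\<Sum>k<K. f k\<bar> ^ (2 * m) \<le> (5 * \<rho>) ^ (2 * m)"
    by (intro power_mono) auto
  also have "\<dots> = 25 ^ m * ?W"
    unfolding power_mult_distrib \<rho>(1) by (simp add: power_mult)
  finally show ?thesis by (simp add: power_even_abs)
qed

section \<open>Exponential moments of Gaussian sums\<close>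

lemma normal_exp_moment:
  assumes "0 < \<sigma>"
  shows "integrable lborel (\<lambda>x. normal_density 0 \<sigma> x * exp (c * x))"
    and "(\<integral>x. normal_density 0 \<sigma> x * exp (c * x) \<partial>lborel) = exp (\<sigma>\<^sup>2 * c\<^sup>2 / 2)"
proof -
  have eq: "normal_density 0 \<sigma> x * exp (c * x) = exp (\<sigma>\<^sup>2 * c\<^sup>2 / 2) * normal_density (\<sigma>\<^sup>2 * c) \<sigma> x" for x
  proof -
    have "- x\<^sup>2 / (2 * \<sigma>\<^sup>2) + c * x = \<sigma>\<^sup>2 * c\<^sup>2 / 2 + - (x - \<sigma>\<^sup>2 * c)\<^sup>2 / (2 * \<sigma>\<^sup>2)"
      using assms by (simp add: power2_eq_square field_simps)
    then have "exp (- x\<^sup>2 / (2 * \<sigma>\<^sup>2)) * exp (c * x) = exp (\<sigma>\<^sup>2 * c\<^sup>2 / 2) * exp (- (x - \<sigma>\<^sup>2 * c)\<^sup>2 / (2 * \<sigma>\<^sup>2))"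
      by (simp only: exp_add[symmetric])
    then show ?thesis by (simp add: normal_density_def)
  qed
  show "integrable lborel (\<lambda>x. normal_density 0 \<sigma> x * exp (c * x))"
    unfolding eq using assms by (intro integrable_mult_right integrable_normal_density)
  show "(\<integral>x. normal_density 0 \<sigma> x * exp (c * x) \<partial>lborel) = exp (\<sigma>\<^sup>2 * c\<^sup>2 / 2)"
    unfolding eq using assms by (simp add: integral_normal_density)
qed

context prob_space
begin

lemma indep_normal_exp_moment:
  assumes "indep_vars (\<lambda>_. borel) X J" "finite J" "0 < \<sigma>"
    and "\<And>j. j \<in> J \<Longrightarrow> distributed M lborel (X j) (normal_density 0 \<sigma>)"
  shows "integrable M (\<lambda>\<omega>. exp (\<mu> + (\<Sum>j\<in>J. c j * X j \<omega>)))"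
    and "expectation (\<lambda>\<omega>. exp (\<mu> + (\<Sum>j\<in>J. c j * X j \<omega>))) = exp (\<mu> + \<sigma>\<^sup>2 * (\<Sum>j\<in>J. (c j)\<^sup>2) / 2)"
proof -
  have rv: "X j \<in> borel_measurable M" if "j \<in> J" for j
    using distributed_measurable[OF assms(4)[OF that]] by simp
  have int: "integrable M (\<lambda>\<omega>. exp (c j * X j \<omega>))" if "j \<in> J" for j
    using distributed_integrable[OF assms(4)[OF that], of "\<lambda>x. exp (c j * x)"] normal_exp_moment(1)[OF assms(3)]
    by simp
  have E: "expectation (\<lambda>\<omega>. exp (c j * X j \<omega>)) = exp (\<sigma>\<^sup>2 * (c j)\<^sup>2 / 2)" if "j \<in> J" for j
    using distributed_integral[OF assms(4)[OF that], of "\<lambda>x. exp (c j * x)"] normal_exp_moment(2)[OF assms(3)]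
    by simp
  have ind: "indep_vars (\<lambda>_. borel) (\<lambda>j \<omega>. exp (c j * X j \<omega>)) J"
    by (rule indep_vars_compose2[OF assms(1)]) auto
  have eq: "exp (\<mu> + (\<Sum>j\<in>J. c j * X j \<omega>)) = exp \<mu> * (\<Prod>j\<in>J. exp (c j * X j \<omega>))" for \<omega>
    by (simp add: exp_add exp_sum[OF assms(2)])
  show "integrable M (\<lambda>\<omega>. exp (\<mu> + (\<Sum>j\<in>J. c j * X j \<omega>)))"
    unfolding eq by (intro integrable_mult_right indep_vars_integrable[OF assms(2) ind] int)
  have "expectation (\<lambda>\<omega>. \<Prod>j\<in>J. exp (c j * X j \<omega>)) = (\<Prod>j\<in>J. exp (\<sigma>\<^sup>2 * (c j)\<^sup>2 / 2))"
    using indep_vars_lebesgue_integral[OF assms(2) ind int] E by simp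
  then show "expectation (\<lambda>\<omega>. exp (\<mu> + (\<Sum>j\<in>J. c j * X j \<omega>))) = exp (\<mu> + \<sigma>\<^sup>2 * (\<Sum>j\<in>J. (c j)\<^sup>2) / 2)"
    unfolding eq by (simp add: exp_add exp_sum[OF assms(2), symmetric] sum_distrib_left sum_divide_distrib)
qed

end


text \<open>With \<open>q = a * h\<close> these are Riemann sums for the kernel of an
  Ornstein-Uhlenbeck process of rate a, bounded uniformly in a. The first two are a supremum bound
  and an l1 bound for noise coefficients; together they bound the sum of squares, hence a variance,
  by v - u. The third, by Cauchy-Schwarz, is the contribution of the initial value and has the order
  of the corresponding standard deviation.\<close>

lemma geometric_weights_coeff_bounds:
  fixes q :: real
  assumes q: "0 < q" "q \<le> 1"
  shows "(\<Sum>k\<in>{k\<in>{u..<v}. j < k}. q * (1 - q) ^ (k - 1 - j)) \<le> 1" (is "?S \<le> 1")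
    and "(\<Sum>j<v. \<Sum>k\<in>{k\<in>{u..<v}. j < k}. q * (1 - q) ^ (k - 1 - j)) \<le> real (v - u)" (is "?SS \<le> _")
    and "(\<Sum>k\<in>{u..<v}. sqrt q * (1 - q) ^ k) \<le> sqrt (real (v - u))"
proof -
  have nn: "0 \<le> q * (1 - q) ^ n" for n using q by simp
  have "?S = (\<Sum>l\<in>(\<lambda>k. k - 1 - j) ` {k\<in>{u..<v}. j < k}. q * (1 - q) ^ l)"
    by (subst sum.reindex) (auto simp: inj_on_def)
  also have "\<dots> \<le> (\<Sum>l<v. q * (1 - q) ^ l)"
    by (intro sum_mono2) (auto simp: nn)
  finally show "?S \<le> 1"
    using geometric_weights_le_1[OF q] order_trans by blast
  have "?SS = (\<Sum>k\<in>{u..<v}. \<Sum>j\<in>{j\<in>{..<v}. j < k}. q * (1 - q) ^ (k - 1 - j))"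
    by (rule sum.swap_restrict) auto
  also have "\<dots> \<le> (\<Sum>k\<in>{u..<v}. 1)"
  proof (rule sum_mono)
    fix k assume "k \<in> {u..<v}"
    then have "{j\<in>{..<v}. j < k} = {..<k}" by auto
    then have "(\<Sum>j\<in>{j\<in>{..<v}. j < k}. q * (1 - q) ^ (k - 1 - j)) = (\<Sum>j<k. q * (1 - q) ^ j)"
      using sum.nat_diff_reindex[of "\<lambda>l. q * (1 - q) ^ l" k] by simp
    then show "(\<Sum>j\<in>{j\<in>{..<v}. j < k}. q * (1 - q) ^ (k - 1 - j)) \<le> 1"
      using geometric_weights_le_1[OF q] by simp
  qed
  finally show "?SS \<le> real (v - u)"
    by simp
  have "(\<Sum>k\<in>{u..<v}. sqrt q * (1 - q) ^ k)\<^sup>2 \<le> (\<Sum>k\<in>{u..<v}. (sqrt q * (1 - q) ^ k)\<^sup>2) * real (v - u)"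
    using sum_squared_le_sum_of_squares[of "\<lambda>k. sqrt q * (1 - q) ^ k" "{u..<v}"] by simp
  also have "(\<Sum>k\<in>{u..<v}. (sqrt q * (1 - q) ^ k)\<^sup>2) \<le> (\<Sum>k<v. q * (1 - q) ^ k)"
  proof (rule order_trans[OF sum_mono[where g = "\<lambda>k. q * (1 - q) ^ k"]])
    fix k
    have "((1 - q) ^ k)\<^sup>2 \<le> (1 - q) ^ k"
      using q mult_right_le_one_le[of "(1 - q) ^ k" "(1 - q) ^ k"] by (simp add: power2_eq_square power_le_one)
    then show "(sqrt q * (1 - q) ^ k)\<^sup>2 \<le> q * (1 - q) ^ k"
      using q by (simp add: power_mult_distrib mult_left_mono)
  next
    show "(\<Sum>k\<in>{u..<v}. q * (1 - q) ^ k) \<le> (\<Sum>k<v. q * (1 - q) ^ k)"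
      by (intro sum_mono2) (auto simp: nn)
  qed
  also have "(\<Sum>k<v. q * (1 - q) ^ k) \<le> 1" by (rule geometric_weights_le_1[OF q])
  finally have "(\<Sum>k\<in>{u..<v}. sqrt q * (1 - q) ^ k)\<^sup>2 \<le> real (v - u)"
    by (simp add: mult_right_mono)
  then show "(\<Sum>k\<in>{u..<v}. sqrt q * (1 - q) ^ k) \<le> sqrt (real (v - u))"
    by (rule real_le_rsqrt)
qed

text \<open>Removes the absolute values from an exponent, leaving exponentials of Gaussian
  variables, whose means are explicit.\<close>

lemma exp_abs_abs_le:
  fixes a b :: real
  shows "exp (\<bar>a\<bar> + \<bar>b\<bar>) \<le> exp (a + b) + exp (a - b) + exp (- a + b) + exp (- a - b)"
proof -
  have "exp (\<bar>a\<bar> + \<bar>b\<bar>) \<in> {exp (a + b), exp (a - b), exp (- a + b), exp (- a - b)}"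
    by (auto simp: abs_if)
  then show ?thesis
    using exp_gt_zero[of "a + b"] exp_gt_zero[of "a - b"] exp_gt_zero[of "- a + b"] exp_gt_zero[of "- a - b"]
    by (elim insertE) (auto intro: add_nonneg_nonneg less_imp_le)
qed

context euler_scheme
begin

text \<open>Summed over u \<le> k < v, the \<open>z_maj k\<close> form an affine function of the
  noise. This is its constant term, and \<open>z_coeff\<close> gives its coefficients; noise j acts
  from step j + 1 on, whence the restriction \<open>j < k\<close> there.\<close>

definition z_mean :: "nat \<Rightarrow> nat \<Rightarrow> real" where
  "z_mean u v = (\<Sum>i\<in>UNIV. h * r i * \<bar>y0 i\<bar> * (\<Sum>k\<in>{u..<v}. (1 - a i * h) ^ k))"

definition z_coeff :: "nat \<Rightarrow> nat \<Rightarrow> nat \<Rightarrow> real" where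
  "z_coeff u v j = (\<Sum>i\<in>UNIV. h * r i * s i * (\<Sum>k\<in>{k\<in>{u..<v}. j < k}. (1 - a i * h) ^ (k - 1 - j)))"

lemma y_maj_explicit:
  "y_maj k i z = (1 - a i * h) ^ k * \<bar>y0 i\<bar> + s i * (\<Sum>j<k. (1 - a i * h) ^ (k - 1 - j) * z j)"
proof (induction k)
  case (Suc k)
  have "(\<Sum>j<k. (1 - a i * h) ^ (k - j) * z j) = (\<Sum>j<k. (1 - a i * h) * ((1 - a i * h) ^ (k - 1 - j) * z j))"
  proof (rule sum.cong)
    fix j assume "j \<in> {..<k}"
    then have "k - j = Suc (k - 1 - j)" by auto
    then show "(1 - a i * h) ^ (k - j) * z j = (1 - a i * h) * ((1 - a i * h) ^ (k - 1 - j) * z j)"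
      by simp
  qed simp
  then show ?case by (simp add: Suc algebra_simps sum_distrib_left)
qed simp

lemma sum_z_maj: "(\<Sum>k\<in>{u..<v}. z_maj k z) = z_mean u v + (\<Sum>j<v. z_coeff u v j * z j)"
proof -
  define S where "S i j = (\<Sum>k\<in>{k\<in>{u..<v}. j < k}. (1 - a i * h) ^ (k - 1 - j))" for i j
  have swap: "(\<Sum>k\<in>{u..<v}. \<Sum>j<k. (1 - a i * h) ^ (k - 1 - j) * z j) = (\<Sum>j<v. S i j * z j)" for i
  proof -
    have "(\<Sum>k\<in>{u..<v}. \<Sum>j<k. (1 - a i * h) ^ (k - 1 - j) * z j)
       = (\<Sum>k\<in>{u..<v}. \<Sum>j\<in>{j\<in>{..<v}. j < k}. (1 - a i * h) ^ (k - 1 - j) * z j)"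
      by (intro sum.cong refl) auto
    also have "\<dots> = (\<Sum>j<v. \<Sum>k\<in>{k\<in>{u..<v}. j < k}. (1 - a i * h) ^ (k - 1 - j) * z j)"
      by (rule sum.swap_restrict) auto
    finally show ?thesis by (simp add: sum_distrib_right S_def)
  qed
  have "(\<Sum>k\<in>{u..<v}. y_maj k i z)
      = \<bar>y0 i\<bar> * (\<Sum>k\<in>{u..<v}. (1 - a i * h) ^ k) + s i * (\<Sum>j<v. S i j * z j)" for i
    unfolding y_maj_explicit sum.distrib sum_distrib_left[symmetric] swap sum_distrib_right[symmetric]
    by (simp add: mult.commute)
  moreover have "(\<Sum>k\<in>{u..<v}. z_maj k z) = (\<Sum>i\<in>UNIV. h * r i * (\<Sum>k\<in>{u..<v}. y_maj k i z))"
    unfolding z_maj_def by (subst sum.swap) (simp add: sum_distrib_left)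
  ultimately have "(\<Sum>k\<in>{u..<v}. z_maj k z)
      = z_mean u v + (\<Sum>i\<in>UNIV. h * r i * s i * (\<Sum>j<v. S i j * z j))"
    unfolding z_mean_def by (simp add: distrib_left sum.distrib mult.assoc)
  also have "(\<Sum>i\<in>UNIV. h * r i * s i * (\<Sum>j<v. S i j * z j)) = (\<Sum>i\<in>UNIV. \<Sum>j<v. h * r i * s i * S i j * z j)"
    by (simp add: sum_distrib_left mult.assoc)
  also have "\<dots> = (\<Sum>j<v. z_coeff u v j * z j)"
    unfolding z_coeff_def S_def[symmetric] by (subst sum.swap) (simp add: sum_distrib_right)
  finally show ?thesis .
qed

end

text \<open>The relation \<open>s i = sqrt (a i)\<close> keeps the stationary size of each
  coordinate bounded whatever its rate. Since the bound for \<open>r i\<close> carries another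
  factor \<open>s i\<close>, the product \<open>h * r i * s i\<close> is at most
  \<open>\<kappa> * (a i * h)\<close>, and \<open>a i * h\<close> is just the normalization of the
  geometric weights; so the bounds below are free of the rates. The weights \<open>\<eta> i\<close>
  record how strongly the initial value of each coordinate is felt.\<close>

locale bounded_euler_scheme = euler_scheme h a s r y0 D A x0
  for h :: real and a s r y0 :: "'i::finite \<Rightarrow> real"
    and D :: "'v::euclidean_space \<Rightarrow> 'v" and A :: "'i \<Rightarrow> 'v \<Rightarrow> 'v" and x0 :: 'v +
  fixes \<kappa> :: real and \<eta> :: "'i \<Rightarrow> real"
  assumes kappa_nonneg: "0 \<le> \<kappa>" and eta: "\<And>i. 0 \<le> \<eta> i" "\<And>i. \<eta> i \<le> 1"
    and s_eq: "\<And>i. s i = sqrt (a i)" and r_le: "\<And>i. r i \<le> \<kappa> * \<eta> i * s i"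
begin

definition y0_size :: real where
  "y0_size = (\<Sum>i\<in>UNIV. \<eta> i * \<bar>y0 i\<bar>)"

text \<open>Splitting \<open>h * sqrt (a i)\<close> as \<open>sqrt h * sqrt (a i * h)\<close> leaves
  the third sum of \<open>geometric_weights_coeff_bounds\<close>. The order
  \<open>sqrt ((v - u) * h)\<close> is that of a standard deviation, so mean and fluctuation can be
  normalized by the same factor in \<open>exp_maj_sum\<close>.\<close>

lemma z_mean_bounds:
  "0 \<le> z_mean u v" "z_mean u v \<le> \<kappa> * sqrt (real (v - u) * h) * y0_size"
proof -
  have q: "0 < a i * h" "a i * h \<le> 1" for i using a_pos h_pos a_h by auto
  show "0 \<le> z_mean u v"
    unfolding z_mean_def using h_pos r_nonneg a_h
    by (intro sum_nonneg mult_nonneg_nonneg zero_le_power) auto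
  have "h * r i * \<bar>y0 i\<bar> * (\<Sum>k\<in>{u..<v}. (1 - a i * h) ^ k) \<le> \<kappa> * sqrt (real (v - u) * h) * (\<eta> i * \<bar>y0 i\<bar>)" for i
  proof -
    have "h * r i * \<bar>y0 i\<bar> * (\<Sum>k\<in>{u..<v}. (1 - a i * h) ^ k)
        \<le> h * (\<kappa> * \<eta> i * s i) * \<bar>y0 i\<bar> * (\<Sum>k\<in>{u..<v}. (1 - a i * h) ^ k)"
      using h_pos r_le q by (intro mult_right_mono mult_left_mono sum_nonneg zero_le_power) auto
    also have "\<dots> = \<kappa> * (\<eta> i * \<bar>y0 i\<bar>) * sqrt h * (\<Sum>k\<in>{u..<v}. sqrt (a i * h) * (1 - a i * h) ^ k)"
    proof -
      have "h * s i = sqrt h * sqrt (a i * h)"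
        using h_pos by (simp add: s_eq real_sqrt_mult)
      then have "\<kappa> * (\<eta> i * \<bar>y0 i\<bar>) * (h * s i) * S = \<kappa> * (\<eta> i * \<bar>y0 i\<bar>) * sqrt h * (sqrt (a i * h) * S)" for S
        by (simp only: mult.assoc)
      moreover have "h * (\<kappa> * \<eta> i * s i) * \<bar>y0 i\<bar> * S = \<kappa> * (\<eta> i * \<bar>y0 i\<bar>) * (h * s i) * S" for S
        by (simp only: mult_ac)
      ultimately show ?thesis unfolding sum_distrib_left[symmetric] by (simp only:)
    qed
    also have "\<dots> \<le> \<kappa> * (\<eta> i * \<bar>y0 i\<bar>) * sqrt h * sqrt (real (v - u))"
      using h_pos kappa_nonneg eta by (intro mult_left_mono geometric_weights_coeff_bounds q) auto
    finally show ?thesis by (simp add: real_sqrt_mult mult_ac)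
  qed
  then show "z_mean u v \<le> \<kappa> * sqrt (real (v - u) * h) * y0_size"
    unfolding z_mean_def y0_size_def sum_distrib_left by (rule sum_mono)
qed

text \<open>The coefficients are at most \<open>\<kappa> * e j\<close>, where \<open>e\<close> is
  bounded by the number of coordinates and its sum by that number times v - u; a sum of squares is
  at most the supremum times the sum. This is the variance bound O(t - s), free of the
  rates.\<close>

lemma z_coeff_bound:
  "h * (\<Sum>j<v. (z_coeff u v j)\<^sup>2) \<le> \<kappa>\<^sup>2 * (real CARD('i))\<^sup>2 * (real (v - u) * h)"
proof -
  have q: "0 < a i * h" "a i * h \<le> 1" for i using a_pos h_pos a_h by auto
  define e where "e j = (\<Sum>i\<in>UNIV. \<Sum>k\<in>{k\<in>{u..<v}. j < k}. (a i * h) * (1 - a i * h) ^ (k - 1 - j))" for j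
  have e0: "0 \<le> e j" for j
    unfolding e_def
    by (intro sum_nonneg mult_nonneg_nonneg[OF less_imp_le[OF q(1)]] zero_le_power) (use q in auto)
  have e1: "e j \<le> real CARD('i)" for j
    unfolding e_def
    by (rule order_trans[OF sum_mono[OF geometric_weights_coeff_bounds(1)[OF q]]]) simp
  have e2: "(\<Sum>j<v. e j) \<le> real CARD('i) * real (v - u)"
    unfolding e_def
    by (subst sum.swap) (rule order_trans[OF sum_mono[OF geometric_weights_coeff_bounds(2)[OF q]]], simp)
  have z0: "0 \<le> z_coeff u v j" for j
    unfolding z_coeff_def using h_pos r_nonneg s_nonneg a_h
    by (intro sum_nonneg mult_nonneg_nonneg zero_le_power) auto
  have z: "z_coeff u v j \<le> \<kappa> * e j" for j
    unfolding z_coeff_def e_def sum_distrib_left[of \<kappa>]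
  proof (rule sum_mono)
    fix i
    have "h * r i * s i * (\<Sum>k\<in>{k\<in>{u..<v}. j < k}. (1 - a i * h) ^ (k - 1 - j))
      \<le> (\<kappa> * (a i * h)) * (\<Sum>k\<in>{k\<in>{u..<v}. j < k}. (1 - a i * h) ^ (k - 1 - j))"
    proof (rule mult_right_mono)
      have "r i * s i \<le> (\<kappa> * 1 * s i) * s i"
        using kappa_nonneg eta s_nonneg
        by (intro mult_right_mono order_trans[OF r_le] mult_left_mono) auto
      also have "\<dots> = \<kappa> * a i" using a_pos[of i] by (simp add: s_eq)
      finally show "h * r i * s i \<le> \<kappa> * (a i * h)"
        using mult_left_mono[of _ _ h] h_pos by (simp add: mult_ac)
    qed (use a_h in \<open>auto intro!: sum_nonneg\<close>)
    then show "h * r i * s i * (\<Sum>k\<in>{k\<in>{u..<v}. j < k}. (1 - a i * h) ^ (k - 1 - j))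
      \<le> (\<Sum>k\<in>{k\<in>{u..<v}. j < k}. \<kappa> * ((a i * h) * (1 - a i * h) ^ (k - 1 - j)))"
      by (simp add: sum_distrib_left mult.assoc)
  qed
  have "(\<Sum>j<v. (z_coeff u v j)\<^sup>2) \<le> (\<Sum>j<v. \<kappa>\<^sup>2 * real CARD('i) * e j)"
  proof (rule sum_mono)
    fix j
    have "(z_coeff u v j)\<^sup>2 \<le> (\<kappa> * e j)\<^sup>2" by (intro power_mono z z0)
    also have "\<dots> = \<kappa>\<^sup>2 * (e j * e j)" by (simp add: power2_eq_square)
    also have "\<dots> \<le> \<kappa>\<^sup>2 * (real CARD('i) * e j)"
      by (intro mult_left_mono mult_right_mono e1 e0) auto
    finally show "(z_coeff u v j)\<^sup>2 \<le> \<kappa>\<^sup>2 * real CARD('i) * e j" by simp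
  qed
  also have "\<dots> \<le> \<kappa>\<^sup>2 * real CARD('i) * (real CARD('i) * real (v - u))"
    unfolding sum_distrib_left[symmetric] by (intro mult_left_mono e2) auto
  finally have "h * (\<Sum>j<v. (z_coeff u v j)\<^sup>2) \<le> h * (\<kappa>\<^sup>2 * real CARD('i) * (real CARD('i) * real (v - u)))"
    using h_pos by (intro mult_left_mono) auto
  then show ?thesis by (simp add: power2_eq_square mult_ac)
qed

end

text \<open>The random variables \<open>\<zeta> k\<close> feed the majorants, the \<open>\<xi> (k, i)\<close> the scheme itself.\<close>

locale random_euler_scheme = bounded_euler_scheme h a s r y0 D A x0 \<kappa> \<eta> + prob_space M
  for h :: real and a s r y0 :: "'i::finite \<Rightarrow> real"
    and D :: "'v::euclidean_space \<Rightarrow> 'v" and A :: "'i \<Rightarrow> 'v \<Rightarrow> 'v" and x0 :: 'v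
    and \<kappa> :: real and \<eta> :: "'i \<Rightarrow> real" and M :: "'w measure" +
  fixes \<xi> :: "nat \<times> 'i \<Rightarrow> 'w \<Rightarrow> real" and \<zeta> :: "nat \<Rightarrow> 'w \<Rightarrow> real"
  assumes integrable_xi: "\<And>w. integrable M (\<lambda>\<omega>. prod_list (map (\<lambda>s. \<xi> s \<omega>) w))"
    and integrable_zeta: "\<And>w. integrable M (\<lambda>\<omega>. prod_list (map (\<lambda>k. \<zeta> k \<omega>) w))"
    and xi_le_zeta: "\<And>w. \<bar>expectation (\<lambda>\<omega>. prod_list (map (\<lambda>s. \<xi> s \<omega>) w))\<bar>
      \<le> expectation (\<lambda>\<omega>. prod_list (map (\<lambda>s. \<zeta> (fst s) \<omega>) w))"
    and indep_zeta: "\<And>n. indep_vars (\<lambda>_. borel) \<zeta> {..<n}"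
    and zeta_normal: "\<And>k. distributed M lborel (\<zeta> k) (normal_density 0 (sqrt h))"
begin

abbreviation scheme_x :: "nat \<Rightarrow> 'w \<Rightarrow> 'v" where
  "scheme_x k \<omega> \<equiv> x k (\<lambda>s. \<xi> s \<omega>)"

definition maj_sum :: "nat \<Rightarrow> nat \<Rightarrow> 'w \<Rightarrow> real" where
  "maj_sum u v \<omega> = (\<Sum>k\<in>{u..<v}. z_maj k (\<lambda>j. \<zeta> j \<omega>))"

text \<open>Divided by \<tau>, the sum over the short range has mean and variance of the same order
  as the full sum. The two are correlated, but \<open>(p + q)^2 \<le> 2 * p^2 + 2 * q^2\<close>
  separates them, and this 2 cancels the 1/2 in the Gaussian exponent.\<close>

lemma exp_maj_sum:
  assumes uv: "u < v" "v \<le> n"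
    and \<tau>: "\<tau> = sqrt (real (v - u) / real n)"
  shows "integrable M (\<lambda>\<omega>. exp (c * maj_sum u v \<omega> / \<tau> + d * maj_sum 0 n \<omega>))" (is ?I)
    and "expectation (\<lambda>\<omega>. exp (c * maj_sum u v \<omega> / \<tau> + d * maj_sum 0 n \<omega>))
      \<le> exp ((\<bar>c\<bar> + \<bar>d\<bar>) * (\<kappa> * sqrt (real n * h) * y0_size)
            + (c\<^sup>2 + d\<^sup>2) * (\<kappa>\<^sup>2 * (real CARD('i))\<^sup>2 * (real n * h)))" (is ?E)
proof -
  have n: "0 < n" using uv by auto
  have \<tau>0: "0 < \<tau>" "\<tau>\<^sup>2 = real (v - u) / real n" unfolding \<tau> using uv n by auto
  define e where "e j = c / \<tau> * (if j < v then z_coeff u v j else 0) + d * z_coeff 0 n j" for j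
  define \<mu> where "\<mu> = c / \<tau> * z_mean u v + d * z_mean 0 n"
  have *: "{j. j < n \<and> j < v} = {..<v}" using uv by auto
  have eq: "c * maj_sum u v \<omega> / \<tau> + d * maj_sum 0 n \<omega> = \<mu> + (\<Sum>j<n. e j * \<zeta> j \<omega>)" for \<omega>
  proof -
    have "(\<Sum>j<n. (if j < v then z_coeff u v j else 0) * \<zeta> j \<omega>) = (\<Sum>j<v. z_coeff u v j * \<zeta> j \<omega>)"
      using uv by (intro sum.mono_neutral_cong_right) auto
    then have "(\<Sum>j<n. e j * \<zeta> j \<omega>)
        = c / \<tau> * (\<Sum>j<v. z_coeff u v j * \<zeta> j \<omega>) + d * (\<Sum>j<n. z_coeff 0 n j * \<zeta> j \<omega>)"
      unfolding e_def distrib_right sum.distrib mult.assoc sum_distrib_left[symmetric] by simp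
    then show ?thesis unfolding maj_sum_def sum_z_maj \<mu>_def by (simp add: algebra_simps add_divide_distrib)
  qed
  have sd: "0 < sqrt h" "(sqrt h)\<^sup>2 = h" using h_pos by auto
  show ?I unfolding eq
    by (rule indep_normal_exp_moment(1)[OF indep_zeta _ sd(1) zeta_normal]) auto
  have E: "expectation (\<lambda>\<omega>. exp (c * maj_sum u v \<omega> / \<tau> + d * maj_sum 0 n \<omega>))
      = exp (\<mu> + h * (\<Sum>j<n. (e j)\<^sup>2) / 2)"
    unfolding eq using indep_normal_exp_moment(2)[OF indep_zeta _ sd(1) zeta_normal, of n \<mu> e] sd(2)
    by simp
  have y0: "0 \<le> y0_size" unfolding y0_size_def using eta by (intro sum_nonneg) auto
  have "c / \<tau> * z_mean u v \<le> \<bar>c\<bar> * (\<kappa> * sqrt (real n * h) * y0_size)"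
  proof -
    have "c / \<tau> * z_mean u v \<le> \<bar>c\<bar> / \<tau> * (\<kappa> * sqrt (real (v - u) * h) * y0_size)"
      using \<tau>0 z_mean_bounds by (intro mult_mono divide_right_mono) auto
    moreover have "sqrt (real (v - u) * h) = \<tau> * sqrt (real n * h)"
      unfolding \<tau> using n by (simp add: real_sqrt_mult[symmetric])
    ultimately show ?thesis using \<tau>0 by (simp add: field_simps)
  qed
  moreover have "d * z_mean 0 n \<le> \<bar>d\<bar> * (\<kappa> * sqrt (real n * h) * y0_size)"
    using z_mean_bounds[of 0 n] by (intro mult_mono) auto
  ultimately have 1: "\<mu> \<le> (\<bar>c\<bar> + \<bar>d\<bar>) * (\<kappa> * sqrt (real n * h) * y0_size)"
    unfolding \<mu>_def by (simp add: distrib_right)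
  have "(e j)\<^sup>2 \<le> 2 * (c\<^sup>2 / \<tau>\<^sup>2 * (if j < v then (z_coeff u v j)\<^sup>2 else 0)) + 2 * (d\<^sup>2 * (z_coeff 0 n j)\<^sup>2)" for j
  proof -
    have "(p + q)\<^sup>2 \<le> 2 * p\<^sup>2 + 2 * q\<^sup>2" for p q :: real
      using sum_squares_bound[of p q] by (simp add: power2_sum)
    from this[of "c / \<tau> * (if j < v then z_coeff u v j else 0)" "d * z_coeff 0 n j"]
    show ?thesis unfolding e_def by (auto simp: power_mult_distrib power_divide split: if_splits)
  qed
  then have "(\<Sum>j<n. (e j)\<^sup>2) \<le> (\<Sum>j<n. 2 * (c\<^sup>2 / \<tau>\<^sup>2 * (if j < v then (z_coeff u v j)\<^sup>2 else 0)) + 2 * (d\<^sup>2 * (z_coeff 0 n j)\<^sup>2))"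
    by (rule sum_mono)
  also have "\<dots> = 2 * (c\<^sup>2 / \<tau>\<^sup>2 * (\<Sum>j<n. if j < v then (z_coeff u v j)\<^sup>2 else 0)) + 2 * (d\<^sup>2 * (\<Sum>j<n. (z_coeff 0 n j)\<^sup>2))"
    by (simp only: sum.distrib sum_distrib_left)
  also have "(\<Sum>j<n. if j < v then (z_coeff u v j)\<^sup>2 else 0) = (\<Sum>j<v. (z_coeff u v j)\<^sup>2)"
    using uv by (intro sum.mono_neutral_cong_right) auto
  finally have "h * (\<Sum>j<n. (e j)\<^sup>2) \<le> h * (2 * (c\<^sup>2 / \<tau>\<^sup>2 * (\<Sum>j<v. (z_coeff u v j)\<^sup>2)) + 2 * (d\<^sup>2 * (\<Sum>j<n. (z_coeff 0 n j)\<^sup>2)))"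
    using h_pos by (intro mult_left_mono) auto
  also have "\<dots> = 2 * (c\<^sup>2 / \<tau>\<^sup>2 * (h * (\<Sum>j<v. (z_coeff u v j)\<^sup>2))) + 2 * (d\<^sup>2 * (h * (\<Sum>j<n. (z_coeff 0 n j)\<^sup>2)))"
    by (simp add: algebra_simps)
  also have "\<dots> \<le> 2 * (c\<^sup>2 / \<tau>\<^sup>2 * (\<kappa>\<^sup>2 * (real CARD('i))\<^sup>2 * (real (v - u) * h)))
      + 2 * (d\<^sup>2 * (\<kappa>\<^sup>2 * (real CARD('i))\<^sup>2 * (real (n - 0) * h)))"
    by (intro add_mono mult_left_mono z_coeff_bound) auto
  also have "\<dots> = 2 * (c\<^sup>2 + d\<^sup>2) * (\<kappa>\<^sup>2 * (real CARD('i))\<^sup>2 * (real n * h))"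
    unfolding \<tau>0(2) using n uv by (simp add: field_simps)
  finally have 2: "h * (\<Sum>j<n. (e j)\<^sup>2) / 2 \<le> (c\<^sup>2 + d\<^sup>2) * (\<kappa>\<^sup>2 * (real CARD('i))\<^sup>2 * (real n * h))"
    by (simp add: algebra_simps)
  show ?E unfolding E using 1 2 by simp
qed

text \<open>The constants come from exponents \<open>c\<close>, \<open>d\<close> of absolute value 2
  m and 4 m in \<open>exp_maj_sum\<close>: 6 m is their sum and 20 m^2 the sum of their squares. Of
  the power of 4, the part \<open>4 ^ m\<close> is \<open>2 ^ (2 * m)\<close>, and one more factor 4
  counts the choices of signs.\<close>

definition growth_bound :: "nat \<Rightarrow> nat \<Rightarrow> real" where
  "growth_bound m n = 4 ^ Suc m * exp (real (6 * m) * (\<kappa> * sqrt (real n * h) * y0_size)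
      + real (20 * m\<^sup>2) * (\<kappa>\<^sup>2 * (real CARD('i))\<^sup>2 * (real n * h)))"

text \<open>Writing T = \<tau> t with \<tau> \<le> 1, the bound
  \<open>|2 T + T^2| \<le> 2 \<tau> exp |t|\<close> extracts a factor \<tau>, whose power 2 m is the
  m-th power of the fraction (v - u) / n. This is the moment condition for chaining. The remaining
  factors are exponentials, as treated in \<open>exp_maj_sum\<close>.\<close>

lemma energy_increment_moment:
  assumes uv: "u < v" "v \<le> n"
  shows "integrable M (\<lambda>\<omega>. (\<Sum>k\<in>{u..<v}. energy_step k (\<lambda>s. \<xi> s \<omega>)) ^ (2 * m))" (is "integrable M ?D")
    and "expectation (\<lambda>\<omega>. (\<Sum>k\<in>{u..<v}. energy_step k (\<lambda>s. \<xi> s \<omega>)) ^ (2 * m))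
      \<le> (real (v - u) / real n) ^ m * growth_bound m n"
proof -
  define \<tau> where "\<tau> = sqrt (real (v - u) / real n)"
  have n: "0 < n" using uv by auto
  have \<tau>: "0 < \<tau>" "\<tau> \<le> 1" "\<tau>\<^sup>2 = real (v - u) / real n" unfolding \<tau>_def using uv n by auto
  let ?T = "maj_sum u v" and ?S = "maj_sum 0 n"
  have maj: "majorized (\<lambda>z. (\<Sum>k\<in>{u..<v}. energy_step k z) ^ (2 * m))
    (\<lambda>z. ((2 * (\<Sum>k\<in>{u..<v}. z_maj k z) + (\<Sum>k\<in>{u..<v}. z_maj k z)\<^sup>2)
       * (exp_trunc n (\<Sum>k\<in>{0..<n}. z_maj k z))\<^sup>2) ^ (2 * m))"
    using energy_increment_majorized[of "{u..<v}" n "2 * m"] uv by (auto simp: lessThan_atLeast0)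
  note E = majorized_expectation[OF maj integrable_xi integrable_zeta xi_le_zeta, folded maj_sum_def]
  show "integrable M ?D"
    by (rule E(1))
  let ?e = "\<lambda>c d \<omega>. exp (c * ?T \<omega> / \<tau> + d * ?S \<omega>)"
  let ?m = "real (2 * m)"
  let ?s = "\<lambda>\<omega>. ?e ?m (2 * ?m) \<omega> + ?e ?m (- (2 * ?m)) \<omega> + ?e (- ?m) (2 * ?m) \<omega> + ?e (- ?m) (- (2 * ?m)) \<omega>"
  have pt: "((2 * ?T \<omega> + (?T \<omega>)\<^sup>2) * (exp_trunc n (?S \<omega>))\<^sup>2) ^ (2 * m)
      \<le> (4 * \<tau>\<^sup>2) ^ m * ?s \<omega>" for \<omega>
  proof -
    define t where "t = ?T \<omega> / \<tau>"
    have T: "?T \<omega> = \<tau> * t" unfolding t_def using \<tau> by simp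
    have "\<bar>2 * ?T \<omega> + (?T \<omega>)\<^sup>2\<bar> \<le> 2 * (\<tau> * \<bar>t\<bar>) + \<tau>\<^sup>2 * \<bar>t\<bar>\<^sup>2"
      unfolding T by (rule order_trans[OF abs_triangle_ineq]) (use \<tau> in \<open>simp add: abs_mult power_mult_distrib\<close>)
    also have "\<dots> \<le> 2 * (\<tau> * \<bar>t\<bar>) + \<tau> * \<bar>t\<bar>\<^sup>2"
      using \<tau>(1,2) by (intro add_left_mono mult_right_mono) (auto simp: power2_eq_square mult_left_le)
    also have "\<dots> = 2 * \<tau> * (\<bar>t\<bar> + \<bar>t\<bar>\<^sup>2 / 2)" by (simp add: algebra_simps)
    also have "\<dots> \<le> 2 * \<tau> * exp \<bar>t\<bar>"
      using exp_lower_Taylor_quadratic[of "\<bar>t\<bar>"] \<tau> by (intro mult_left_mono) auto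
    finally have 1: "\<bar>2 * ?T \<omega> + (?T \<omega>)\<^sup>2\<bar> \<le> 2 * \<tau> * exp \<bar>t\<bar>" .
    have "\<bar>exp_trunc n (?S \<omega>)\<bar>\<^sup>2 \<le> (exp \<bar>?S \<omega>\<bar>)\<^sup>2"
      by (intro power_mono abs_exp_trunc_le) auto
    then have "\<bar>(2 * ?T \<omega> + (?T \<omega>)\<^sup>2) * (exp_trunc n (?S \<omega>))\<^sup>2\<bar> \<le> (2 * \<tau> * exp \<bar>t\<bar>) * (exp \<bar>?S \<omega>\<bar>)\<^sup>2"
      unfolding abs_mult using \<tau> by (intro mult_mono 1) auto
    then have "\<bar>(2 * ?T \<omega> + (?T \<omega>)\<^sup>2) * (exp_trunc n (?S \<omega>))\<^sup>2\<bar> ^ (2 * m) \<le> ((2 * \<tau> * exp \<bar>t\<bar>) * (exp \<bar>?S \<omega>\<bar>)\<^sup>2) ^ (2 * m)"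
      by (intro power_mono) auto
    also have "\<dots> = (4 * \<tau>\<^sup>2) ^ m * exp (\<bar>?m * t\<bar> + \<bar>2 * ?m * ?S \<omega>\<bar>)"
    proof -
      have "(2 * \<tau>) ^ (2 * m) = (4 * \<tau>\<^sup>2) ^ m" by (simp add: power_mult power_mult_distrib)
      moreover have "(exp \<bar>t\<bar>) ^ (2 * m) = exp \<bar>?m * t\<bar>"
        by (simp add: exp_of_nat_mult[symmetric] abs_mult)
      moreover have "((exp \<bar>?S \<omega>\<bar>)\<^sup>2) ^ (2 * m) = exp \<bar>2 * ?m * ?S \<omega>\<bar>"
        unfolding power_mult[symmetric] exp_of_nat_mult[symmetric] by (simp add: abs_mult)
      ultimately show ?thesis unfolding power_mult_distrib[of "2 * \<tau> * exp \<bar>t\<bar>"] power_mult_distrib[of "2 * \<tau>"] exp_add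
        by simp
    qed
    also have "\<dots> \<le> (4 * \<tau>\<^sup>2) ^ m * (exp (?m * t + 2 * ?m * ?S \<omega>) + exp (?m * t - 2 * ?m * ?S \<omega>)
        + exp (- (?m * t) + 2 * ?m * ?S \<omega>) + exp (- (?m * t) - 2 * ?m * ?S \<omega>))"
      by (intro mult_left_mono exp_abs_abs_le) auto
    finally show ?thesis unfolding t_def by (simp add: power_even_abs)
  qed
  have int: "integrable M (?e c d)" for c d
    by (rule exp_maj_sum(1)[OF uv \<tau>_def])
  let ?b = "exp (real (6 * m) * (\<kappa> * sqrt (real n * h) * y0_size)
      + real (20 * m\<^sup>2) * (\<kappa>\<^sup>2 * (real CARD('i))\<^sup>2 * (real n * h)))"
  have bnd: "expectation (?e c d) \<le> ?b" if "\<bar>c\<bar> = ?m" "\<bar>d\<bar> = 2 * ?m" for c d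
  proof -
    have "c\<^sup>2 = (2 * real m)\<^sup>2" "d\<^sup>2 = (4 * real m)\<^sup>2"
      using that by (metis power2_abs of_nat_mult of_nat_numeral, metis power2_abs of_nat_mult of_nat_numeral mult.assoc numeral_Bit0_eq_double)
    then have "c\<^sup>2 + d\<^sup>2 = real (20 * m\<^sup>2)" by (simp add: power_mult_distrib)
    moreover have "\<bar>c\<bar> + \<bar>d\<bar> = real (6 * m)" using that by simp
    ultimately show ?thesis using exp_maj_sum(2)[OF uv \<tau>_def, of c d] by simp
  qed
  have "expectation ?D \<le> expectation (\<lambda>\<omega>. ((2 * ?T \<omega> + (?T \<omega>)\<^sup>2) * (exp_trunc n (?S \<omega>))\<^sup>2) ^ (2 * m))"
    using E(3) by linarith
  also have "\<dots> \<le> expectation (\<lambda>\<omega>. (4 * \<tau>\<^sup>2) ^ m * ?s \<omega>)"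
    by (intro integral_mono E(2) pt integrable_mult_right Bochner_Integration.integrable_add int)
  also have "\<dots> = (4 * \<tau>\<^sup>2) ^ m * (expectation (?e ?m (2 * ?m)) + expectation (?e ?m (- (2 * ?m)))
      + expectation (?e (- ?m) (2 * ?m)) + expectation (?e (- ?m) (- (2 * ?m))))"
    using int by (simp only: Bochner_Integration.integral_add Bochner_Integration.integrable_add integral_mult_right_zero)
  also have "\<dots> \<le> (4 * \<tau>\<^sup>2) ^ m * (?b + ?b + ?b + ?b)"
    by (intro mult_left_mono add_mono bnd) auto
  also have "\<dots> = (\<tau>\<^sup>2) ^ m * growth_bound m n"
    by (simp add: growth_bound_def power_mult_distrib)
  finally show "expectation ?D \<le> (real (v - u) / real n) ^ m * growth_bound m n"
    unfolding \<tau>(3) .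
qed

text \<open>Level j has 2^j blocks, each with a moment of order 1 / 2^(j m), so with the weights
  (25/16)^(j m) the levels form a geometric series of ratio 2 (25/32)^m. One integrable
  \<open>W\<close> bounds all steps at once; the power 4 m of the norm is the power 2 m of the
  energy.\<close>

lemma scheme_moment:
  assumes m: "3 \<le> m"
  obtains W where "integrable M W" "\<And>\<omega> k. k \<le> 2 ^ N \<Longrightarrow> norm (scheme_x k \<omega>) ^ (4 * m) \<le> W \<omega>"
    "expectation W \<le> 4 ^ m * (1 + 25 ^ m * (22 * growth_bound m (2 ^ N)))"
proof
  let ?\<Delta> = "\<lambda>j i \<omega>. (\<Sum>k\<in>{i * 2 ^ (N - j)..<Suc i * 2 ^ (N - j)}. energy_step k (\<lambda>s. \<xi> s \<omega>)) ^ (2 * m)"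
  define W where "W \<omega> = 4 ^ m * (1 + 25 ^ m * (\<Sum>j\<le>N. \<Sum>i<2 ^ j. ((25 / 16) ^ m) ^ j * ?\<Delta> j i \<omega>))" for \<omega>
  have le: "i * 2 ^ (N - j) < Suc i * 2 ^ (N - j)" "Suc i * 2 ^ (N - j) \<le> 2 ^ N"
    if "j \<le> N" "i < 2 ^ j" for i j :: nat
  proof -
    have "Suc i * 2 ^ (N - j) \<le> 2 ^ j * 2 ^ (N - j)" using that by (intro mult_right_mono) auto
    then show "Suc i * 2 ^ (N - j) \<le> 2 ^ N" using that by (simp add: power_add[symmetric])
  qed auto
  have int: "integrable M (?\<Delta> j i)" if "j \<le> N" "i < 2 ^ j" for i j
    by (rule energy_increment_moment(1)[OF le[OF that]])
  show "integrable M W" unfolding W_def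
    by (intro integrable_mult_right Bochner_Integration.integrable_add Bochner_Integration.integrable_sum int) auto
  show "norm (scheme_x k \<omega>) ^ (4 * m) \<le> W \<omega>" if "k \<le> 2 ^ N" for k \<omega>
  proof -
    let ?\<Phi> = "\<Sum>j<k. energy_step j (\<lambda>s. \<xi> s \<omega>)"
    have sq: "(1 + t)\<^sup>2 \<le> 4 * max 1 (t\<^sup>2)" for t :: real
    proof -
      have "(1 + t)\<^sup>2 \<le> 2 * 1 + 2 * t\<^sup>2"
        using sum_squares_bound[of 1 t] by (simp add: power2_sum)
      then show ?thesis by (auto simp: max_def)
    qed
    have "norm (scheme_x k \<omega>) ^ (4 * m) = ((norm (scheme_x k \<omega>))\<^sup>2) ^ (2 * m)"
      by (simp add: power_mult[symmetric])
    also have "\<dots> \<le> (1 + ?\<Phi>) ^ (2 * m)"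
      by (intro power_mono norm_x_le_energy) auto
    also have "\<dots> = ((1 + ?\<Phi>)\<^sup>2) ^ m" by (simp add: power_mult)
    also have "\<dots> \<le> (4 * max 1 (?\<Phi>\<^sup>2)) ^ m"
      by (intro power_mono sq) auto
    also have "\<dots> \<le> 4 ^ m * (1 + ?\<Phi> ^ (2 * m))"
      by (auto simp: power_mult_distrib max_def power_mult)
    also have "\<dots> \<le> W \<omega>"
      unfolding W_def using m that
      by (intro mult_left_mono add_left_mono dyadic_partial_sum_power_le) auto
    finally show ?thesis .
  qed
  have "expectation W = 4 ^ m * (1 + 25 ^ m * (\<Sum>j\<le>N. \<Sum>i<2 ^ j. ((25 / 16) ^ m) ^ j * expectation (?\<Delta> j i)))"
  proof -
    have "integrable M (\<lambda>\<omega>. \<Sum>j\<le>N. \<Sum>i<2 ^ j. ((25 / 16) ^ m) ^ j * ?\<Delta> j i \<omega>)"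
      by (intro integrable_mult_right Bochner_Integration.integrable_sum int) auto
    then have "expectation W = 4 ^ m * (1 + 25 ^ m * expectation (\<lambda>\<omega>. \<Sum>j\<le>N. \<Sum>i<2 ^ j. ((25 / 16) ^ m) ^ j * ?\<Delta> j i \<omega>))"
      unfolding W_def by (simp add: prob_space)
    also have "expectation (\<lambda>\<omega>. \<Sum>j\<le>N. \<Sum>i<2 ^ j. ((25 / 16) ^ m) ^ j * ?\<Delta> j i \<omega>)
        = (\<Sum>j\<le>N. \<Sum>i<2 ^ j. expectation (\<lambda>\<omega>. ((25 / 16) ^ m) ^ j * ?\<Delta> j i \<omega>))"
      by (subst Bochner_Integration.integral_sum,
          intro integrable_mult_right Bochner_Integration.integrable_sum int, simp, simp)
        (intro sum.cong refl Bochner_Integration.integral_sum integrable_mult_right int, auto)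
    finally show ?thesis by simp
  qed
  also have "\<dots> \<le> 4 ^ m * (1 + 25 ^ m * (22 * growth_bound m (2 ^ N)))"
  proof -
    let ?\<rho> = "2 * (25 / 32) ^ m :: real"
    \<comment> \<open>The number 19532/20480 is slightly above 2 (25/32)^3 = 15625/16384. The series
      then sums to at most 20480/948 < 22, which is the 22 of the statement.\<close>
    have \<rho>: "0 \<le> ?\<rho>" "?\<rho> \<le> 19532 / 20480"
    proof -
      have "(25 / 32 :: real) ^ m \<le> (25 / 32) ^ 3" using m by (intro power_decreasing) auto
      then show "?\<rho> \<le> 19532 / 20480" by (simp add: power3_eq_cube)
    qed simp
    have g: "0 \<le> growth_bound m n" for n unfolding growth_bound_def by simp
    have "(\<Sum>i<2 ^ j. ((25 / 16) ^ m) ^ j * expectation (?\<Delta> j i)) \<le> ?\<rho> ^ j * growth_bound m (2 ^ N)" if "j \<le> N" for j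
    proof -
      have "(\<Sum>i<2 ^ j. ((25 / 16) ^ m) ^ j * expectation (?\<Delta> j i))
         \<le> (\<Sum>i<(2::nat) ^ j. ((25 / 16) ^ m) ^ j * ((1 / 2 ^ j) ^ m * growth_bound m (2 ^ N)))"
      proof (intro sum_mono mult_left_mono)
        fix i :: nat assume i: "i \<in> {..<2 ^ j}"
        have "real (Suc i * 2 ^ (N - j) - i * 2 ^ (N - j)) / real (2 ^ N) = 1 / 2 ^ j"
          using that by (simp add: power_add[symmetric] field_simps)
        then show "expectation (?\<Delta> j i) \<le> (1 / 2 ^ j) ^ m * growth_bound m (2 ^ N)"
          using energy_increment_moment(2)[OF le[OF that], of i m] i by simp
      qed auto
      also have "\<dots> = ?\<rho> ^ j * growth_bound m (2 ^ N)"
      proof -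
        have "2 ^ j * ((25 / 16 :: real) ^ m) ^ j * (1 / 2 ^ j) ^ m = ?\<rho> ^ j"
        proof -
          have "(1 / 2 ^ j :: real) ^ m = ((1 / 2) ^ m) ^ j"
            by (simp add: power_mult[symmetric] power_one_over mult.commute)
          then have "2 ^ j * ((25 / 16 :: real) ^ m) ^ j * (1 / 2 ^ j) ^ m = (2 * ((25 / 16) ^ m * (1 / 2) ^ m)) ^ j"
            by (simp only: power_mult_distrib mult.assoc)
          also have "(25 / 16 :: real) ^ m * (1 / 2) ^ m = (25 / 32) ^ m"
            by (simp add: power_mult_distrib[symmetric])
          finally show ?thesis .
        qed
        then show ?thesis by simp
      qed
      finally show ?thesis .
    qed
    then have "(\<Sum>j\<le>N. \<Sum>i<2 ^ j. ((25 / 16) ^ m) ^ j * expectation (?\<Delta> j i)) \<le> (\<Sum>j\<le>N. ?\<rho> ^ j * growth_bound m (2 ^ N))"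
      by (intro sum_mono) auto
    also have "\<dots> \<le> (\<Sum>j\<le>N. (19532 / 20480) ^ j * growth_bound m (2 ^ N))"
      by (intro sum_mono mult_right_mono power_mono g \<rho>)
    also have "\<dots> = 20480 / 948 * (\<Sum>j<Suc N. 948 / 20480 * (1 - 948 / 20480) ^ j) * growth_bound m (2 ^ N)"
      by (simp add: lessThan_Suc_atMost sum_distrib_right sum_distrib_left)
    also have "\<dots> \<le> 20480 / 948 * 1 * growth_bound m (2 ^ N)"
      by (intro mult_right_mono mult_left_mono geometric_weights_le_1 g) auto
    also have "\<dots> \<le> 22 * growth_bound m (2 ^ N)" using g[of "2 ^ N"] by simp
    finally show ?thesis by (intro mult_left_mono add_left_mono) auto
  qed
  finally show "expectation W \<le> 4 ^ m * (1 + 25 ^ m * (22 * growth_bound m (2 ^ N)))" .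
qed

end

section \<open>Brownian increments\<close>

text \<open>The inequality of arithmetic and geometric means for n-th powers. It reduces a mixed
  moment of n variables to moments of single variables, whatever their dependence.\<close>

lemma abs_prod_list_le_mean_power:
  fixes f :: "'a \<Rightarrow> real"
  assumes "xs \<noteq> []"
  shows "\<bar>prod_list (map f xs)\<bar> \<le> (\<Sum>x\<leftarrow>xs. \<bar>f x\<bar> ^ length xs) / real (length xs)"
proof -
  let ?n = "length xs"
  have n: "0 < ?n" using assms by simp
  have "root ?n (\<Prod>i<?n. \<bar>f (xs ! i)\<bar> ^ ?n) \<le> (\<Sum>i<?n. \<bar>f (xs ! i)\<bar> ^ ?n) / real ?n"
    using arith_geom_mean[of "{..<?n}" "\<lambda>i. \<bar>f (xs ! i)\<bar> ^ ?n"] n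
    by (auto simp: lessThan_empty_iff root_powr_inverse prod_nonneg sum_divide_distrib)
  moreover have "root ?n (\<Prod>i<?n. \<bar>f (xs ! i)\<bar> ^ ?n) = (\<Prod>i<?n. \<bar>f (xs ! i)\<bar>)"
    using n by (simp add: prod_power_distrib[symmetric] real_root_power_cancel prod_nonneg)
  moreover have "\<bar>prod_list (map f xs)\<bar> = (\<Prod>i<?n. \<bar>f (xs ! i)\<bar>)"
    by (simp add: prod.list_conv_set_nth abs_prod lessThan_atLeast0)
  moreover have "(\<Sum>x\<leftarrow>xs. \<bar>f x\<bar> ^ ?n) = (\<Sum>i<?n. \<bar>f (xs ! i)\<bar> ^ ?n)"
    by (simp add: sum.list_conv_set_nth lessThan_atLeast0)
  ultimately show ?thesis by simp
qed

text \<open>Moments of the standard normal law: for even n this is the double factorial (n -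
  1)!!.\<close>

definition gauss_moment :: "nat \<Rightarrow> real" where
  "gauss_moment n = (if even n then fact n / (2 ^ (n div 2) * fact (n div 2)) else 0)"

lemma gauss_moment_nonneg: "0 \<le> gauss_moment n"
  by (simp add: gauss_moment_def)

text \<open>In even degrees the moments satisfy \<open>g (Suc i) = (2 * i + 1) * g i\<close>, and
  the factor only grows when i is replaced by i + j. This is how letters from two independent
  Brownian motions in the same time step are merged into one Gaussian.\<close>

lemma gauss_moment_mult_le: "gauss_moment a * gauss_moment b \<le> gauss_moment (a + b)"
proof (cases "even a \<and> even b")
  case True
  define g where "g i = (fact (2 * i) / (2 ^ i * fact i) :: real)" for i
  have g_Suc: "g (Suc i) = (2 * real i + 1) * g i" for i
  proof -
    have "fact (2 * Suc i) = 2 * (real i + 1) * ((2 * real i + 1) * fact (2 * i))"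
      by (simp add: algebra_simps)
    moreover have "fact (Suc i) = (real i + 1) * fact i" by simp
    moreover have "real i + 1 \<noteq> 0" by linarith
    ultimately show ?thesis unfolding g_def by (simp only: power_Suc) (simp add: divide_simps)
  qed
  have g0: "0 \<le> g i" for i unfolding g_def by simp
  have le: "g i * g j \<le> g (i + j)" for i j
  proof (induction i)
    case 0 show ?case by (simp add: g_def)
  next
    case (Suc i)
    have "g (Suc i) * g j = (2 * real i + 1) * (g i * g j)" by (simp add: g_Suc)
    also have "\<dots> \<le> (2 * real (i + j) + 1) * g (i + j)"
      by (intro mult_mono Suc.IH) (auto simp: g0)
    also have "\<dots> = g (Suc i + j)" by (simp add: g_Suc)
    finally show ?case .
  qed
  have g: "gauss_moment (2 * i) = g i" for i
    unfolding gauss_moment_def g_def by simp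
  from True obtain i j where a: "a = 2 * i" and b: "b = 2 * j" by (auto elim!: evenE)
  then have "a + b = 2 * (i + j)" by simp
  then have "gauss_moment a = g i" "gauss_moment b = g j" "gauss_moment (a + b) = g (i + j)"
    using g a b by (simp_all only:)
  then show ?thesis using le by simp
next
  case False
  then show ?thesis using gauss_moment_nonneg[of "a + b"] by (auto simp: gauss_moment_def)
qed

lemma normal_moment:
  assumes "0 < \<sigma>"
  shows "(\<integral>x. normal_density 0 \<sigma> x * x ^ n \<partial>lborel) = \<sigma> ^ n * gauss_moment n"
proof (cases "even n")
  case True
  then obtain k where n: "n = 2 * k" by (auto elim: evenE)
  have "\<sigma> ^ n = (\<sigma>\<^sup>2) ^ k" by (simp add: n power_mult)
  then show ?thesis using integral_normal_moment_even[OF assms, of 0 k] assms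
    unfolding n by (simp add: gauss_moment_def power_divide field_simps)
next
  case False
  then obtain k where n: "n = 2 * k + 1" by (auto elim: oddE)
  show ?thesis using integral_normal_moment_odd[OF assms, of 0 k]
    unfolding n by (simp add: gauss_moment_def)
qed

text \<open>\<open>X v\<close> is one Gaussian vector tested against v, with variance
  \<open>t * q v\<close>. The laws are given for one v at a time, as in
  \<open>standard_brownian\<close>, and v = 0 is excluded because its law has no density.\<close>

locale gaussian_family = prob_space M for M :: "'w measure" +
  fixes V :: "'g::real_vector set" and X :: "'g \<Rightarrow> 'w \<Rightarrow> real" and q :: "'g \<Rightarrow> real" and t :: real
  assumes subspace_V: "subspace V" and t_pos: "0 < t"
    and X_linear: "\<And>u v c \<omega>. u \<in> V \<Longrightarrow> v \<in> V \<Longrightarrow> X (u + c *\<^sub>R v) \<omega> = X u \<omega> + c * X v \<omega>"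
    and q_pos: "\<And>v. v \<in> V \<Longrightarrow> v \<noteq> 0 \<Longrightarrow> 0 < q v" and q_zero: "q 0 = 0"
    and X_normal: "\<And>v. v \<in> V \<Longrightarrow> v \<noteq> 0 \<Longrightarrow> distributed M lborel (X v) (normal_density 0 (sqrt (t * q v)))"
begin

lemma X_zero: "X 0 \<omega> = 0"
  using X_linear[of 0 0 1 \<omega>] subspace_0[OF subspace_V] by simp

lemma moment:
  assumes "v \<in> V"
  shows "X v \<in> borel_measurable M" (is ?A) "integrable M (\<lambda>\<omega>. X v \<omega> ^ n)" (is ?B)
    "expectation (\<lambda>\<omega>. X v \<omega> ^ n) = sqrt (t * q v) ^ n * gauss_moment n" (is ?C)
proof -
  have "?A \<and> ?B \<and> ?C"
  proof (cases "v = 0")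
    case True
    then have "X v = (\<lambda>_. 0)" using X_zero by auto
    then show ?thesis using True
      by (cases n) (auto simp: q_zero gauss_moment_def prob_space)
  next
    case False
    note d = X_normal[OF assms False]
    have s: "0 < sqrt (t * q v)" using q_pos[OF assms False] t_pos by simp
    have "X v \<in> borel_measurable M" using distributed_measurable[OF d] by simp
    moreover have "integrable M (\<lambda>\<omega>. X v \<omega> ^ n)"
      using distributed_integrable[OF d, of "\<lambda>x. x ^ n"] integrable_normal_moment[OF s, of 0 n] by simp
    moreover have "expectation (\<lambda>\<omega>. X v \<omega> ^ n) = sqrt (t * q v) ^ n * gauss_moment n"
      using distributed_integral[OF d, of "\<lambda>x. x ^ n"] normal_moment[OF s, of n] by simp
    ultimately show ?thesis by simp
  qed
  then show ?A ?B ?C by auto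
qed

lemma measurable_prod:
  "set vs \<subseteq> V \<Longrightarrow> (\<lambda>\<omega>. prod_list (map (\<lambda>v. X v \<omega>) vs)) \<in> borel_measurable M"
  by (induction vs) (auto intro!: borel_measurable_times moment(1))

lemma integrable_abs_power: "v \<in> V \<Longrightarrow> integrable M (\<lambda>\<omega>. \<bar>X v \<omega>\<bar> ^ n)"
  using integrable_abs[OF moment(2)[of v n]] by (simp add: power_abs)

lemma integrable_sum_abs_power:
  "set vs \<subseteq> V \<Longrightarrow> integrable M (\<lambda>\<omega>. \<Sum>v\<leftarrow>vs. \<bar>X v \<omega>\<bar> ^ n)"
  by (induction vs) (auto intro!: Bochner_Integration.integrable_add integrable_abs_power)

lemma integrable_prod:
  assumes "set vs \<subseteq> V"
  shows "integrable M (\<lambda>\<omega>. prod_list (map (\<lambda>v. X v \<omega>) vs))"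
proof (cases "vs = []")
  case False
  show ?thesis
  proof (rule Bochner_Integration.integrable_bound)
    show "integrable M (\<lambda>\<omega>. (\<Sum>v\<leftarrow>vs. \<bar>X v \<omega>\<bar> ^ length vs) / real (length vs))"
      by (intro integrable_divide_zero integrable_sum_abs_power assms)
    show "AE \<omega> in M. norm (prod_list (map (\<lambda>v. X v \<omega>) vs)) \<le> norm ((\<Sum>v\<leftarrow>vs. \<bar>X v \<omega>\<bar> ^ length vs) / real (length vs))"
      using order_trans[OF abs_prod_list_le_mean_power[OF False] abs_ge_self] by (auto simp del: abs_divide)
  qed (rule measurable_prod[OF assms])
qed simp

text \<open>
  Polarisation: only the laws of the single variables \<open>X v\<close> are given, so the joint moment is obtained
  as the linear coefficient in \<open>s\<close> of the moments with \<open>v + s u\<close> in place of \<open>v\<close>.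
\<close>

lemma expectation_prod_power_odd:
  assumes "set us \<subseteq> V" "v \<in> V" "odd (length us + k)"
  shows "expectation (\<lambda>\<omega>. prod_list (map (\<lambda>u. X u \<omega>) us) * X v \<omega> ^ k) = 0"
  using assms
proof (induction us arbitrary: v k)
  case Nil
  then show ?case by (simp add: moment gauss_moment_def)
next
  case (Cons u us)
  let ?P = "\<lambda>\<omega>. prod_list (map (\<lambda>u. X u \<omega>) us)"
  define c where "c l = real (Suc k choose l) * expectation (\<lambda>\<omega>. ?P \<omega> * (X u \<omega> ^ l * X v \<omega> ^ (Suc k - l)))" for l
  have int: "integrable M (\<lambda>\<omega>. ?P \<omega> * (X u \<omega> ^ l * X v \<omega> ^ m))" for l m
  proof -
    have "?P \<omega> * (X u \<omega> ^ l * X v \<omega> ^ m) = prod_list (map (\<lambda>u. X u \<omega>) (us @ replicate l u @ replicate m v))" for \<omega>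
      by (simp add: prod_list_replicate)
    then show ?thesis using integrable_prod[of "us @ replicate l u @ replicate m v"] Cons.prems
      by (auto simp: set_replicate_conv_if)
  qed
  \<comment> \<open>Removing u from the list and raising the power by one keeps the parity, so the
    induction hypothesis applies to every \<open>v + s *\<^sub>R u\<close>. A polynomial in s
    vanishes identically, and its linear coefficient is \<open>Suc k\<close> times the wanted
    moment.\<close>
  have "(\<Sum>l\<le>Suc k. c l * s ^ l) = 0" for s
  proof -
    have "0 = expectation (\<lambda>\<omega>. ?P \<omega> * X (v + s *\<^sub>R u) \<omega> ^ Suc k)"
      using Cons.prems subspace_V by (intro Cons.IH[symmetric]) (auto intro: subspace_add subspace_scale)
    also have "\<dots> = expectation (\<lambda>\<omega>. \<Sum>l\<le>Suc k. (real (Suc k choose l) * s ^ l) * (?P \<omega> * (X u \<omega> ^ l * X v \<omega> ^ (Suc k - l))))"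
    proof (intro Bochner_Integration.integral_cong refl)
      fix \<omega>
      have "X (v + s *\<^sub>R u) \<omega> = s * X u \<omega> + X v \<omega>"
        using Cons.prems by (subst X_linear) auto
      then have "?P \<omega> * X (v + s *\<^sub>R u) \<omega> ^ Suc k = (\<Sum>l\<le>Suc k. ?P \<omega> * (real (Suc k choose l) * (s * X u \<omega>) ^ l * X v \<omega> ^ (Suc k - l)))"
        by (simp only: binomial_ring sum_distrib_left)
      also have "\<dots> = (\<Sum>l\<le>Suc k. (real (Suc k choose l) * s ^ l) * (?P \<omega> * (X u \<omega> ^ l * X v \<omega> ^ (Suc k - l))))"
        by (intro sum.cong refl) (simp only: power_mult_distrib mult_ac)
      finally show "?P \<omega> * X (v + s *\<^sub>R u) \<omega> ^ Suc k = (\<Sum>l\<le>Suc k. (real (Suc k choose l) * s ^ l) * (?P \<omega> * (X u \<omega> ^ l * X v \<omega> ^ (Suc k - l))))" .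
    qed
    also have "\<dots> = (\<Sum>l\<le>Suc k. c l * s ^ l)"
      by (subst Bochner_Integration.integral_sum)
        (auto intro!: integrable_mult_right int sum.cong simp: c_def simp del: sum.atMost_Suc power_Suc)
    finally show ?thesis by simp
  qed
  then have "c 1 = 0" using polyfun_eq_0[of c "Suc k"] by simp
  then show ?case by (simp add: c_def mult_ac)
qed

text \<open>In even degree the mean of the powers has exactly the moment of one variable of variance
  t. In odd degree the bound is 0, so absolute values are of no help; there the moment itself
  vanishes by \<open>expectation_prod_power_odd\<close>.\<close>

lemma abs_expectation_prod_le:
  assumes vs: "set vs \<subseteq> V" and "\<And>v. v \<in> set vs \<Longrightarrow> q v = 1"
  shows "\<bar>expectation (\<lambda>\<omega>. prod_list (map (\<lambda>v. X v \<omega>) vs))\<bar> \<le> sqrt t ^ length vs * gauss_moment (length vs)"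
proof (cases "even (length vs) \<and> vs \<noteq> []")
  case True
  let ?n = "length vs"
  have E: "expectation (\<lambda>\<omega>. \<Sum>v\<leftarrow>us. \<bar>X v \<omega>\<bar> ^ ?n) = real (length us) * (sqrt t ^ ?n * gauss_moment ?n)"
    if "set us \<subseteq> set vs" for us
    using that
  proof (induction us)
    case (Cons u us)
    have "expectation (\<lambda>\<omega>. \<bar>X u \<omega>\<bar> ^ ?n) = sqrt t ^ ?n * gauss_moment ?n"
      using Cons.prems assms moment(3)[of u ?n] True by (simp add: power_even_abs subset_iff)
    moreover have "integrable M (\<lambda>\<omega>. \<bar>X u \<omega>\<bar> ^ ?n)" "integrable M (\<lambda>\<omega>. \<Sum>v\<leftarrow>us. \<bar>X v \<omega>\<bar> ^ ?n)"
      using Cons.prems vs by (auto intro!: integrable_abs_power integrable_sum_abs_power)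
    ultimately show ?case using Cons by (simp add: algebra_simps)
  qed (simp add: prob_space)
  have "\<bar>expectation (\<lambda>\<omega>. prod_list (map (\<lambda>v. X v \<omega>) vs))\<bar> \<le> expectation (\<lambda>\<omega>. \<bar>prod_list (map (\<lambda>v. X v \<omega>) vs)\<bar>)"
    by (rule integral_abs_bound)
  also have "\<dots> \<le> expectation (\<lambda>\<omega>. (\<Sum>v\<leftarrow>vs. \<bar>X v \<omega>\<bar> ^ ?n) / real ?n)"
    using True abs_prod_list_le_mean_power[of vs "\<lambda>v. X v _"]
    by (intro integral_mono integrable_divide_zero integrable_sum_abs_power vs integrable_abs integrable_prod) auto
  also have "\<dots> = sqrt t ^ ?n * gauss_moment ?n"
    using E[of vs] True by simp
  finally show ?thesis .
next
  case False
  show ?thesis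
  proof (cases "vs = []")
    case False
    with \<open>\<not> (even (length vs) \<and> vs \<noteq> [])\<close> have "odd (length vs)" by simp
    then show ?thesis
      using expectation_prod_power_odd[OF vs subspace_0[OF subspace_V], of 0] by (simp add: gauss_moment_def)
  qed (simp add: prob_space gauss_moment_def)
qed

end


section \<open>Words in the increments of one Brownian motion and of an independent pair\<close>

lemma prod_list_split_by_key:
  fixes f :: "nat \<times> 'a \<Rightarrow> real"
  assumes "\<And>s. s \<in> set u \<Longrightarrow> fst s < n"
  shows "prod_list (map f u) = (\<Prod>k<n. prod_list (map f (filter (\<lambda>s. fst s = k) u)))"
  using assms
proof (induction u)
  case (Cons s u)
  have "(\<Prod>k<n. prod_list (map f (filter (\<lambda>s. fst s = k) (s # u))))
      = (\<Prod>k<n. (if fst s = k then f s else 1) * prod_list (map f (filter (\<lambda>s. fst s = k) u)))"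
    by (intro prod.cong) auto
  also have "\<dots> = f s * prod_list (map f u)"
    using Cons by (simp add: prod.distrib)
  finally show ?case by simp
qed simp

lemma prod_list_filter_split:
  fixes f :: "'a \<Rightarrow> real"
  shows "prod_list (map f u) = prod_list (map f (filter P u)) * prod_list (map f (filter (\<lambda>s. \<not> P s) u))"
  by (induction u) auto

definition increment :: "real \<Rightarrow> (real \<Rightarrow> 'w \<Rightarrow> 'g::real_vector) \<Rightarrow> nat \<Rightarrow> 'w \<Rightarrow> 'g" where
  "increment h w k \<omega> = w (real (Suc k) * h) \<omega> - w (real k * h) \<omega>"

locale brownian_increments = prob_space Q for Q :: "'w measure" +
  fixes V :: "'g::euclidean_space set" and q :: "'g \<Rightarrow> 'g \<Rightarrow> real" and w :: "real \<Rightarrow> 'w \<Rightarrow> 'g" and h :: real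
  assumes brownian: "standard_brownian Q V q w" and subspace_V: "subspace V" and h_pos: "0 < h"
    and linear_q: "\<And>x. linear (q x)" and linear_q': "\<And>y. linear (\<lambda>x. q x y)"
    and q_pos: "\<And>v. v \<in> V \<Longrightarrow> v \<noteq> 0 \<Longrightarrow> 0 < q v v"
begin

lemma continuous_q: "continuous_on UNIV (q v)"
  using linear_q linear_continuous_on linear_conv_bounded_linear by blast

lemma measurable_q [measurable]: "q v \<in> borel_measurable borel"
  by (rule borel_measurable_continuous_onI[OF continuous_q])

lemma measurable_w: "0 \<le> t \<Longrightarrow> w t \<in> borel_measurable Q"
  using brownian unfolding standard_brownian_def by blast

lemma increment_measurable [measurable]: "increment h w k \<in> borel_measurable Q"
  unfolding increment_def[abs_def] using h_pos
  by (intro borel_measurable_diff measurable_w) auto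

lemma increments_indep: "indep_vars (\<lambda>_. borel) (increment h w) {..<n}"
proof -
  have "\<forall>t n. 0 \<le> t 0 \<and> mono t \<longrightarrow>
      indep_vars (\<lambda>_. borel) (\<lambda>i \<omega>. w (t (Suc i)) \<omega> - w (t i) \<omega>) {..<n::nat}"
    using brownian unfolding standard_brownian_def by (elim conjE)
  moreover have "mono (\<lambda>k. real k * h)" using h_pos by (intro monoI mult_right_mono) auto
  ultimately show ?thesis
    unfolding increment_def[abs_def] by (elim allE[of _ "\<lambda>k. real k * h"] allE[of _ n]) simp
qed

lemma normal_increment:
  assumes "0 \<le> s" "s < t" "v \<in> V" "v \<noteq> 0"
  shows "distributed Q lborel (\<lambda>\<omega>. q v (w t \<omega> - w s \<omega>)) (normal_density 0 (sqrt ((t - s) * q v v)))"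
proof -
  have "\<forall>s t v. 0 \<le> s \<and> s < t \<and> v \<in> V \<and> v \<noteq> 0 \<longrightarrow> distributed Q lborel (\<lambda>\<omega>. q v (w t \<omega> - w s \<omega>))
      (\<lambda>x. ennreal (normal_density 0 (sqrt ((t - s) * q v v)) x))"
    using brownian unfolding standard_brownian_def by (elim conjE)
  then show ?thesis using assms by blast
qed

sublocale inc: gaussian_family Q V "\<lambda>v \<omega>. q v (increment h w k \<omega>)" "\<lambda>v. q v v" h for k
proof
  fix u v :: 'g and c :: real and \<omega>
  show "q (u + c *\<^sub>R v) (increment h w k \<omega>) = q u (increment h w k \<omega>) + c * q v (increment h w k \<omega>)"
    using linear_add[OF linear_q'] linear_cmul[OF linear_q'] by simp
next
  show "q 0 0 = 0" using linear_0[OF linear_q] by simp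
next
  fix v assume "v \<in> V" "v \<noteq> 0"
  moreover have "real (Suc k) * h - real k * h = h" by (simp add: algebra_simps)
  moreover have "0 \<le> real k * h" "real k * h < real (Suc k) * h" using h_pos by auto
  ultimately show "distributed Q lborel (\<lambda>\<omega>. q v (increment h w k \<omega>)) (normal_density 0 (sqrt (h * q v v)))"
    using normal_increment[of "real k * h" "real (Suc k) * h" v] unfolding increment_def by simp
qed (use subspace_V h_pos q_pos in auto)

lemma expectation_word:
  assumes "\<And>s. s \<in> set u \<Longrightarrow> snd s \<in> V" "\<And>s. s \<in> set u \<Longrightarrow> fst s < n"
  shows "integrable Q (\<lambda>\<omega>. prod_list (map (\<lambda>s. q (snd s) (increment h w (fst s) \<omega>)) u))" (is ?I)
    and "expectation (\<lambda>\<omega>. prod_list (map (\<lambda>s. q (snd s) (increment h w (fst s) \<omega>)) u))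
      = (\<Prod>k<n. expectation (\<lambda>\<omega>. prod_list (map (\<lambda>v. q v (increment h w k \<omega>)) (map snd (filter (\<lambda>s. fst s = k) u)))))" (is ?E)
proof -
  define F where "F k x = prod_list (map (\<lambda>v. q v x) (map snd (filter (\<lambda>s. fst s = k) u)))" for k x
  have F: "prod_list (map (\<lambda>s. q (snd s) (increment h w (fst s) \<omega>)) u) = (\<Prod>k<n. F k (increment h w k \<omega>))" for \<omega>
  proof -
    have map_eq: "map (\<lambda>s. q (snd s) (increment h w (fst s) \<omega>)) (filter (\<lambda>s. fst s = k) u)
       = map (\<lambda>v. q v (increment h w k \<omega>)) (map snd (filter (\<lambda>s. fst s = k) u))" for k
      by auto
    show ?thesis
      unfolding F_def map_eq[symmetric] by (rule prod_list_split_by_key[OF assms(2)])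
  qed
  have meas: "F k \<in> borel_measurable borel" for k
  proof -
    have "(\<lambda>x. prod_list (map (\<lambda>v. q v x) vs)) \<in> borel_measurable borel" for vs
      by (induction vs) auto
    then show ?thesis unfolding F_def[abs_def] by blast
  qed
  have ind: "indep_vars (\<lambda>_. borel) (\<lambda>k \<omega>. F k (increment h w k \<omega>)) {..<n}"
    by (rule indep_vars_compose2[OF increments_indep]) (rule meas)
  have int: "integrable Q (\<lambda>\<omega>. F k (increment h w k \<omega>))" for k
    unfolding F_def using assms(1) by (intro inc.integrable_prod) auto
  show ?I
    unfolding F by (rule indep_vars_integrable[OF _ ind int]) simp
  show ?E
    unfolding F F_def[symmetric] by (rule indep_vars_lebesgue_integral[OF _ ind int]) simp
qed

text \<open>Independence of the two Brownian motions is stated for whole paths in a product space; a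
  word inherits it once it is a measurable function of the path.\<close>

lemma word_factors_path:
  obtains F where "F \<in> borel_measurable (PiM {0..} (\<lambda>_. borel))"
    "\<And>\<omega>. prod_list (map (\<lambda>s. q (snd s) (increment h w (fst s) \<omega>)) u) = F (\<lambda>t\<in>{0..}. w t \<omega>)"
proof
  define G where "G s f = q (snd s) (f (real (Suc (fst s)) * h) - f (real (fst s) * h))" for s :: "nat \<times> 'g" and f
  have [measurable]: "G s \<in> borel_measurable (PiM {0..} (\<lambda>_. borel))" for s
  proof -
    have "(\<lambda>f. f t) \<in> borel_measurable (PiM {0..} (\<lambda>_. borel :: 'g measure))" if "0 \<le> t" for t :: real
      using that by (intro measurable_component_singleton) auto
    then have "(\<lambda>f. f (real (Suc (fst s)) * h) - f (real (fst s) * h)) \<in> borel_measurable (PiM {0..} (\<lambda>_. borel :: 'g measure))"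
      using h_pos by (intro borel_measurable_diff) auto
    from measurable_compose[OF this measurable_q] show ?thesis unfolding G_def[abs_def] .
  qed
  show "(\<lambda>f. prod_list (map (\<lambda>s. G s f) u)) \<in> borel_measurable (PiM {0..} (\<lambda>_. borel))"
    by (induction u) auto
  show "prod_list (map (\<lambda>s. q (snd s) (increment h w (fst s) \<omega>)) u) = prod_list (map (\<lambda>s. G s (\<lambda>t\<in>{0..}. w t \<omega>)) u)" for \<omega>
    using h_pos by (simp add: G_def increment_def)
qed

end

text \<open>The unit vector \<open>v0\<close> provides the scalar reference noise: testing the
  increments of w against it gives independent N(0, h) variables on the given probability space.
  They may depend on the noise of the scheme, because only expectations of words are
  compared.\<close>

locale brownian_pair = p: brownian_increments Q V q w h + k: brownian_increments Q V' q w' h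
  for Q :: "'w measure" and V V' :: "'g::euclidean_space set" and q w w' h +
  fixes e :: "'n \<Rightarrow> 'g" and v0 :: 'g
  assumes independent: "independent_processes Q w w'"
    and e_mem: "\<And>i. e i \<in> V \<or> e i \<in> V'" and e_norm: "\<And>i. q (e i) (e i) = 1"
    and v0: "v0 \<in> V" "q v0 v0 = 1"
begin

definition coord_increment :: "nat \<times> 'n \<Rightarrow> 'w \<Rightarrow> real" where
  "coord_increment s \<omega> = q (e (snd s)) (increment h (if e (snd s) \<in> V then w else w') (fst s) \<omega>)"

definition ref_increment :: "nat \<Rightarrow> 'w \<Rightarrow> real" where
  "ref_increment k \<omega> = q v0 (increment h w k \<omega>)"

lemma ref_increment_normal: "distributed Q lborel (ref_increment k) (normal_density 0 (sqrt h))"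
proof -
  have "v0 \<noteq> 0" using v0(2) linear_0[OF p.linear_q] by auto
  then show ?thesis using p.inc.X_normal[OF v0(1), of k] v0(2) unfolding ref_increment_def[abs_def] by simp
qed

lemma ref_increment_indep: "p.indep_vars (\<lambda>_. borel) ref_increment {..<n}"
  unfolding ref_increment_def[abs_def]
  by (rule p.indep_vars_compose2[OF p.increments_indep]) auto

lemma ref_word:
  assumes "\<And>k. k \<in> set u \<Longrightarrow> k < n"
  shows "integrable Q (\<lambda>\<omega>. prod_list (map (\<lambda>k. ref_increment k \<omega>) u))" (is ?I)
    and "p.expectation (\<lambda>\<omega>. prod_list (map (\<lambda>k. ref_increment k \<omega>) u))
      = (\<Prod>k<n. sqrt h ^ count_list u k * gauss_moment (count_list u k))" (is ?E)
proof -
  let ?u = "map (\<lambda>k. (k, v0)) u"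
  have eq: "prod_list (map (\<lambda>k. ref_increment k \<omega>) u) = prod_list (map (\<lambda>s. q (snd s) (increment h w (fst s) \<omega>)) ?u)" for \<omega>
    by (simp add: ref_increment_def o_def)
  have mem: "snd s \<in> V" "fst s < n" if "s \<in> set ?u" for s using that assms v0 by auto
  show ?I
    unfolding eq by (rule p.expectation_word(1)[OF mem])
  have fil: "map snd (filter (\<lambda>s. fst s = k) (map (\<lambda>k. (k, v0)) u)) = replicate (count_list u k) v0" for k
    by (induction u) auto
  show ?E
    unfolding eq
  proof (rule trans[OF p.expectation_word(2)[OF mem]])
    show "(\<Prod>k<n. p.expectation (\<lambda>\<omega>. prod_list (map (\<lambda>v. q v (increment h w k \<omega>)) (map snd (filter (\<lambda>s. fst s = k) ?u)))))
      = (\<Prod>k<n. sqrt h ^ count_list u k * gauss_moment (count_list u k))"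
      unfolding fil using p.inc.moment(3)[OF v0(1)] v0(2) by (simp add: prod_list_replicate)
  qed
qed

text \<open>The word splits into its letters from w and from w', which are independent. Each part
  factors over the time steps, where \<open>abs_expectation_prod_le\<close> applies, and the counts
  of the two parts within one step are then added by \<open>gauss_moment_mult_le\<close>.\<close>

lemma coord_word:
  shows "integrable Q (\<lambda>\<omega>. prod_list (map (\<lambda>s. coord_increment s \<omega>) u))" (is ?I)
    and "\<bar>p.expectation (\<lambda>\<omega>. prod_list (map (\<lambda>s. coord_increment s \<omega>) u))\<bar>
      \<le> p.expectation (\<lambda>\<omega>. prod_list (map (\<lambda>s. ref_increment (fst s) \<omega>) u))" (is ?L)
proof -
  \<comment> \<open>Any strict bound on the time indices serves. For the empty word the maximum is
    unspecified, but then there is no letter to bound.\<close>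
  define n where "n = Suc (Max (fst ` set u))"
  have n: "fst s < n" if "s \<in> set u" for s
    unfolding n_def less_Suc_eq_le using that by (intro Max_ge) auto
  define P where "P s \<longleftrightarrow> e (snd s) \<in> V" for s :: "nat \<times> 'n"
  define up where "up = map (\<lambda>s. (fst s, e (snd s))) (filter P u)"
  define uk where "uk = map (\<lambda>s. (fst s, e (snd s))) (filter (\<lambda>s. \<not> P s) u)"
  let ?Fp = "\<lambda>\<omega>. prod_list (map (\<lambda>s. q (snd s) (increment h w (fst s) \<omega>)) up)"
  let ?Fk = "\<lambda>\<omega>. prod_list (map (\<lambda>s. q (snd s) (increment h w' (fst s) \<omega>)) uk)"
  have split: "prod_list (map (\<lambda>s. coord_increment s \<omega>) u) = ?Fp \<omega> * ?Fk \<omega>" for \<omega>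
  proof -
    have "map (\<lambda>s. coord_increment s \<omega>) (filter P u) = map (\<lambda>s. q (snd s) (increment h w (fst s) \<omega>)) up"
      "map (\<lambda>s. coord_increment s \<omega>) (filter (\<lambda>s. \<not> P s) u) = map (\<lambda>s. q (snd s) (increment h w' (fst s) \<omega>)) uk"
      unfolding up_def uk_def by (auto simp: coord_increment_def P_def)
    then show ?thesis by (subst prod_list_filter_split[where P = P]) simp
  qed
  have memp: "snd s \<in> V" "fst s < n" if "s \<in> set up" for s using that n by (auto simp: up_def P_def)
  have not_mem: "e i \<notin> V \<Longrightarrow> e i \<in> V'" for i using e_mem by blast
  have memk: "snd s \<in> V'" "fst s < n" if "s \<in> set uk" for s using that n by (auto simp: uk_def P_def not_mem)
  have ip: "integrable Q ?Fp" "p.expectation ?Fp = (\<Prod>k<n. p.expectation (\<lambda>\<omega>. prod_list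
      (map (\<lambda>v. q v (increment h w k \<omega>)) (map snd (filter (\<lambda>s. fst s = k) up)))))"
    by (rule p.expectation_word; erule memp)+
  have ik: "integrable Q ?Fk" "p.expectation ?Fk = (\<Prod>k<n. p.expectation (\<lambda>\<omega>. prod_list
      (map (\<lambda>v. q v (increment h w' k \<omega>)) (map snd (filter (\<lambda>s. fst s = k) uk)))))"
    by (rule k.expectation_word; erule memk)+
  obtain Gp where Gp: "Gp \<in> borel_measurable (PiM {0..} (\<lambda>_. borel))" "\<And>\<omega>. ?Fp \<omega> = Gp (\<lambda>t\<in>{0..}. w t \<omega>)"
    using p.word_factors_path[of up] by blast
  obtain Gk where Gk: "Gk \<in> borel_measurable (PiM {0..} (\<lambda>_. borel))" "\<And>\<omega>. ?Fk \<omega> = Gk (\<lambda>t\<in>{0..}. w' t \<omega>)"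
    using k.word_factors_path[of uk] by blast
  have "p.indep_var borel (Gp \<circ> (\<lambda>\<omega>. \<lambda>t\<in>{0..}. w t \<omega>)) borel (Gk \<circ> (\<lambda>\<omega>. \<lambda>t\<in>{0..}. w' t \<omega>))"
    using independent unfolding independent_processes_def by (rule p.indep_var_compose[OF _ Gp(1) Gk(1)])
  then have ind: "p.indep_var borel ?Fp borel ?Fk"
    unfolding o_def Gp(2)[symmetric] Gk(2)[symmetric] .
  show ?I
    unfolding split by (rule p.indep_var_integrable[OF ind ip(1) ik(1)])
  define np where "np k = length (filter (\<lambda>s. fst s = k) up)" for k
  define nk where "nk k = length (filter (\<lambda>s. fst s = k) uk)" for k
  have cnt: "count_list (map fst u) k = np k + nk k" for k
    unfolding np_def nk_def up_def uk_def by (induction u) auto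
  have "\<bar>p.expectation (\<lambda>\<omega>. prod_list (map (\<lambda>s. coord_increment s \<omega>) u))\<bar> = \<bar>p.expectation ?Fp\<bar> * \<bar>p.expectation ?Fk\<bar>"
    unfolding split abs_mult[symmetric]
    by (rule arg_cong[OF p.indep_var_lebesgue_integral[OF ind ip(1) ik(1)]])
  also have "\<dots> \<le> (\<Prod>k<n. sqrt h ^ np k * gauss_moment (np k)) * (\<Prod>k<n. sqrt h ^ nk k * gauss_moment (nk k))"
  proof (intro mult_mono prod_nonneg mult_nonneg_nonneg gauss_moment_nonneg)
    show "\<bar>p.expectation ?Fp\<bar> \<le> (\<Prod>k<n. sqrt h ^ np k * gauss_moment (np k))"
      unfolding ip(2) abs_prod
    proof (intro prod_mono conjI abs_ge_zero)
      fix k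
      have "set (map snd (filter (\<lambda>s. fst s = k) up)) \<subseteq> V" using memp by auto
      moreover have "q v v = 1" if "v \<in> set (map snd (filter (\<lambda>s. fst s = k) up))" for v
        using that e_norm by (auto simp: up_def)
      ultimately show "\<bar>p.expectation (\<lambda>\<omega>. prod_list (map (\<lambda>v. q v (increment h w k \<omega>)) (map snd (filter (\<lambda>s. fst s = k) up))))\<bar>
          \<le> sqrt h ^ np k * gauss_moment (np k)"
        using p.inc.abs_expectation_prod_le[of "map snd (filter (\<lambda>s. fst s = k) up)" k] by (simp add: np_def)
    qed
    show "\<bar>p.expectation ?Fk\<bar> \<le> (\<Prod>k<n. sqrt h ^ nk k * gauss_moment (nk k))"
      unfolding ik(2) abs_prod
    proof (intro prod_mono conjI abs_ge_zero)
      fix k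
      have "set (map snd (filter (\<lambda>s. fst s = k) uk)) \<subseteq> V'" using memk by auto
      moreover have "q v v = 1" if "v \<in> set (map snd (filter (\<lambda>s. fst s = k) uk))" for v
        using that e_norm by (auto simp: uk_def)
      ultimately show "\<bar>p.expectation (\<lambda>\<omega>. prod_list (map (\<lambda>v. q v (increment h w' k \<omega>)) (map snd (filter (\<lambda>s. fst s = k) uk))))\<bar>
          \<le> sqrt h ^ nk k * gauss_moment (nk k)"
        using k.inc.abs_expectation_prod_le[of "map snd (filter (\<lambda>s. fst s = k) uk)" k] by (simp add: nk_def)
    qed
  qed (use p.h_pos in auto)
  also have "\<dots> = (\<Prod>k<n. sqrt h ^ (np k + nk k) * (gauss_moment (np k) * gauss_moment (nk k)))"
    by (simp add: prod.distrib[symmetric] power_add mult_ac)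
  also have "\<dots> \<le> (\<Prod>k<n. sqrt h ^ (np k + nk k) * gauss_moment (np k + nk k))"
    using p.h_pos
    by (intro prod_mono conjI mult_left_mono gauss_moment_mult_le mult_nonneg_nonneg gauss_moment_nonneg) auto
  also have "\<dots> = p.expectation (\<lambda>\<omega>. prod_list (map (\<lambda>k. ref_increment k \<omega>) (map fst u)))"
    using n by (subst ref_word(2)[of _ n]) (auto simp: cnt)
  finally show ?L
    by (simp add: o_def)
qed

lemma ref_word_integrable: "integrable Q (\<lambda>\<omega>. prod_list (map (\<lambda>k. ref_increment k \<omega>) u))"
  by (rule ref_word(1)[of u "Suc (Max (set u))"]) (simp add: less_Suc_eq_le)

end

section \<open>Pathwise convergence of the Euler scheme\<close>

lemma discrete_gronwall:
  fixes \<epsilon> :: "nat \<Rightarrow> real"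
  assumes "0 \<le> h" "0 \<le> b" "0 \<le> c" "\<epsilon> 0 \<le> 0"
    and "\<And>k. k < n \<Longrightarrow> \<epsilon> (Suc k) \<le> (1 + h * b) * \<epsilon> k + h * c"
  shows "\<epsilon> n \<le> real n * h * c * exp (b * (real n * h))"
proof -
  have "k \<le> n \<Longrightarrow> \<epsilon> k \<le> real k * h * c * (1 + h * b) ^ k" for k
  proof (induction k)
    case (Suc k)
    have "\<epsilon> (Suc k) \<le> (1 + h * b) * \<epsilon> k + h * c" using Suc.prems by (intro assms) auto
    also have "\<dots> \<le> (1 + h * b) * (real k * h * c * (1 + h * b) ^ k) + h * c * (1 + h * b) ^ Suc k"
      using Suc assms mult_left_mono[OF one_le_power[of "1 + h * b" "Suc k"], of "h * c"]
      by (intro add_mono mult_left_mono) (auto simp: mult.assoc)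
    also have "\<dots> = real (Suc k) * h * c * (1 + h * b) ^ Suc k" by (simp add: algebra_simps)
    finally show ?case .
  qed (use assms in simp)
  from this[of n] have "\<epsilon> n \<le> real n * h * c * (1 + h * b) ^ n" by simp
  also have "(1 + h * b) ^ n \<le> exp (h * b) ^ n"
    using assms by (intro power_mono) auto
  also have "exp (h * b) ^ n = exp (b * (real n * h))"
    by (simp add: exp_of_nat_mult[symmetric] mult_ac)
  finally show ?thesis using assms by (simp add: mult_left_mono)
qed

lemma euler_local_error:
  fixes f :: "real \<Rightarrow> 'v::real_normed_vector"
  assumes "0 \<le> h" and "\<And>s. s \<in> {t..t + h} \<Longrightarrow> (f has_vector_derivative f' s) (at s within {t..t + h})"
    and "\<And>s. s \<in> {t..t + h} \<Longrightarrow> norm (f' s - f' t) \<le> \<epsilon>"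
  shows "norm (f (t + h) - f t - h *\<^sub>R f' t) \<le> h * \<epsilon>"
proof -
  have "norm ((\<lambda>s. f s - s *\<^sub>R f' t) (t + h) - (\<lambda>s. f s - s *\<^sub>R f' t) t) \<le> \<epsilon> * norm (t + h - t)"
  proof (rule differentiable_bound[where S = "{t..t + h}" and f' = "\<lambda>s u. u *\<^sub>R (f' s - f' t)"])
    fix s assume s: "s \<in> {t..t + h}"
    have "((\<lambda>s. f s - s *\<^sub>R f' t) has_vector_derivative f' s - f' t) (at s within {t..t + h})"
      by (rule derivative_eq_intros assms(2)[OF s] refl | simp)+
    then show "((\<lambda>s. f s - s *\<^sub>R f' t) has_derivative (\<lambda>u. u *\<^sub>R (f' s - f' t))) (at s within {t..t + h})"
      by (simp add: has_vector_derivative_def)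
    show "onorm (\<lambda>u. u *\<^sub>R (f' s - f' t)) \<le> \<epsilon>"
      using assms(3)[OF s] by (intro onorm_le) (simp add: mult.commute[of \<epsilon>] mult_left_mono)
  qed (use assms in auto)
  then show ?thesis using assms(1) by (simp add: algebra_simps)
qed

text \<open>The noise is additive and enters scheme and equation through the same increments, so the
  only error is that of freezing Y in the drift over one step. As \<open>1 - a * h\<close> lies
  between 0 and 1, the errors add up without amplification.\<close>

lemma linear_sde_euler_error:
  fixes Y \<beta> :: "real \<Rightarrow> real"
  assumes cont: "continuous_on {0..} Y" and a: "0 < a" "a * h \<le> 1" and h: "0 < h"
    and eq: "\<And>t. 0 \<le> t \<Longrightarrow> Y t = Y0 - integral {0..t} (\<lambda>s. a * Y s) + \<sigma> * \<beta> t"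
    and y: "y 0 = Y 0" "\<And>k. y (Suc k) = (1 - a * h) * y k + \<sigma> * (\<beta> (real (Suc k) * h) - \<beta> (real k * h))"
    and mod: "\<And>u v. u \<in> {0..M} \<Longrightarrow> v \<in> {0..M} \<Longrightarrow> \<bar>u - v\<bar> \<le> h \<Longrightarrow> \<bar>Y u - Y v\<bar> \<le> \<epsilon>"
    and k: "real k * h \<le> M"
  shows "\<bar>y k - Y (real k * h)\<bar> \<le> a * (real k * h) * \<epsilon>"
  using k
proof (induction k)
  case (Suc k)
  let ?t = "real k * h"
  have t: "0 \<le> ?t" "real (Suc k) * h = ?t + h" "?t + h \<le> M" using h Suc.prems by (auto simp: algebra_simps)
  have M: "?t \<le> M" using t h by auto
  have int: "(\<lambda>s. a * Y s) integrable_on {0..?t + h}"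
    by (intro integrable_continuous_real continuous_intros continuous_on_subset[OF cont]) auto
  have "integral {0..?t + h} (\<lambda>s. a * Y s) = integral {0..?t} (\<lambda>s. a * Y s) + integral {?t..?t + h} (\<lambda>s. a * Y s)"
    using t(1) h int by (intro Henstock_Kurzweil_Integration.integral_combine[symmetric]) auto
  then have Y: "Y (?t + h) = Y ?t - integral {?t..?t + h} (\<lambda>s. a * Y s) + \<sigma> * (\<beta> (?t + h) - \<beta> ?t)"
    using eq[of "?t + h"] eq[of ?t] t(1) h by (simp add: algebra_simps)
  have int': "(\<lambda>s. a * Y s) integrable_on {?t..?t + h}"
    using t by (intro integrable_continuous_real continuous_intros continuous_on_subset[OF cont]) auto
  have "norm (integral {?t..?t + h} (\<lambda>s. a * Y s - a * Y ?t)) \<le> a * \<epsilon> * (?t + h - ?t)"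
  proof (rule integral_bound)
    show "continuous_on {?t..?t + h} (\<lambda>s. a * Y s - a * Y ?t)"
      using t by (intro continuous_intros continuous_on_subset[OF cont]) auto
    fix s assume "s \<in> {?t..?t + h}"
    then have "0 \<le> s" "s \<le> M" "\<bar>s - ?t\<bar> \<le> h"
      using t order_trans[OF t(1), of s] by (auto simp del: mult_nonneg_nonneg)
    then have "\<bar>Y s - Y ?t\<bar> \<le> \<epsilon>" using t(1) M by (intro mod) auto
    then show "norm (a * Y s - a * Y ?t) \<le> a * \<epsilon>"
      using a by (simp add: right_diff_distrib[symmetric] abs_mult)
  qed (use h in auto)
  moreover have "integral {?t..?t + h} (\<lambda>s. a * Y s - a * Y ?t) = integral {?t..?t + h} (\<lambda>s. a * Y s) - h * (a * Y ?t)"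
    using h int' by (subst Henstock_Kurzweil_Integration.integral_diff) auto
  ultimately have I: "\<bar>integral {?t..?t + h} (\<lambda>s. a * Y s) - h * (a * Y ?t)\<bar> \<le> a * \<epsilon> * h" by simp
  have "y (Suc k) - Y (real (Suc k) * h) = (1 - a * h) * (y k - Y ?t) + (integral {?t..?t + h} (\<lambda>s. a * Y s) - h * (a * Y ?t))"
    unfolding y t(2) Y by (simp add: algebra_simps)
  then have "\<bar>y (Suc k) - Y (real (Suc k) * h)\<bar> \<le> \<bar>(1 - a * h) * (y k - Y ?t)\<bar> + a * \<epsilon> * h"
    using I by linarith
  also have "\<bar>(1 - a * h) * (y k - Y ?t)\<bar> \<le> \<bar>y k - Y ?t\<bar>"
    using a h by (simp add: abs_mult mult_left_le_one_le)
  also have "\<bar>y k - Y ?t\<bar> \<le> a * ?t * \<epsilon>" using Suc M by simp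
  finally show ?case by (simp add: algebra_simps)
qed (use y in simp)

text \<open>The path Y is merely continuous, so no rate of convergence is claimed; uniform
  continuity on the compact interval gives a \<delta> for each \<epsilon>. It depends on the path,
  which suffices for limits at fixed \<omega>.\<close>

lemma euler_scheme_converges:
  fixes X :: "real \<Rightarrow> 'v::euclidean_space" and Y \<beta> :: "'i::finite \<Rightarrow> real \<Rightarrow> real"
  assumes M: "0 < M" and lin: "linear A0" "\<And>i. linear (A i)" and a: "\<And>i. 0 < a i"
    and contY: "\<And>i. continuous_on {0..} (Y i)"
    and eqY: "\<And>i t. 0 \<le> t \<Longrightarrow> Y i t = Y0 i - integral {0..t} (\<lambda>s. a i * Y i s) + \<sigma> i * \<beta> i t"
    and X: "\<And>t. 0 \<le> t \<Longrightarrow> (X has_vector_derivative A0 (X t) + (\<Sum>i\<in>UNIV. Y i t *\<^sub>R A i (X t))) (at t within {0..})"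
    and \<epsilon>: "0 < \<epsilon>"
  obtains \<delta> where "0 < \<delta>"
    "\<And>h y x k. 0 < h \<Longrightarrow> h \<le> \<delta> \<Longrightarrow> (\<And>i. a i * h \<le> 1) \<Longrightarrow> (\<And>i. y 0 i = Y i 0) \<Longrightarrow>
      (\<And>k i. y (Suc k) i = (1 - a i * h) * y k i + \<sigma> i * (\<beta> i (real (Suc k) * h) - \<beta> i (real k * h))) \<Longrightarrow>
      x 0 = X 0 \<Longrightarrow> (\<And>k. x (Suc k) = x k + h *\<^sub>R (A0 (x k) + (\<Sum>i\<in>UNIV. y k i *\<^sub>R A i (x k)))) \<Longrightarrow>
      real k * h \<le> M \<Longrightarrow> norm (x k - X (real k * h)) \<le> \<epsilon>"
proof -
  define F where "F t = A0 (X t) + (\<Sum>i\<in>UNIV. Y i t *\<^sub>R A i (X t))" for t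
  have cX: "continuous_on {0..} X"
    using X by (intro continuous_on_eq_continuous_within[THEN iffD2] ballI has_vector_derivative_continuous) auto
  have clin: "continuous_on S (\<lambda>t. L (X t))" if "linear L" "S \<subseteq> {0..}" for L :: "'v \<Rightarrow> 'v" and S
    using continuous_on_compose2[OF linear_continuous_on continuous_on_subset[OF cX that(2)], of L UNIV] that(1)
    by (simp add: linear_conv_bounded_linear)
  have cF: "continuous_on {0..M} F"
    unfolding F_def by (intro continuous_intros clin lin continuous_on_subset[OF contY]) auto
  define Yv where "Yv t = (\<chi> i. Y i t)" for t
  have cYv: "continuous_on {0..M} Yv"
    unfolding Yv_def by (intro continuous_on_vec_lambda continuous_on_subset[OF contY]) auto
  have bd: "\<exists>c>0. \<forall>v. norm (L v) \<le> c * norm v" if "linear L" for L :: "'v \<Rightarrow> 'v"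
    using bounded_linear.pos_bounded[of L] that by (auto simp: linear_conv_bounded_linear mult.commute)
  obtain K0 where K0: "0 < K0" "\<And>v. norm (A0 v) \<le> K0 * norm v" using bd[OF lin(1)] by blast
  have "\<exists>c. \<forall>i. 0 < c i \<and> (\<forall>v. norm (A i v) \<le> c i * norm v)"
    by (intro choice allI) (use bd[OF lin(2)] in blast)
  then obtain c where c: "\<And>i. 0 < c i" "\<And>i v. norm (A i v) \<le> c i * norm v" by blast
  have "compact (X ` {0..M})"
    by (intro compact_continuous_image continuous_on_subset[OF cX]) auto
  then have "bounded (X ` {0..M})" by (rule compact_imp_bounded)
  then obtain CX where CX: "0 < CX" "\<And>t. t \<in> {0..M} \<Longrightarrow> norm (X t) \<le> CX"
    unfolding bounded_pos by auto
  have "bounded (Yv ` {0..M})"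
    by (intro compact_imp_bounded compact_continuous_image cYv) auto
  then obtain CY where CY: "0 < CY" "\<And>t. t \<in> {0..M} \<Longrightarrow> norm (Yv t) \<le> CY"
    unfolding bounded_pos by auto
  have CYi: "\<bar>Y i t\<bar> \<le> CY" if "t \<in> {0..M}" for i t
    using component_le_norm_cart[of "Yv t" i] CY(2)[OF that] by (simp add: Yv_def)
  define C where "C = (\<Sum>i\<in>UNIV. c i)"
  have C0: "0 \<le> C" unfolding C_def using c(1) by (intro sum_nonneg) (auto intro: less_imp_le)
  define b where "b = K0 + (CY + 1) * C"
  have b0: "0 \<le> b" unfolding b_def using K0 CY C0 by simp
  \<comment> \<open>The tolerance for which the Gronwall bound at the end is at most \<epsilon>; the
    cap 1 keeps the scheme for Y within \<open>CY + 1\<close>.\<close>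
  define \<eta> where "\<eta> = min 1 (\<epsilon> / (M * (C * CX + 1) * exp (b * M)))"
  have pos: "0 < M * (C * CX + 1) * exp (b * M)" using M C0 CX(1) by (simp add: add_nonneg_pos)
  have \<eta>: "0 < \<eta>" "\<eta> \<le> 1" "M * ((C * CX + 1) * \<eta>) * exp (b * M) \<le> \<epsilon>"
  proof -
    show "0 < \<eta>" "\<eta> \<le> 1" unfolding \<eta>_def using pos \<epsilon> by auto
    have "\<eta> \<le> \<epsilon> / (M * (C * CX + 1) * exp (b * M))" unfolding \<eta>_def by simp
    then show "M * ((C * CX + 1) * \<eta>) * exp (b * M) \<le> \<epsilon>"
      using pos by (simp add: pos_le_divide_eq mult_ac)
  qed
  define sa where "sa = (\<Sum>i\<in>UNIV. a i)"
  have sa: "0 \<le> sa" "a i \<le> sa" for i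
    unfolding sa_def by (rule sum_nonneg, simp add: a less_imp_le) (rule member_le_sum; simp add: a less_imp_le)
  define \<eta>' where "\<eta>' = \<eta> / (sa * M + 1)"
  have sM: "0 < sa * M + 1" using sa(1) M by (simp add: add_nonneg_pos)
  have \<eta>': "0 < \<eta>'" "sa * M * \<eta>' \<le> \<eta>" unfolding \<eta>'_def using \<eta>(1) sM by (auto simp: field_simps)
  have "uniformly_continuous_on {0..M} F" "uniformly_continuous_on {0..M} Yv"
    by (auto intro!: compact_uniformly_continuous cF cYv)
  then obtain d1 d2 where d1: "0 < d1" "\<And>u v. u \<in> {0..M} \<Longrightarrow> v \<in> {0..M} \<Longrightarrow> dist u v < d1 \<Longrightarrow> dist (F u) (F v) < \<eta>"
    and d2: "0 < d2" "\<And>u v. u \<in> {0..M} \<Longrightarrow> v \<in> {0..M} \<Longrightarrow> dist u v < d2 \<Longrightarrow> dist (Yv u) (Yv v) < \<eta>'"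
    unfolding uniformly_continuous_on_def using \<eta>(1) \<eta>'(1) by metis
  define \<delta> where "\<delta> = min d1 d2 / 2"
  have \<delta>: "0 < \<delta>" "\<delta> < d1" "\<delta> < d2" unfolding \<delta>_def using d1(1) d2(1) by auto
  show ?thesis
  proof (rule that[OF \<delta>(1)])
    fix h :: real and y :: "nat \<Rightarrow> 'i \<Rightarrow> real" and x :: "nat \<Rightarrow> 'v" and n :: nat
    assume h: "0 < h" "h \<le> \<delta>" "\<And>i. a i * h \<le> 1" and y0: "\<And>i. y 0 i = Y i 0"
      and ySuc: "\<And>k i. y (Suc k) i = (1 - a i * h) * y k i + \<sigma> i * (\<beta> i (real (Suc k) * h) - \<beta> i (real k * h))"
      and x0: "x 0 = X 0" and xSuc: "\<And>k. x (Suc k) = x k + h *\<^sub>R (A0 (x k) + (\<Sum>i\<in>UNIV. y k i *\<^sub>R A i (x k)))"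
      and n: "real n * h \<le> M"
    have yerr: "\<bar>y k i - Y i (real k * h)\<bar> \<le> \<eta>" if "real k * h \<le> M" for k i
    proof -
      have "\<bar>y k i - Y i (real k * h)\<bar> \<le> a i * (real k * h) * \<eta>'"
      proof (rule linear_sde_euler_error[where y = "\<lambda>k. y k i" and M = M, OF contY a h(3) h(1) eqY])
        fix u v assume uv: "u \<in> {0..M}" "v \<in> {0..M}" "\<bar>u - v\<bar> \<le> h"
        have "\<bar>Y i u - Y i v\<bar> \<le> norm (Yv u - Yv v)"
          using component_le_norm_cart[of "Yv u - Yv v" i] by (simp add: Yv_def)
        also have "\<dots> \<le> \<eta>'" using d2(2)[OF uv(1,2)] uv(3) h \<delta> by (simp add: dist_norm)
        finally show "\<bar>Y i u - Y i v\<bar> \<le> \<eta>'" .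
      qed (use y0 ySuc that in auto)
      also have "\<dots> \<le> sa * M * \<eta>'"
        using a h(1) that \<eta>'(1) sa by (intro mult_right_mono mult_mono) (auto intro: less_imp_le)
      finally show ?thesis using \<eta>'(2) by linarith
    qed
    define err where "err k = norm (x k - X (real k * h))" for k
    have "err n \<le> real n * h * ((C * CX + 1) * \<eta>) * exp (b * (real n * h))"
    proof (rule discrete_gronwall[OF less_imp_le[OF h(1)] b0])
      show "0 \<le> (C * CX + 1) * \<eta>" using C0 CX(1) \<eta>(1) by simp
      show "err 0 \<le> 0" unfolding err_def by (simp add: x0)
      fix k assume "k < n"
      then have "real (Suc k) * h \<le> real n * h" using h(1) by (intro mult_right_mono) auto
      then have t': "real k * h + h \<le> M" using n by (simp add: algebra_simps)
      let ?t = "real k * h"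
      have t: "0 \<le> ?t" "?t \<le> M" "?t \<in> {0..M}" using t' h(1) by auto
      have loc: "norm (X (?t + h) - X ?t - h *\<^sub>R F ?t) \<le> h * \<eta>"
      proof (rule euler_local_error)
        fix s assume s: "s \<in> {?t..?t + h}"
        show "(X has_vector_derivative F s) (at s within {?t..?t + h})"
          unfolding F_def using s order_trans[OF t(1)]
          by (intro has_vector_derivative_within_subset[OF X]) auto
        have "dist s ?t < d1" using s h \<delta> by (auto simp: dist_real_def)
        then show "norm (F s - F ?t) \<le> \<eta>"
          using d1(2)[of s ?t] s t t' order_trans[OF t(1), of s] by (auto simp: dist_norm)
      qed (use h in auto)
      define u where "u = x k - X ?t"
      have yb: "\<bar>y k i\<bar> \<le> CY + 1" for i
        using yerr[OF t(2), of i] CYi[OF t(3), of i] \<eta>(2) by linarith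
      have B1: "norm (A0 u + (\<Sum>i\<in>UNIV. y k i *\<^sub>R A i u)) \<le> b * norm u"
      proof -
        have "norm (\<Sum>i\<in>UNIV. y k i *\<^sub>R A i u) \<le> (\<Sum>i\<in>UNIV. (CY + 1) * (c i * norm u))"
          using CY(1) by (intro sum_norm_le) (auto intro!: mult_mono yb c)
        also have "\<dots> = (CY + 1) * C * norm u"
          by (simp add: C_def sum_distrib_left sum_distrib_right mult.assoc)
        finally show ?thesis using norm_triangle_ineq[of "A0 u" "\<Sum>i\<in>UNIV. y k i *\<^sub>R A i u"] K0(2)[of u]
          unfolding b_def by (simp add: algebra_simps)
      qed
      have B2: "norm (\<Sum>i\<in>UNIV. (y k i - Y i ?t) *\<^sub>R A i (X ?t)) \<le> C * CX * \<eta>"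
      proof -
        have "norm (\<Sum>i\<in>UNIV. (y k i - Y i ?t) *\<^sub>R A i (X ?t)) \<le> (\<Sum>i\<in>UNIV. \<eta> * (c i * CX))"
        proof (rule sum_norm_le)
          fix i
          have "norm (A i (X ?t)) \<le> c i * CX"
            using c(1)[of i] CX(2)[OF t(3)] by (intro order_trans[OF c(2)] mult_left_mono) auto
          then show "norm ((y k i - Y i ?t) *\<^sub>R A i (X ?t)) \<le> \<eta> * (c i * CX)"
            using yerr[OF t(2), of i] \<eta>(1) by (auto intro!: mult_mono)
        qed
        also have "\<dots> = C * CX * \<eta>" by (simp add: C_def sum_distrib_left sum_distrib_right mult_ac)
        finally show ?thesis .
      qed
      \<comment> \<open>The three sources of error: the previous error propagated by the scheme, the
        wrong coefficients along the exact solution, and the local error.\<close>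
      have "x (Suc k) - X (?t + h) = u + h *\<^sub>R (A0 u + (\<Sum>i\<in>UNIV. y k i *\<^sub>R A i u))
          + h *\<^sub>R (\<Sum>i\<in>UNIV. (y k i - Y i ?t) *\<^sub>R A i (X ?t)) - (X (?t + h) - X ?t - h *\<^sub>R F ?t)"
      proof -
        have x: "x k = u + X ?t" by (simp add: u_def)
        show ?thesis unfolding xSuc F_def x linear_add[OF lin(1)] linear_add[OF lin(2)]
          by (simp add: algebra_simps sum.distrib sum_subtractf scaleR_sum_right)
      qed
      also have "norm \<dots> \<le> norm u + h * (b * norm u) + h * (C * CX * \<eta>) + h * \<eta>"
      proof -
        have tri: "norm (p + h *\<^sub>R q + h *\<^sub>R r - s) \<le> norm p + h * norm q + h * norm r + norm s" for p q r s :: 'v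
          using norm_triangle_ineq4[of "p + h *\<^sub>R q + h *\<^sub>R r" s]
            norm_triangle_ineq[of "p + h *\<^sub>R q" "h *\<^sub>R r"] norm_triangle_ineq[of p "h *\<^sub>R q"] h(1)
          by simp
        show ?thesis
          using h(1) by (intro order_trans[OF tri] add_mono order_refl loc mult_left_mono B1 B2) auto
      qed
      finally show "err (Suc k) \<le> (1 + h * b) * err k + h * ((C * CX + 1) * \<eta>)"
        unfolding err_def u_def[symmetric] by (simp add: algebra_simps)
    qed
    also have "\<dots> \<le> M * ((C * CX + 1) * \<eta>) * exp (b * M)"
      using n h(1) b0 C0 CX(1) \<eta>(1) M by (intro mult_mono) (auto intro!: mult_left_mono)
    also have "\<dots> \<le> \<epsilon>" by (rule \<eta>(3))
    finally show "norm (x n - X (real n * h)) \<le> \<epsilon>" unfolding err_def .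
  qed
qed

section \<open>The operators \<open>R\<^sup>0\<close> and \<open>\<N>\<close>\<close>

lemma linear_scaleR_const:
  assumes "linear l"
  shows "linear (\<lambda>x. l x *\<^sub>R c)"
  by (rule linearI) (simp_all add: linear_add[OF assms] linear_cmul[OF assms] scaleR_add_left)

locale cartan_data =
  fixes br :: "'g::euclidean_space \<Rightarrow> 'g \<Rightarrow> 'g" and \<theta> :: "'g \<Rightarrow> 'g" and B :: "'g \<Rightarrow> 'g \<Rightarrow> real"
    and e :: "'n::{finite,linorder} \<Rightarrow> 'g" and cS :: "'g \<Rightarrow> complex^'s::finite^'s"
  assumes linear_theta: "linear \<theta>" and theta_theta: "\<And>x. \<theta> (\<theta> x) = x"
    and linear_B: "\<And>x. linear (B x)" and B_sym: "\<And>x y. B x y = B y x"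
    and B_theta: "\<And>x y. B (\<theta> x) (\<theta> y) = B x y"
    and B_pos: "\<And>x. x \<in> p_part \<theta> \<Longrightarrow> x \<noteq> 0 \<Longrightarrow> 0 < B x x"
    and B_neg: "\<And>x. x \<in> k_part \<theta> \<Longrightarrow> x \<noteq> 0 \<Longrightarrow> B x x < 0"
    and linear_br: "\<And>x. linear (br x)" and linear_br': "\<And>y. linear (\<lambda>x. br x y)"
    and adapted: "adapted_basis B \<theta> e" and p_nontrivial: "p_part \<theta> \<noteq> {0}"
begin

lemma linear_B': "linear (\<lambda>x. B x y)"
proof -
  have "(\<lambda>x. B x y) = B y" using B_sym by (intro ext)
  then show ?thesis using linear_B[of y] by simp
qed

lemma linear_ip: "linear (ip B \<theta> x)"
  unfolding ip_def[abs_def] using linear_compose[OF linear_theta linear_B[of x]]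
  by (intro linear_compose_neg) (simp add: o_def)

lemma linear_ip': "linear (\<lambda>x. ip B \<theta> x y)"
  unfolding ip_def by (intro linear_compose_neg linear_B')

lemma ip_sym: "ip B \<theta> x y = ip B \<theta> y x"
  unfolding ip_def using B_theta[of x "\<theta> y"] B_sym[of "\<theta> x" y] by (simp add: theta_theta)

lemma ip_p_pos: "x \<in> p_part \<theta> \<Longrightarrow> x \<noteq> 0 \<Longrightarrow> 0 < ip B \<theta> x x"
  using B_pos[of x] linear_neg[OF linear_B[of x], of x] by (simp add: ip_def p_part_def)

lemma ip_k_pos: "x \<in> k_part \<theta> \<Longrightarrow> x \<noteq> 0 \<Longrightarrow> 0 < ip B \<theta> x x"
  using B_neg[of x] by (simp add: ip_def k_part_def)

lemma subspace_p: "subspace (p_part \<theta>)"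
  by (auto simp: subspace_def p_part_def linear_0[OF linear_theta] linear_add[OF linear_theta]
      linear_cmul[OF linear_theta])

lemma subspace_k: "subspace (k_part \<theta>)"
  by (auto simp: subspace_def k_part_def linear_0[OF linear_theta] linear_add[OF linear_theta]
      linear_cmul[OF linear_theta])

lemma ip_p_k: "x \<in> p_part \<theta> \<Longrightarrow> y \<in> k_part \<theta> \<Longrightarrow> ip B \<theta> x y = 0"
  using B_theta[of x y] linear_neg[OF linear_B'[of y], of x] by (simp add: ip_def p_part_def k_part_def)

lemma e_orthonormal: "ip B \<theta> (e i) (e j) = (if i = j then 1 else 0)"
  using adapted unfolding adapted_basis_def by blast

lemma e_mem: "e i \<in> p_part \<theta> \<or> e i \<in> k_part \<theta>"
  using adapted unfolding adapted_basis_def by blast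

lemma e_not_p: "e i \<notin> p_part \<theta> \<Longrightarrow> e i \<in> k_part \<theta>"
  using e_mem by blast

lemma expand: "x = (\<Sum>i\<in>UNIV. ip B \<theta> x (e i) *\<^sub>R e i)"
proof -
  have "x \<in> span (range e)" using adapted unfolding adapted_basis_def by auto
  then show ?thesis
  proof (induction rule: span_induct_alt)
    case base
    show ?case by (simp add: linear_0[OF linear_ip'])
  next
    case (step c v x)
    from step(1) obtain j where v: "v = e j" by blast
    have "(\<Sum>i\<in>UNIV. ip B \<theta> (c *\<^sub>R v + x) (e i) *\<^sub>R e i)
        = (\<Sum>i\<in>UNIV. (if j = i then c else 0) *\<^sub>R e i) + (\<Sum>i\<in>UNIV. ip B \<theta> x (e i) *\<^sub>R e i)"
      unfolding sum.distrib[symmetric] v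
      by (intro sum.cong refl)
        (simp add: linear_add[OF linear_ip'] linear_cmul[OF linear_ip'] e_orthonormal algebra_simps)
    also have "(\<Sum>i\<in>UNIV. (if j = i then c else 0) *\<^sub>R e i) = (\<Sum>i\<in>UNIV. if j = i then c *\<^sub>R e i else 0)"
      by (intro sum.cong) auto
    also have "\<dots> = c *\<^sub>R v" by (simp add: v)
    finally show ?case using step(2) by simp
  qed
qed

lemma linear_pr_p: "linear (pr_p \<theta>)"
  by (rule linearI) (simp_all add: pr_p_def linear_add[OF linear_theta] linear_cmul[OF linear_theta] algebra_simps)

lemma linear_pr_k: "linear (pr_k \<theta>)"
  by (rule linearI) (simp_all add: pr_k_def linear_add[OF linear_theta] linear_cmul[OF linear_theta] algebra_simps)

lemma pr_p_e: "pr_p \<theta> (e i) = (if e i \<in> p_part \<theta> then e i else 0)"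
  using e_not_p[of i] by (auto simp: pr_p_def p_part_def k_part_def scaleR_2[symmetric])

lemma pr_k_e: "pr_k \<theta> (e i) = (if e i \<in> p_part \<theta> then 0 else e i)"
  using e_not_p[of i] by (auto simp: pr_k_def p_part_def k_part_def scaleR_2[symmetric])

lemma pr_mem: "pr_p \<theta> x \<in> p_part \<theta>" "pr_k \<theta> x \<in> k_part \<theta>"
  by (simp_all add: pr_p_def pr_k_def p_part_def k_part_def theta_theta linear_cmul[OF linear_theta]
      linear_diff[OF linear_theta] linear_add[OF linear_theta] algebra_simps)

lemma pr_sum: "x = pr_p \<theta> x + pr_k \<theta> x"
  unfolding pr_p_def pr_k_def scaleR_add_right[symmetric] by (simp add: scaleR_2[symmetric])

lemma ip_pr:
  assumes "e i \<in> p_part \<theta>"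
  shows "ip B \<theta> (e i) (pr_p \<theta> x) = ip B \<theta> (e i) x" "ip B \<theta> (e i) (pr_k \<theta> x) = 0"
proof -
  show k: "ip B \<theta> (e i) (pr_k \<theta> x) = 0" by (rule ip_p_k[OF assms pr_mem(2)])
  show "ip B \<theta> (e i) (pr_p \<theta> x) = ip B \<theta> (e i) x"
    using linear_add[OF linear_ip, of "e i" "pr_p \<theta> x" "pr_k \<theta> x"] k pr_sum[of x] by simp
qed

lemma ip_pr':
  assumes "e i \<notin> p_part \<theta>"
  shows "ip B \<theta> (e i) (pr_k \<theta> x) = ip B \<theta> (e i) x" "ip B \<theta> (e i) (pr_p \<theta> x) = 0"
proof -
  show k: "ip B \<theta> (e i) (pr_p \<theta> x) = 0"
    unfolding ip_sym[of "e i"] by (rule ip_p_k[OF pr_mem(1) e_not_p[OF assms]])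
  show "ip B \<theta> (e i) (pr_k \<theta> x) = ip B \<theta> (e i) x"
    using linear_add[OF linear_ip, of "e i" "pr_p \<theta> x" "pr_k \<theta> x"] k pr_sum[of x] by simp
qed

lemma ip_self: "ip B \<theta> x x = (\<Sum>i\<in>UNIV. (ip B \<theta> (e i) x)\<^sup>2)"
proof -
  have "ip B \<theta> x x = ip B \<theta> x (\<Sum>i\<in>UNIV. ip B \<theta> x (e i) *\<^sub>R e i)" using expand[of x] by simp
  also have "\<dots> = (\<Sum>i\<in>UNIV. (ip B \<theta> (e i) x)\<^sup>2)"
    unfolding linear_sum[OF linear_ip] linear_cmul[OF linear_ip]
    by (simp add: power2_eq_square ip_sym[of x])
  finally show ?thesis .
qed

lemma weighted_size:
  "c * ip B \<theta> (pr_p \<theta> x) (pr_p \<theta> x) + ip B \<theta> (pr_k \<theta> x) (pr_k \<theta> x)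
    = (\<Sum>i\<in>UNIV. (if e i \<in> p_part \<theta> then c else 1) * (ip B \<theta> (e i) x)\<^sup>2)"
  unfolding ip_self sum_distrib_left sum.distrib[symmetric]
  by (intro sum.cong refl) (auto simp: ip_pr ip_pr')

text \<open>Supplies the direction of the reference noise. Otherwise the basis would lie in
  \<open>k_part \<theta>\<close>, which would then be the whole space and at the same time
  orthogonal to the nonzero space \<open>p_part \<theta>\<close>.\<close>

lemma unit_p_vector: obtains i where "e i \<in> p_part \<theta>"
proof (rule ccontr)
  assume *: "\<not> thesis"
  have "e i \<in> k_part \<theta>" for i using that * e_not_p by blast
  then have "range e \<subseteq> k_part \<theta>" by auto
  then have k: "k_part \<theta> = UNIV"
    using span_minimal[OF _ subspace_k] adapted unfolding adapted_basis_def by blast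
  have "x = 0" if "x \<in> p_part \<theta>" for x
    using ip_p_k[OF that, of x] ip_p_pos[OF that] k by auto
  then show False using p_nontrivial subspace_0[OF subspace_p] by blast
qed

lemma linear_rot: "linear (rot \<theta> \<phi>)"
  by (rule linearI) (simp_all add: rot_def linear_add[OF linear_pr_p] linear_cmul[OF linear_pr_p]
      linear_add[OF linear_pr_k] linear_cmul[OF linear_pr_k] algebra_simps)

lemma linear_beta_form: "linear (\<lambda>u. beta_form B \<theta> u v)"
  by (rule linearI) (simp_all add: beta_form_def linear_add[OF linear_B'] linear_cmul[OF linear_B']
      linear_add[OF linear_ip'] linear_cmul[OF linear_ip'] algebra_simps)

lemma linear_continuous_compose:
  fixes L :: "'a::euclidean_space \<Rightarrow> 'b::euclidean_space"
  assumes "linear L" "continuous_on S f"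
  shows "continuous_on S (\<lambda>t. L (f t))"
  using continuous_on_compose2[OF linear_continuous_on assms(2), of L UNIV] assms(1)
  by (simp add: linear_conv_bounded_linear)

lemma continuous_rot:
  fixes S :: "real set"
  assumes "continuous_on S f" "continuous_on S g"
  shows "continuous_on S (\<lambda>t. rot \<theta> (f t) (g t))"
  unfolding rot_def
  by (intro continuous_intros linear_continuous_compose[OF linear_pr_p]
      linear_continuous_compose[OF linear_pr_k] continuous_on_cos[OF assms(1)]
      continuous_on_sin[OF assms(1)] assms)

lemma clh_rot_linear:
  assumes "\<And>u. linear (\<lambda>x. A x u)"
  shows "linear (\<lambda>x :: 'g. clh_rot B \<theta> e cS \<phi> (A x) :: ('n, 's) ext_op)"
proof -
  have l: "linear (\<lambda>x. beta_form B \<theta> ((rot \<theta> \<phi> \<circ> A x \<circ> rot \<theta> (- \<phi>)) u) v)" for u v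
    using linear_compose[OF linear_compose[OF assms linear_rot[of \<phi>]] linear_beta_form[of v], of "rot \<theta> (- \<phi>) u"]
    by (simp add: o_def)
  show ?thesis unfolding clh_rot_def clh_End_def
    by (intro linear_compose_scale_right linear_compose_sum ballI linear_scaleR_const l)
qed

lemma clh_rot_continuous:
  fixes S :: "real set"
  assumes "linear A"
  shows "continuous_on S (\<lambda>\<phi>. clh_rot B \<theta> e cS \<phi> A :: ('n, 's) ext_op)"
  unfolding clh_rot_def clh_End_def o_def
  by (intro continuous_intros linear_continuous_compose[OF linear_beta_form] continuous_rot
      linear_continuous_compose[OF assms])

definition R0_p :: "real \<Rightarrow> 'g \<Rightarrow> ('n, 's) ext_op" where
  "R0_p \<phi> x = clh_rot B \<theta> e cS \<phi> (\<lambda>(u, v). (br x u, 0)) - cl_End B \<theta> e (br x)"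

definition R0_k :: "real \<Rightarrow> 'g \<Rightarrow> ('n, 's) ext_op" where
  "R0_k \<phi> x = times_ii o\<^sub>L (cl_End B \<theta> e (\<lambda>u. \<theta> (br x u)) + clh_rot B \<theta> e cS \<phi> (\<lambda>(u, v). (0, br x v)))"

lemma R0_split: "R0 br B \<theta> e cS \<phi> Y = cos \<phi> *\<^sub>R R0_p \<phi> (pr_p \<theta> Y) - sqrt (cos \<phi>) *\<^sub>R R0_k \<phi> (pr_k \<theta> Y)"
  by (simp add: R0_def R0_p_def R0_k_def)

lemma cl_End_linear:
  assumes "\<And>u. linear (\<lambda>x. A x u)"
  shows "linear (\<lambda>x :: 'g. cl_End B \<theta> e (A x) :: ('n, 's) ext_op)"
proof -
  have l: "linear (\<lambda>x. B (A x u) v)" for u v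
    using linear_compose[OF assms linear_B'[of v], of u] by (simp add: o_def)
  show ?thesis unfolding cl_End_def
    by (intro linear_compose_scale_right linear_compose_sum ballI linear_scaleR_const l)
qed

lemma R0_p_linear: "linear (R0_p \<phi>)"
proof -
  have "linear (\<lambda>x. (\<lambda>(u, v). (br x u, 0::'g)) w)" for w :: "'g \<times> 'g"
    by (rule linearI) (auto simp: linear_add[OF linear_br'] linear_cmul[OF linear_br'] split: prod.split)
  then show ?thesis unfolding R0_p_def[abs_def]
    by (intro linear_compose_sub clh_rot_linear cl_End_linear linear_br')
qed

lemma R0_k_linear: "linear (R0_k \<phi>)"
proof -
  have 1: "linear (\<lambda>x. (\<lambda>(u, v). (0::'g, br x v)) w)" for w :: "'g \<times> 'g"
    by (rule linearI) (auto simp: linear_add[OF linear_br'] linear_cmul[OF linear_br'] split: prod.split)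
  have 2: "linear (\<lambda>x. \<theta> (br x u))" for u
    using linear_compose[OF linear_br' linear_theta, of u] by (simp add: o_def)
  have "linear (\<lambda>x. cl_End B \<theta> e (\<lambda>u. \<theta> (br x u)) + clh_rot B \<theta> e cS \<phi> (\<lambda>(u, v). (0, br x v)) :: ('n, 's) ext_op)"
    by (intro linear_compose_add clh_rot_linear cl_End_linear 1 2)
  from linear_compose[OF this bounded_linear.linear[OF bounded_bilinear.bounded_linear_right[OF bounded_bilinear_blinfun_compose]]]
  show ?thesis unfolding R0_k_def[abs_def] by (simp add: o_def)
qed

lemma R0_expand: "R0 br B \<theta> e cS \<phi> Y = (\<Sum>i\<in>UNIV. ip B \<theta> (e i) Y *\<^sub>R R0 br B \<theta> e cS \<phi> (e i))"
proof -
  have lin: "linear (R0 br B \<theta> e cS \<phi>)"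
    unfolding R0_split[abs_def]
    using linear_compose[OF linear_pr_p R0_p_linear[of \<phi>]] linear_compose[OF linear_pr_k R0_k_linear[of \<phi>]]
    by (intro linear_compose_sub linear_compose_scale_right) (auto simp: o_def)
  have "R0 br B \<theta> e cS \<phi> (\<Sum>i\<in>UNIV. ip B \<theta> Y (e i) *\<^sub>R e i)
      = (\<Sum>i\<in>UNIV. ip B \<theta> (e i) Y *\<^sub>R R0 br B \<theta> e cS \<phi> (e i))"
    unfolding linear_sum[OF lin] linear_cmul[OF lin] by (intro sum.cong refl) (subst ip_sym, rule refl)
  then show ?thesis using expand[of Y] by simp
qed

text \<open>The rotated Clifford operators depend continuously on the angle up to and including
  pi/2, so compactness bounds them, while the prefactors of \<open>R0\<close> are kept. Their exact
  powers of cos \<phi> matter, since they have to match the relaxation rates as \<phi> tends to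
  pi/2.\<close>

lemma R0_bound:
  "\<exists>C>0. \<forall>\<phi> i. 0 \<le> \<phi> \<longrightarrow> \<phi> < pi / 2 \<longrightarrow>
    norm (R0 br B \<theta> e cS \<phi> (e i)) \<le> C * (if e i \<in> p_part \<theta> then cos \<phi> else sqrt (cos \<phi>))"
proof -
  have lp: "linear (\<lambda>(u, v). (br x u, 0::'g))" for x
    by (rule linearI) (auto simp: linear_add[OF linear_br] linear_cmul[OF linear_br])
  have lk: "linear (\<lambda>(u, v). (0::'g, br x v))" for x
    by (rule linearI) (auto simp: linear_add[OF linear_br] linear_cmul[OF linear_br])
  have cp: "continuous_on {0..pi / 2} (\<lambda>\<phi>. R0_p \<phi> x)" for x
    unfolding R0_p_def by (intro continuous_intros clh_rot_continuous lp)
  have ck: "continuous_on {0..pi / 2} (\<lambda>\<phi>. R0_k \<phi> x)" for x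
    unfolding R0_k_def by (intro continuous_intros clh_rot_continuous lk)
  have bnd: "\<exists>c. \<forall>\<phi>\<in>{0..pi / 2}. norm (f \<phi>) \<le> c"
    if "continuous_on {0..pi / 2} f" for f :: "real \<Rightarrow> ('n, 's) ext_op"
    using compact_imp_bounded[OF compact_continuous_image[OF that compact_Icc]] by (auto simp: bounded_iff)
  have "\<exists>c. \<forall>i. \<forall>\<phi>\<in>{0..pi / 2}. norm (R0_p \<phi> (e i)) \<le> c i"
    by (rule choice) (intro allI bnd cp)
  then obtain mp where mp: "\<forall>i. \<forall>\<phi>\<in>{0..pi / 2}. norm (R0_p \<phi> (e i)) \<le> mp i" ..
  have "\<exists>c. \<forall>i. \<forall>\<phi>\<in>{0..pi / 2}. norm (R0_k \<phi> (e i)) \<le> c i"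
    by (rule choice) (intro allI bnd ck)
  then obtain mk where mk: "\<forall>i. \<forall>\<phi>\<in>{0..pi / 2}. norm (R0_k \<phi> (e i)) \<le> mk i" ..
  define C where "C = 1 + (\<Sum>i\<in>UNIV. \<bar>mp i\<bar> + \<bar>mk i\<bar>)"
  have C: "\<bar>mp i\<bar> + \<bar>mk i\<bar> \<le> C" for i
    unfolding C_def by (rule order_trans[OF member_le_sum[of i UNIV "\<lambda>i. \<bar>mp i\<bar> + \<bar>mk i\<bar>"]]) auto
  show ?thesis
  proof (intro exI[of _ C] conjI allI impI)
    show "0 < C" unfolding C_def by (intro add_pos_nonneg sum_nonneg) auto
    fix \<phi> :: real and i assume \<phi>: "0 \<le> \<phi>" "\<phi> < pi / 2"
    have cos: "0 < cos \<phi>" using \<phi> by (intro cos_gt_zero_pi) auto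
    show "norm (R0 br B \<theta> e cS \<phi> (e i)) \<le> C * (if e i \<in> p_part \<theta> then cos \<phi> else sqrt (cos \<phi>))"
    proof (cases "e i \<in> p_part \<theta>")
      case True
      have "norm (R0_p \<phi> (e i)) \<le> C" using bspec[OF spec[OF mp, of i], of \<phi>] C[of i] \<phi> by auto
      then have "cos \<phi> * norm (R0_p \<phi> (e i)) \<le> cos \<phi> * C" using cos by (intro mult_left_mono) auto
      then show ?thesis using True cos unfolding R0_split pr_p_e pr_k_e
        by (simp add: linear_0[OF R0_k_linear] mult.commute[of C])
    next
      case False
      have "norm (R0_k \<phi> (e i)) \<le> C" using bspec[OF spec[OF mk, of i], of \<phi>] C[of i] \<phi> by auto
      then have "sqrt (cos \<phi>) * norm (R0_k \<phi> (e i)) \<le> sqrt (cos \<phi>) * C" using cos by (intro mult_left_mono) auto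
      then show ?thesis using False cos unfolding R0_split pr_p_e pr_k_e
        by (simp add: linear_0[OF R0_p_linear] mult.commute[of C])
    qed
  qed
qed

end

section \<open>The number operator as a diagonal operator, and adjoints\<close>

lemma number_rot_apply:
  "blinfun_apply (number_rot \<theta> e \<phi> :: ('n::finite, 's::finite) ext_op) \<omega> $ J =
    (real (card (J \<inter> {i. e i \<in> p_part \<theta>})) + cos \<phi> * real (card (J \<inter> {i. e i \<in> k_part \<theta>}))) *\<^sub>R (\<omega> $ J)"
  by (simp add: number_rot_def blinfun.add_left blinfun.scaleR_left number_op.rep_eq scaleR_add_left)

lemma number_rot_symmetric:
  "blinfun_apply (number_rot \<theta> e \<phi> :: ('n::finite, 's::finite) ext_op) u \<bullet> v
    = u \<bullet> blinfun_apply (number_rot \<theta> e \<phi>) v"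
  unfolding inner_vec_def[of "blinfun_apply _ _"] inner_vec_def[of u] number_rot_apply by simp

lemma norm_vec_le_componentwise:
  fixes u v :: "'a::real_normed_vector ^ 'b::finite"
  assumes "\<And>J. norm (u $ J) \<le> norm (v $ J)"
  shows "norm u \<le> norm v"
  unfolding norm_vec_def by (intro L2_set_mono assms norm_ge_zero)

text \<open>The operator is diagonal with eigenvalues between 0 and \<open>2 * CARD('n)\<close>, so
  under the condition on c the Euler step has eigenvalues in [0, 1].\<close>

lemma number_rot_contraction:
  assumes "0 \<le> c" "c * (2 * real CARD('n)) \<le> 1" "0 \<le> cos \<phi>"
  shows "norm (v - c *\<^sub>R blinfun_apply (number_rot \<theta> e \<phi> :: ('n::finite, 's::finite) ext_op) v) \<le> norm v"
proof (rule norm_vec_le_componentwise)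
  fix J :: "'n set"
  define l where "l = real (card (J \<inter> {i. e i \<in> p_part \<theta>})) + cos \<phi> * real (card (J \<inter> {i. e i \<in> k_part \<theta>}))"
  have card: "card (J \<inter> S) \<le> CARD('n)" for S by (rule card_mono) auto
  have "l \<le> real CARD('n) + 1 * real CARD('n)"
    unfolding l_def using assms(3) card by (intro add_mono mult_mono) auto
  then have "c * l \<le> c * (2 * real CARD('n))" using assms(1) by (intro mult_left_mono) auto
  moreover have "0 \<le> c * l" unfolding l_def using assms by simp
  ultimately have l: "0 \<le> c * l" "c * l \<le> 1" using assms(2) by auto
  have "(v - c *\<^sub>R blinfun_apply (number_rot \<theta> e \<phi> :: ('n, 's) ext_op) v) $ J = (1 - c * l) *\<^sub>R (v $ J)"
    by (simp add: number_rot_apply l_def scaleR_diff_left)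
  then show "norm ((v - c *\<^sub>R blinfun_apply (number_rot \<theta> e \<phi> :: ('n, 's) ext_op) v) $ J) \<le> norm (v $ J)"
    using l by (simp add: mult_left_le_one_le)
qed

text \<open>The generator multiplies U from the right. Adjoints put it on the left, so that for each
  fixed \<xi> the image of \<xi> under the adjoint of U solves a linear equation of its own.\<close>

lemma adjoint_blinfun_inner:
  fixes T :: "'a::euclidean_space \<Rightarrow>\<^sub>L 'b::euclidean_space"
  shows "v \<bullet> adjoint (blinfun_apply T) x = blinfun_apply T v \<bullet> x"
  by (rule adjoint_works) (rule bounded_linear.linear[OF blinfun.bounded_linear_right])

lemma adjoint_blinfun_norm:
  fixes T :: "'a::euclidean_space \<Rightarrow>\<^sub>L 'b::euclidean_space"
  shows "norm (adjoint (blinfun_apply T) x) \<le> norm T * norm x"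
proof -
  let ?a = "adjoint (blinfun_apply T) x"
  have "norm ?a * norm ?a = blinfun_apply T ?a \<bullet> x"
    using adjoint_blinfun_inner[of ?a T x] by (simp add: power2_norm_eq_inner[symmetric] power2_eq_square)
  also have "\<dots> \<le> (norm T * norm ?a) * norm x"
    by (intro order_trans[OF norm_cauchy_schwarz] mult_right_mono norm_blinfun) auto
  finally have "norm ?a * norm ?a \<le> norm ?a * (norm T * norm x)" by (simp add: mult_ac)
  then show ?thesis by (cases "?a = 0") auto
qed

lemma bounded_linear_adjoint_blinfun:
  "bounded_linear (\<lambda>T :: 'a::euclidean_space \<Rightarrow>\<^sub>L 'b::euclidean_space. adjoint (blinfun_apply T) x)"
proof (rule bounded_linear_intro[where K = "norm x"])
  fix S T :: "'a \<Rightarrow>\<^sub>L 'b" and c :: real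
  have "v \<bullet> adjoint (blinfun_apply (S + T)) x = v \<bullet> (adjoint (blinfun_apply S) x + adjoint (blinfun_apply T) x)" for v
    by (simp add: adjoint_blinfun_inner inner_add_right inner_add_left blinfun.add_left)
  then show "adjoint (blinfun_apply (S + T)) x = adjoint (blinfun_apply S) x + adjoint (blinfun_apply T) x"
    by (rule vector_eq_ldot[THEN iffD1, OF allI])
  have "v \<bullet> adjoint (blinfun_apply (c *\<^sub>R T)) x = v \<bullet> (c *\<^sub>R adjoint (blinfun_apply T) x)" for v
    by (simp add: adjoint_blinfun_inner blinfun.scaleR_left)
  then show "adjoint (blinfun_apply (c *\<^sub>R T)) x = c *\<^sub>R adjoint (blinfun_apply T) x"
    by (rule vector_eq_ldot[THEN iffD1, OF allI])
  show "norm (adjoint (blinfun_apply T) x) \<le> norm T * norm x" by (rule adjoint_blinfun_norm)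
qed

lemma adjoint_blinfun_compose:
  fixes S :: "'b::euclidean_space \<Rightarrow>\<^sub>L 'c::euclidean_space" and T :: "'a::euclidean_space \<Rightarrow>\<^sub>L 'b"
  shows "adjoint (blinfun_apply (S o\<^sub>L T)) x = adjoint (blinfun_apply T) (adjoint (blinfun_apply S) x)"
proof -
  have "v \<bullet> adjoint (blinfun_apply (S o\<^sub>L T)) x = v \<bullet> adjoint (blinfun_apply T) (adjoint (blinfun_apply S) x)" for v
    by (simp add: adjoint_blinfun_inner)
  then show ?thesis by (rule vector_eq_ldot[THEN iffD1, OF allI])
qed

text \<open>Finitely many initial vectors thus control the operator norm, and no supremum over the
  unit sphere has to be taken inside the expectation.\<close>

lemma norm_blinfun_le_sum_adjoint:
  fixes T :: "'a::euclidean_space \<Rightarrow>\<^sub>L 'b::euclidean_space"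
  shows "norm T \<le> (\<Sum>x\<in>Basis. norm (adjoint (blinfun_apply T) x))"
proof (rule norm_blinfun_bound)
  fix v
  have "norm (blinfun_apply T v) \<le> (\<Sum>x\<in>Basis. \<bar>blinfun_apply T v \<bullet> x\<bar>)" by (rule norm_le_l1)
  also have "\<dots> \<le> (\<Sum>x\<in>Basis. norm (adjoint (blinfun_apply T) x) * norm v)"
    unfolding adjoint_blinfun_inner[symmetric]
    by (intro sum_mono) (simp add: Cauchy_Schwarz_ineq2 mult.commute[of _ "norm v"])
  finally show "norm (blinfun_apply T v) \<le> (\<Sum>x\<in>Basis. norm (adjoint (blinfun_apply T) x)) * norm v"
    by (simp add: sum_distrib_right)
qed (auto intro: sum_nonneg)

section \<open>The flow\<close>

lemma sum_power_le_card_power: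
  fixes f :: "'a \<Rightarrow> real"
  assumes "finite A" "A \<noteq> {}" "\<And>x. x \<in> A \<Longrightarrow> 0 \<le> f x"
  shows "(\<Sum>x\<in>A. f x) ^ q \<le> real (card A) ^ q * (\<Sum>x\<in>A. f x ^ q)"
proof -
  have "Max (f ` A) \<in> f ` A" using assms by (intro Max_in) auto
  then obtain x where x: "x \<in> A" "f x = Max (f ` A)" by auto
  have "(\<Sum>x\<in>A. f x) \<le> real (card A) * f x"
    using assms(1) by (intro sum_bounded_above) (simp add: x(2))
  then have "(\<Sum>x\<in>A. f x) ^ q \<le> (real (card A) * f x) ^ q"
    using assms(3) by (intro power_mono sum_nonneg) auto
  also have "\<dots> = real (card A) ^ q * f x ^ q" by (rule power_mult_distrib)
  also have "f x ^ q \<le> (\<Sum>x\<in>A. f x ^ q)"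
    using x(1) assms(1,3) by (intro member_le_sum[where f = "\<lambda>x. f x ^ q"]) auto
  finally show ?thesis by (simp add: mult_left_mono)
qed

lemma powr_le_one_plus_power:
  fixes u :: real
  assumes "0 \<le> u" "0 \<le> p" "p \<le> real q"
  shows "u powr p \<le> 1 + u ^ q"
proof (cases "u \<le> 1")
  case True
  then have "u powr p \<le> 1" using assms by (intro powr_le1) auto
  then show ?thesis using assms(1) by (smt (verit) zero_le_power)
next
  case False
  then have "u powr p \<le> u powr real q" using assms by (intro powr_mono) auto
  also have "\<dots> = u ^ q" using False by (simp add: powr_realpow)
  finally show ?thesis by simp
qed

text \<open>Fatou's lemma: \<open>H N\<close> bounds the approximations at all times at once, so its
  lower limit bounds the uncountable supremum over t. Measurability of that supremum is avoided
  because the lower integral is monotone on all functions. As E \<ge> 1, the root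
  \<open>E powr (1 / p)\<close> is at most E.\<close>

lemma Lp_norm_SUP_le:
  fixes F :: "real \<Rightarrow> 'w \<Rightarrow> real" and H :: "nat \<Rightarrow> 'w \<Rightarrow> real"
  assumes p: "1 \<le> p" and E: "1 \<le> E" and T: "T \<noteq> {}"
    and F: "\<And>t \<omega>. 0 \<le> F t \<omega>"
    and int: "\<And>N. integrable Q (H N)" "\<And>N \<omega>. 0 \<le> H N \<omega>" "\<And>N. (\<integral>\<omega>. H N \<omega> \<partial>Q) \<le> E"
    and le: "AE \<omega> in Q. \<forall>t\<in>T. \<exists>c. c \<longlonglongrightarrow> F t \<omega> powr p \<and> (\<forall>N. c N \<le> H N \<omega>)"
  shows "Lp_norm Q p (\<lambda>\<omega>. SUP t\<in>T. ennreal (F t \<omega>)) \<le> ennreal E"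
proof -
  let ?S = "\<lambda>\<omega>. SUP t\<in>T. ennreal (F t \<omega>)" and ?L = "\<lambda>\<omega>. liminf (\<lambda>N. ennreal (H N \<omega>))"
  define pw where "pw x r = (if x = \<infinity> then \<infinity> else ennreal (enn2real x powr r))" for x :: ennreal and r :: real
  have "AE \<omega> in Q. pw (?S \<omega>) p \<le> ?L \<omega>"
    using le
  proof (eventually_elim)
    case (elim \<omega>)
    define L where "L = ?L \<omega>"
    have FL: "ennreal (F t \<omega> powr p) \<le> L" if "t \<in> T" for t
    proof -
      from elim that obtain c where c: "c \<longlonglongrightarrow> F t \<omega> powr p" "\<And>N. c N \<le> H N \<omega>" by blast
      have "(\<lambda>N. ennreal (c N)) \<longlonglongrightarrow> ennreal (F t \<omega> powr p)" by (rule tendsto_ennrealI[OF c(1)])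
      then have "ennreal (F t \<omega> powr p) = liminf (\<lambda>N. ennreal (c N))"
        by (intro lim_imp_Liminf[symmetric]) auto
      also have "\<dots> \<le> L" unfolding L_def by (intro Liminf_mono always_eventually allI ennreal_leI c(2))
      finally show ?thesis .
    qed
    show ?case
    proof (cases L rule: ennreal_cases)
      case top
      then show ?thesis unfolding L_def by simp
    next
      case (real l)
      have "F t \<omega> \<le> l powr (1 / p)" if "t \<in> T" for t
      proof -
        have "F t \<omega> powr p \<le> l" using FL[OF that] real by (simp add: ennreal_le_iff)
        then have "(F t \<omega> powr p) powr (1 / p) \<le> l powr (1 / p)" using p by (intro powr_mono2) auto
        then show ?thesis using p F[of t \<omega>] by (simp add: powr_powr)
      qed
      then have S: "(?S \<omega>) \<le> ennreal (l powr (1 / p))"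
        by (intro SUP_least ennreal_leI)
      then have fin: "(?S \<omega>) \<noteq> \<infinity>"
        by (metis ennreal_less_top infinity_ennreal_def leD)
      have "enn2real (?S \<omega>) \<le> l powr (1 / p)"
        using enn2real_mono[OF S] by simp
      then have "enn2real (?S \<omega>) powr p \<le> (l powr (1 / p)) powr p"
        using p by (intro powr_mono2) auto
      also have "\<dots> = l" using p real by (simp add: powr_powr)
      finally show ?thesis unfolding L_def[symmetric] real(2) pw_def if_not_P[OF fin] by (rule ennreal_leI)
    qed
  qed
  then have "(\<integral>\<^sup>+\<omega>. pw (?S \<omega>) p \<partial>Q) \<le> (\<integral>\<^sup>+\<omega>. ?L \<omega> \<partial>Q)"
    by (rule nn_integral_mono_AE)
  also have "\<dots> \<le> liminf (\<lambda>N. \<integral>\<^sup>+\<omega>. ennreal (H N \<omega>) \<partial>Q)"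
    using int(1) by (intro nn_integral_liminf) (auto intro!: borel_measurable_integrable)
  also have "\<dots> \<le> liminf (\<lambda>N. ennreal E)"
    using int by (intro Liminf_mono always_eventually allI) (simp add: nn_integral_eq_integral ennreal_leI)
  also have "\<dots> = ennreal E" by (simp add: Liminf_const)
  finally have I: "(\<integral>\<^sup>+\<omega>. pw (?S \<omega>) p \<partial>Q) \<le> ennreal E" (is "?I \<le> _") .
  then have fin: "?I \<noteq> \<infinity>" by (metis ennreal_less_top infinity_ennreal_def leD)
  have "enn2real ?I \<le> E" using enn2real_mono[OF I] E by simp
  then have "enn2real ?I powr (1 / p) \<le> E powr (1 / p)" using p by (intro powr_mono2) auto
  also have "\<dots> \<le> E powr 1" using p E by (intro powr_mono) auto
  finally have "enn2real ?I powr (1 / p) \<le> E" using E by simp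
  moreover have "pw ?I (1 / p) = ennreal (enn2real ?I powr (1 / p))"
    unfolding pw_def[of ?I] by (rule if_not_P[OF fin])
  ultimately have "pw ?I (1 / p) \<le> ennreal E" by (simp only: ennreal_leI)
  then show ?thesis unfolding Lp_norm_def Let_def pw_def .
qed

locale hypoelliptic_flow = cartan_data br \<theta> B e cS + prob_space Q
  for br :: "'g::euclidean_space \<Rightarrow> 'g \<Rightarrow> 'g" and \<theta> :: "'g \<Rightarrow> 'g" and B :: "'g \<Rightarrow> 'g \<Rightarrow> real"
    and e :: "'n::{finite,linorder} \<Rightarrow> 'g" and cS :: "'g \<Rightarrow> complex^'s::finite^'s"
    and Q :: "'w measure" +
  fixes b \<phi> M C :: real and Y0 :: 'g and wp wk Y :: "real \<Rightarrow> 'w \<Rightarrow> 'g"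
    and U :: "real \<Rightarrow> 'w \<Rightarrow> ('n, 's) ext_op"
  assumes b: "0 < b" and phi: "0 \<le> \<phi>" "\<phi> < pi / 2" and M: "0 < M" and C: "0 < C"
    and R0_le: "\<And>i. norm (R0 br B \<theta> e cS \<phi> (e i)) \<le> C * (if e i \<in> p_part \<theta> then cos \<phi> else sqrt (cos \<phi>))"
    and brownian_p: "standard_brownian Q (p_part \<theta>) (ip B \<theta>) wp"
    and brownian_k: "standard_brownian Q (k_part \<theta>) (ip B \<theta>) wk"
    and independent: "independent_processes Q wp wk"
    and Y: "solves_Y Q \<theta> b \<phi> wp wk Y0 Y"
    and U: "solves_U Q br B \<theta> e cS b \<phi> Y U"
begin

lemma cos_pos: "0 < cos \<phi>"
  using phi by (intro cos_gt_zero_pi) auto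

definition rate :: "'n \<Rightarrow> real" where
  "rate i = (if e i \<in> p_part \<theta> then 1 / b\<^sup>2 else cos \<phi> / b\<^sup>2)"

text \<open>What is left of the bound for \<open>R0\<close> on a basis vector, divided by b, after
  the diffusion coefficient \<open>sqrt (rate i)\<close> is taken out: on p,
  \<open>cos \<phi> / b\<close> is \<open>cos \<phi>\<close> times \<open>1 / b\<close>, and on k,
  \<open>sqrt (cos \<phi>) / b\<close> is the diffusion coefficient itself. It is also the weight of
  the initial value in the theorem.\<close>

definition wgt :: "'n \<Rightarrow> real" where
  "wgt i = (if e i \<in> p_part \<theta> then cos \<phi> else 1)"

definition drift :: "('n, 's) ext_spin \<Rightarrow> ('n, 's) ext_spin" where
  "drift v = - (1 / b\<^sup>2) *\<^sub>R blinfun_apply (number_rot \<theta> e \<phi>) v"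

definition noise :: "'n \<Rightarrow> ('n, 's) ext_spin \<Rightarrow> ('n, 's) ext_spin" where
  "noise i v = (1 / b) *\<^sub>R adjoint (blinfun_apply (R0 br B \<theta> e cS \<phi> (e i))) v"

definition mesh :: "nat \<Rightarrow> real" where
  "mesh N = M / 2 ^ N"

definition incr :: "nat \<Rightarrow> nat \<times> 'n \<Rightarrow> 'w \<Rightarrow> real" where
  "incr N s \<omega> = ip B \<theta> (e (snd s)) (increment (mesh N) (if e (snd s) \<in> p_part \<theta> then wp else wk) (fst s) \<omega>)"

definition euler_y :: "nat \<Rightarrow> nat \<Rightarrow> 'n \<Rightarrow> 'w \<Rightarrow> real" where
  "euler_y N k i \<omega> = euler_scheme.y (mesh N) rate (\<lambda>i. sqrt (rate i)) (\<lambda>i. ip B \<theta> (e i) Y0) k i (\<lambda>s. incr N s \<omega>)"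

definition euler_x :: "nat \<Rightarrow> ('n, 's) ext_spin \<Rightarrow> nat \<Rightarrow> 'w \<Rightarrow> ('n, 's) ext_spin" where
  "euler_x N x0 k \<omega> = euler_scheme.x (mesh N) rate (\<lambda>i. sqrt (rate i)) (\<lambda>i. ip B \<theta> (e i) Y0)
     (\<lambda>v. v + mesh N *\<^sub>R drift v) noise x0 k (\<lambda>s. incr N s \<omega>)"

text \<open>Makes the Euler step of the number operator a contraction
  (\<open>number_rot_contraction\<close> with c = mesh / b^2) and implies
  \<open>rate i * mesh N \<le> 1\<close>. It holds from some N on that depends on b, which is
  harmless for a limit.\<close>

definition fine_mesh :: "nat \<Rightarrow> bool" where
  "fine_mesh N \<longleftrightarrow> mesh N * (2 * real CARD('n)) \<le> b\<^sup>2"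

lemma mesh_pos: "0 < mesh N"
  using M by (simp add: mesh_def)

lemma mesh_tendsto: "mesh \<longlonglongrightarrow> 0"
proof -
  have "(\<lambda>N. M * (1 / 2) ^ N) \<longlonglongrightarrow> M * 0"
    by (intro tendsto_intros LIMSEQ_power_zero) auto
  then show ?thesis by (simp add: mesh_def[abs_def] power_one_over field_simps)
qed

lemma eventually_fine: "eventually fine_mesh sequentially"
proof -
  have lim: "(\<lambda>N. mesh N * (2 * real CARD('n))) \<longlonglongrightarrow> 0 * (2 * real CARD('n))"
    by (intro tendsto_intros mesh_tendsto)
  have "0 * (2 * real CARD('n)) < b\<^sup>2" using b by simp
  from order_tendstoD(2)[OF lim this] show ?thesis by eventually_elim (simp add: fine_mesh_def)
qed

lemma rate_pos: "0 < rate i"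
  using b cos_pos by (simp add: rate_def)

lemma rate_mesh: "fine_mesh N \<Longrightarrow> rate i * mesh N \<le> 1"
proof -
  assume f: "fine_mesh N"
  have "0 < CARD('n)" by simp
  then have "1 \<le> 2 * real CARD('n)" by linarith
  then have "mesh N * 1 \<le> mesh N * (2 * real CARD('n))"
    using mesh_pos[of N] by (intro mult_left_mono) auto
  then have "mesh N \<le> b\<^sup>2" using f by (simp add: fine_mesh_def)
  moreover have "rate i \<le> 1 / b\<^sup>2" by (simp add: rate_def divide_right_mono)
  ultimately have "rate i * mesh N \<le> 1 / b\<^sup>2 * b\<^sup>2"
    using mesh_pos[of N] by (intro mult_mono) auto
  then show ?thesis using b by simp
qed

lemma linear_drift: "linear drift"
  unfolding drift_def[abs_def]
  by (intro linear_compose_scale_right bounded_linear.linear[OF blinfun.bounded_linear_right])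

lemma linear_noise: "linear (noise i)"
  unfolding noise_def[abs_def]
  by (intro linear_compose_scale_right adjoint_linear bounded_linear.linear[OF blinfun.bounded_linear_right])

lemma norm_noise: "norm (noise i v) \<le> (C * wgt i * sqrt (rate i)) * norm v"
proof -
  have "norm (noise i v) = (1 / b) * norm (adjoint (blinfun_apply (R0 br B \<theta> e cS \<phi> (e i))) v)"
    using b by (simp add: noise_def)
  also have "\<dots> \<le> (1 / b) * ((C * (if e i \<in> p_part \<theta> then cos \<phi> else sqrt (cos \<phi>))) * norm v)"
    using b
    by (intro mult_left_mono order_trans[OF adjoint_blinfun_norm mult_right_mono[OF R0_le norm_ge_zero]]) auto
  also have "\<dots> = (C * wgt i * sqrt (rate i)) * norm v"
    using b by (simp add: wgt_def rate_def real_sqrt_divide)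
  finally show ?thesis .
qed

text \<open>The bound of \<open>scheme_moment\<close> for 2^N steps of total length M, with constant
  C and weights \<open>wgt\<close>; neither N nor b occurs in it.\<close>

definition moment_bound :: "nat \<Rightarrow> real" where
  "moment_bound m = 4 ^ m * (1 + 25 ^ m * (22 * (4 ^ Suc m *
     exp (real (6 * m) * (C * sqrt M * (\<Sum>i\<in>UNIV. wgt i * \<bar>ip B \<theta> (e i) Y0\<bar>))
      + real (20 * m\<^sup>2) * (C\<^sup>2 * (real CARD('n))\<^sup>2 * M)))))"

lemma bounded_scheme:
  assumes "fine_mesh N" "norm x0 \<le> 1"
  shows "bounded_euler_scheme (mesh N) rate (\<lambda>i. sqrt (rate i)) (\<lambda>i. C * wgt i * sqrt (rate i))
      (\<lambda>v. v + mesh N *\<^sub>R drift v) noise x0 C wgt"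
proof -
  have lin: "linear (\<lambda>v. v + mesh N *\<^sub>R drift v)"
    by (intro linear_compose_add linear_compose_scale_right linear_drift linear_id[unfolded id_def])
  have D: "norm (v + mesh N *\<^sub>R drift v) \<le> norm v" for v
  proof -
    have "v + mesh N *\<^sub>R drift v = v - (mesh N / b\<^sup>2) *\<^sub>R blinfun_apply (number_rot \<theta> e \<phi>) v"
      by (simp add: drift_def)
    moreover have "norm (v - (mesh N / b\<^sup>2) *\<^sub>R blinfun_apply (number_rot \<theta> e \<phi>) v) \<le> norm v"
      using assms(1) b mesh_pos[of N] cos_pos
      by (intro number_rot_contraction) (auto simp: fine_mesh_def field_simps)
    ultimately show ?thesis by simp
  qed
  have r: "0 \<le> sqrt (rate i)" "0 \<le> wgt i" "wgt i \<le> 1" for i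
    using rate_pos[of i] cos_pos by (auto simp: wgt_def)
  then have "0 \<le> C * wgt i * sqrt (rate i)" for i using C by simp
  with r lin D show ?thesis
    by (intro bounded_euler_scheme.intro euler_scheme.intro bounded_euler_scheme_axioms.intro)
      (use assms mesh_pos rate_pos rate_mesh linear_noise norm_noise C in auto)
qed

lemma euler_x_moment:
  assumes fine: "fine_mesh N" and x0: "norm x0 \<le> 1" and m: "3 \<le> m"
  shows "\<exists>W. integrable Q W \<and> (\<forall>\<omega> k. k \<le> 2 ^ N \<longrightarrow> norm (euler_x N x0 k \<omega>) ^ (4 * m) \<le> W \<omega>) \<and>
    expectation W \<le> moment_bound m"
proof -
  obtain i0 where i0: "e i0 \<in> p_part \<theta>" by (rule unit_p_vector)
  interpret bp: brownian_pair Q "p_part \<theta>" "k_part \<theta>" "ip B \<theta>" wp wk "mesh N" e "e i0"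
    by (intro brownian_pair.intro brownian_increments.intro brownian_increments_axioms.intro
        brownian_pair_axioms.intro prob_space_axioms brownian_p brownian_k independent subspace_p
        subspace_k mesh_pos linear_ip linear_ip' ip_p_pos ip_k_pos e_mem i0)
      (simp_all add: e_orthonormal)
  interpret sch: bounded_euler_scheme "mesh N" rate "\<lambda>i. sqrt (rate i)" "\<lambda>i. C * wgt i * sqrt (rate i)"
      "\<lambda>i. ip B \<theta> (e i) Y0" "\<lambda>v. v + mesh N *\<^sub>R drift v" noise x0 C wgt
    by (rule bounded_scheme[OF fine x0])
  have incr: "incr N = bp.coord_increment"
    by (simp add: fun_eq_iff incr_def bp.coord_increment_def)
  interpret rs: random_euler_scheme "mesh N" rate "\<lambda>i. sqrt (rate i)" "\<lambda>i. C * wgt i * sqrt (rate i)"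
      "\<lambda>i. ip B \<theta> (e i) Y0" "\<lambda>v. v + mesh N *\<^sub>R drift v" noise x0 C wgt Q "incr N" bp.ref_increment
    unfolding incr
    by (intro random_euler_scheme.intro random_euler_scheme_axioms.intro prob_space_axioms
        sch.bounded_euler_scheme_axioms bp.coord_word bp.ref_word_integrable bp.ref_increment_indep
        bp.ref_increment_normal)
  have "real (2 ^ N) * mesh N = M" by (simp add: mesh_def)
  then have mb: "moment_bound m = 4 ^ m * (1 + 25 ^ m * (22 * rs.growth_bound m (2 ^ N)))"
    unfolding moment_bound_def rs.growth_bound_def sch.y0_size_def by simp
  show ?thesis
  proof (rule rs.scheme_moment[OF m, of N])
    fix W assume "integrable Q W" and "\<And>\<omega> k. k \<le> 2 ^ N \<Longrightarrow> norm (rs.scheme_x k \<omega>) ^ (4 * m) \<le> W \<omega>"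
      and "expectation W \<le> 4 ^ m * (1 + 25 ^ m * (22 * rs.growth_bound m (2 ^ N)))"
    then show ?thesis unfolding mb euler_x_def by (intro exI[of _ W] conjI allI impI)
  qed
qed

lemma euler_y_rec:
  assumes "fine_mesh N"
  shows "euler_y N 0 i \<omega> = ip B \<theta> (e i) Y0" (is ?A)
    "euler_y N (Suc k) i \<omega> = (1 - rate i * mesh N) * euler_y N k i \<omega> + sqrt (rate i) * incr N (k, i) \<omega>" (is ?B)
proof -
  interpret sch: bounded_euler_scheme "mesh N" rate "\<lambda>i. sqrt (rate i)" "\<lambda>i. C * wgt i * sqrt (rate i)"
      "\<lambda>i. ip B \<theta> (e i) Y0" "\<lambda>v. v + mesh N *\<^sub>R drift v" noise 0 C wgt
    by (rule bounded_scheme[OF assms]) simp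
  show ?A ?B
    by (simp_all add: euler_y_def)
qed

lemma euler_x_rec:
  assumes "fine_mesh N" "norm x0 \<le> 1"
  shows "euler_x N x0 0 \<omega> = x0" (is ?A)
    "euler_x N x0 (Suc k) \<omega> = euler_x N x0 k \<omega>
      + mesh N *\<^sub>R (drift (euler_x N x0 k \<omega>) + (\<Sum>i\<in>UNIV. euler_y N k i \<omega> *\<^sub>R noise i (euler_x N x0 k \<omega>)))" (is ?B)
proof -
  interpret sch: bounded_euler_scheme "mesh N" rate "\<lambda>i. sqrt (rate i)" "\<lambda>i. C * wgt i * sqrt (rate i)"
      "\<lambda>i. ip B \<theta> (e i) Y0" "\<lambda>v. v + mesh N *\<^sub>R drift v" noise x0 C wgt
    by (rule bounded_scheme[OF assms])
  show ?A ?B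
    by (simp_all add: euler_y_def euler_x_def scaleR_add_right scaleR_sum_right add.assoc)
qed

lemma coordinate_equation:
  assumes cont: "continuous_on {0..} (\<lambda>t. Y t \<omega>)" and t: "0 \<le> t"
    and eq: "pr_p \<theta> (Y t \<omega>) = pr_p \<theta> Y0 - integral {0..t} (\<lambda>s. (1 / b\<^sup>2) *\<^sub>R pr_p \<theta> (Y s \<omega>)) + (1 / b) *\<^sub>R wp t \<omega>"
      "pr_k \<theta> (Y t \<omega>) = pr_k \<theta> Y0 - integral {0..t} (\<lambda>s. (cos \<phi> / b\<^sup>2) *\<^sub>R pr_k \<theta> (Y s \<omega>)) + (sqrt (cos \<phi>) / b) *\<^sub>R wk t \<omega>"
  shows "ip B \<theta> (e i) (Y t \<omega>) = ip B \<theta> (e i) Y0 - integral {0..t} (\<lambda>s. rate i * ip B \<theta> (e i) (Y s \<omega>))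
    + sqrt (rate i) * ip B \<theta> (e i) ((if e i \<in> p_part \<theta> then wp else wk) t \<omega>)"
proof -
  have bl: "bounded_linear (ip B \<theta> (e i))" using linear_ip by (simp add: linear_conv_bounded_linear)
  have int: "(\<lambda>s. c *\<^sub>R f (Y s \<omega>)) integrable_on {0..t}" if "linear f" for c and f :: "'g \<Rightarrow> 'g"
    by (intro integrable_continuous_real continuous_intros linear_continuous_compose[OF that]
        continuous_on_subset[OF cont]) auto
  have L: "ip B \<theta> (e i) (integral {0..t} (\<lambda>s. c *\<^sub>R f (Y s \<omega>))) = integral {0..t} (\<lambda>s. c * ip B \<theta> (e i) (f (Y s \<omega>)))"
    if "linear f" for c and f :: "'g \<Rightarrow> 'g"
    using integral_linear[OF int[OF that] bl, of c] unfolding o_def linear_cmul[OF linear_ip]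
    by (auto dest: sym)
  show ?thesis
  proof (cases "e i \<in> p_part \<theta>")
    case True
    have "ip B \<theta> (e i) (Y t \<omega>) = ip B \<theta> (e i) (pr_p \<theta> (Y t \<omega>))" by (simp add: ip_pr[OF True])
    also have "\<dots> = ip B \<theta> (e i) Y0 - integral {0..t} (\<lambda>s. (1 / b\<^sup>2) * ip B \<theta> (e i) (Y s \<omega>)) + (1 / b) * ip B \<theta> (e i) (wp t \<omega>)"
      unfolding eq(1) linear_add[OF linear_ip] linear_diff[OF linear_ip] linear_cmul[OF linear_ip] L[OF linear_pr_p]
      by (simp add: ip_pr[OF True])
    finally show ?thesis using True b by (simp add: rate_def real_sqrt_divide)
  next
    case False
    have "ip B \<theta> (e i) (Y t \<omega>) = ip B \<theta> (e i) (pr_k \<theta> (Y t \<omega>))" by (simp add: ip_pr'[OF False])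
    also have "\<dots> = ip B \<theta> (e i) Y0 - integral {0..t} (\<lambda>s. (cos \<phi> / b\<^sup>2) * ip B \<theta> (e i) (Y s \<omega>)) + (sqrt (cos \<phi>) / b) * ip B \<theta> (e i) (wk t \<omega>)"
      unfolding eq(2) linear_add[OF linear_ip] linear_diff[OF linear_ip] linear_cmul[OF linear_ip] L[OF linear_pr_k]
      by (simp add: ip_pr'[OF False])
    finally show ?thesis using False b by (simp add: rate_def real_sqrt_divide)
  qed
qed

lemma adjoint_generator:
  "adjoint (blinfun_apply (- (1 / b\<^sup>2) *\<^sub>R number_rot \<theta> e \<phi> + (1 / b) *\<^sub>R R0 br B \<theta> e cS \<phi> y)) v
    = drift v + (\<Sum>i\<in>UNIV. ip B \<theta> (e i) y *\<^sub>R noise i v)"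
proof -
  interpret adj: bounded_linear "\<lambda>T :: ('n, 's) ext_op. adjoint (blinfun_apply T) v"
    by (rule bounded_linear_adjoint_blinfun)
  have "blinfun_apply (number_rot \<theta> e \<phi>) = adjoint (blinfun_apply (number_rot \<theta> e \<phi> :: ('n, 's) ext_op))"
    by (rule sym, rule adjoint_unique) (simp add: number_rot_symmetric)
  then have N: "adjoint (blinfun_apply (number_rot \<theta> e \<phi> :: ('n, 's) ext_op)) v = blinfun_apply (number_rot \<theta> e \<phi>) v"
    by metis
  show ?thesis
    unfolding adj.add adj.scaleR N drift_def noise_def
    by (subst R0_expand) (simp only: adj.sum adj.scaleR scaleR_sum_right scaleR_scaleR mult.commute)
qed

text \<open>One null set serves all x0 and t, since convergence of the scheme is deterministic once
  the path is continuous and the equations hold. The index is that of the last grid point not after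
  t; this point tends to t, and the solution is continuous.\<close>

lemma euler_x_converges:
  "AE \<omega> in Q. \<forall>x0. norm x0 \<le> 1 \<longrightarrow> (\<forall>t\<in>{0..M}.
    (\<lambda>N. euler_x N x0 (nat \<lfloor>t / mesh N\<rfloor>) \<omega>) \<longlonglongrightarrow> adjoint (blinfun_apply (U t \<omega>)) x0)"
proof -
  have "AE \<omega> in Q. wp 0 \<omega> = 0" "AE \<omega> in Q. wk 0 \<omega> = 0"
    using brownian_p brownian_k unfolding standard_brownian_def by (auto elim!: eventually_mono)
  then show ?thesis using Y[unfolded solves_Y_def] U[unfolded solves_U_def]
  proof eventually_elim
    case (elim \<omega>)
    show ?case
    proof (intro allI impI ballI)
      fix x0 :: "('n, 's) ext_spin" and t assume x0: "norm x0 \<le> 1" and t: "t \<in> {0..M}"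
      let ?n = "\<lambda>N. nat \<lfloor>t / mesh N\<rfloor>"
      define X where "X s = adjoint (blinfun_apply (U s \<omega>)) x0" for s
      define \<beta> where "\<beta> i t = ip B \<theta> (e i) ((if e i \<in> p_part \<theta> then wp else wk) t \<omega>)" for i t
      define y where "y i t = ip B \<theta> (e i) (Y t \<omega>)" for i t
      have w0: "wp 0 \<omega> = 0" "wk 0 \<omega> = 0" using elim(1,2) by auto
      have cont: "continuous_on {0..} (\<lambda>t. Y t \<omega>)" using elim(3) by (rule conjunct1)
      have cy: "continuous_on {0..} (y i)" for i
        unfolding y_def by (intro linear_continuous_compose[OF linear_ip] cont)
      have eqy: "y i t = ip B \<theta> (e i) Y0 - integral {0..t} (\<lambda>s. rate i * y i s) + sqrt (rate i) * \<beta> i t" if "0 \<le> t" for i t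
        unfolding y_def \<beta>_def using elim(3) that by (intro coordinate_equation cont) auto
      have X0: "X 0 = x0"
      proof -
        have "adjoint (blinfun_apply (id_blinfun :: ('n, 's) ext_op)) x0 = x0"
          by (rule vector_eq_ldot[THEN iffD1, OF allI], subst adjoint_blinfun_inner) simp
        then show ?thesis unfolding X_def using elim(4) by simp
      qed
      have dX: "(X has_vector_derivative drift (X s) + (\<Sum>i\<in>UNIV. y i s *\<^sub>R noise i (X s))) (at s within {0..})"
        if "0 \<le> s" for s
      proof -
        have "((\<lambda>s. U s \<omega>) has_vector_derivative (U s \<omega> o\<^sub>L (- (1 / b\<^sup>2) *\<^sub>R number_rot \<theta> e \<phi> + (1 / b) *\<^sub>R R0 br B \<theta> e cS \<phi> (Y s \<omega>))))
            (at s within {0..})"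
          using elim(4) that by simp
        from bounded_linear.has_vector_derivative[OF bounded_linear_adjoint_blinfun this, of x0]
        show ?thesis unfolding adjoint_blinfun_compose adjoint_generator X_def y_def .
      qed
      have k: "real (?n N) * mesh N \<le> t" "t - mesh N \<le> real (?n N) * mesh N" for N
      proof -
        have "0 \<le> t / mesh N" using t mesh_pos[of N] by auto
        then have f: "real (?n N) \<le> t / mesh N" "t / mesh N - 1 \<le> real (?n N)"
          by linarith+
        show "real (?n N) * mesh N \<le> t"
          using f(1) mesh_pos[of N] by (simp add: field_simps)
        show "t - mesh N \<le> real (?n N) * mesh N"
          using f(2) mesh_pos[of N] by (simp add: field_simps)
      qed
      let ?s = "\<lambda>N. real (?n N) * mesh N"
      have "?s \<longlonglongrightarrow> t"
      proof (rule tendsto_sandwich[where f = "\<lambda>N. t - mesh N" and h = "\<lambda>_. t"])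
        have "(\<lambda>N. t - mesh N) \<longlonglongrightarrow> t - 0" by (intro tendsto_intros mesh_tendsto)
        then show "(\<lambda>N. t - mesh N) \<longlonglongrightarrow> t" by simp
      qed (use k in auto)
      moreover have "continuous_on {0..} X"
        using dX by (intro continuous_on_eq_continuous_within[THEN iffD2] ballI has_vector_derivative_continuous) auto
      moreover have mesh_nonneg: "0 \<le> ?s N" for N using mesh_pos[of N] by simp
      ultimately have lim: "(\<lambda>N. X (?s N)) \<longlonglongrightarrow> X t"
        using t mesh_nonneg by (intro continuous_on_tendsto_compose[of "{0..}" X ?s t]) auto
      have "(\<lambda>N. euler_x N x0 (?n N) \<omega> - X (?s N)) \<longlonglongrightarrow> 0"
      proof (rule LIMSEQ_I)
        fix \<epsilon> :: real assume "0 < \<epsilon>"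
        then have \<epsilon>: "0 < \<epsilon> / 2" by simp
        show "\<exists>n0. \<forall>N\<ge>n0. norm (euler_x N x0 (?n N) \<omega> - X (?s N) - 0) < \<epsilon>"
        proof (rule euler_scheme_converges[OF M linear_drift linear_noise rate_pos cy eqy dX \<epsilon>])
          fix \<delta> :: real assume \<delta>: "0 < \<delta>" and err: "\<And>h yy x k. 0 < h \<Longrightarrow> h \<le> \<delta> \<Longrightarrow> (\<And>i. rate i * h \<le> 1) \<Longrightarrow> (\<And>i. yy 0 i = y i 0) \<Longrightarrow>
            (\<And>k i. yy (Suc k) i = (1 - rate i * h) * yy k i + sqrt (rate i) * (\<beta> i (real (Suc k) * h) - \<beta> i (real k * h))) \<Longrightarrow>
            x 0 = X 0 \<Longrightarrow> (\<And>k. x (Suc k) = x k + h *\<^sub>R (drift (x k) + (\<Sum>i\<in>UNIV. yy k i *\<^sub>R noise i (x k)))) \<Longrightarrow>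
            real k * h \<le> M \<Longrightarrow> norm (x k - X (real k * h)) \<le> \<epsilon> / 2"
          have "eventually (\<lambda>N. mesh N < \<delta>) sequentially"
            using order_tendstoD(2)[OF mesh_tendsto \<delta>] .
          then have "eventually (\<lambda>N. norm (euler_x N x0 (?n N) \<omega> - X (?s N) - 0) < \<epsilon>) sequentially"
            using eventually_fine
          proof eventually_elim
            case (elim N)
            have "norm (euler_x N x0 (?n N) \<omega> - X (?s N)) \<le> \<epsilon> / 2"
            proof (rule err[of "mesh N" "\<lambda>k i. euler_y N k i \<omega>" "\<lambda>k. euler_x N x0 k \<omega>"])
              show "0 < mesh N" by (rule mesh_pos)
              show "mesh N \<le> \<delta>" using elim(1) by simp
              show "rate i * mesh N \<le> 1" for i by (rule rate_mesh[OF elim(2)])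
              show "euler_y N 0 i \<omega> = y i 0" for i
              proof -
                have "\<beta> i 0 = 0" unfolding \<beta>_def using w0 by (simp add: linear_0[OF linear_ip])
                then show ?thesis using eqy[of 0 i] euler_y_rec(1)[OF elim(2)] by simp
              qed
              show "euler_y N (Suc k) i \<omega> = (1 - rate i * mesh N) * euler_y N k i \<omega>
                  + sqrt (rate i) * (\<beta> i (real (Suc k) * mesh N) - \<beta> i (real k * mesh N))" for k i
                unfolding euler_y_rec(2)[OF elim(2)] incr_def \<beta>_def
                by (simp add: increment_def linear_diff[OF linear_ip])
              show "euler_x N x0 0 \<omega> = X 0" unfolding X0 by (rule euler_x_rec(1)[OF elim(2) x0])
              show "euler_x N x0 (Suc k) \<omega> = euler_x N x0 k \<omega> + mesh N *\<^sub>R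
                  (drift (euler_x N x0 k \<omega>) + (\<Sum>i\<in>UNIV. euler_y N k i \<omega> *\<^sub>R noise i (euler_x N x0 k \<omega>)))" for k
                by (rule euler_x_rec(2)[OF elim(2) x0])
              show "real (?n N) * mesh N \<le> M" using k(1)[of N] t by simp
            qed
            then show ?case using \<epsilon> by simp
          qed
          then show ?thesis unfolding eventually_sequentially .
        qed
      qed
      from tendsto_add[OF this lim] show "(\<lambda>N. euler_x N x0 (?n N) \<omega>) \<longlonglongrightarrow> adjoint (blinfun_apply (U t \<omega>)) x0"
        unfolding X_def by simp
    qed
  qed
qed

lemma Lp_bound:
  assumes p: "2 < p" "p \<le> real (4 * m)" and m: "3 \<le> m"
  shows "Lp_norm Q p (\<lambda>\<omega>. SUP t\<in>{0..M}. ennreal (norm (U t \<omega>)))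
    \<le> ennreal (1 + real DIM(('n, 's) ext_spin) ^ (4 * m) * (real DIM(('n, 's) ext_spin) * moment_bound m))"
proof -
  let ?d = "real DIM(('n, 's) ext_spin)"
  obtain N0 where N0: "\<And>N. N \<ge> N0 \<Longrightarrow> fine_mesh N"
    using eventually_fine unfolding eventually_sequentially by blast
  define P where "P N x0 V \<longleftrightarrow> integrable Q V \<and> (\<forall>\<omega> k. k \<le> 2 ^ (N + N0) \<longrightarrow>
      norm (euler_x (N + N0) x0 k \<omega>) ^ (4 * m) \<le> V \<omega>) \<and> expectation V \<le> moment_bound m" for N x0 V
  \<comment> \<open>A choice for each N and x0, made before \<omega> is fixed. The shift by
    \<open>N0\<close> skips the meshes that are not fine.\<close>
  define W where "W N x0 = (SOME V. P N x0 V)" for N x0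
  have "P N x0 (W N x0)" if "x0 \<in> Basis" for N x0
  proof -
    have "norm x0 \<le> 1" using that by simp
    then have "\<exists>V. P N x0 V" unfolding P_def by (intro euler_x_moment N0 m) simp_all
    then show ?thesis unfolding W_def by (rule someI_ex)
  qed
  then have W: "\<And>N x0. x0 \<in> Basis \<Longrightarrow> integrable Q (W N x0)"
      "\<And>N x0 \<omega> k. x0 \<in> Basis \<Longrightarrow> k \<le> 2 ^ (N + N0) \<Longrightarrow> norm (euler_x (N + N0) x0 k \<omega>) ^ (4 * m) \<le> W N x0 \<omega>"
      "\<And>N x0. x0 \<in> Basis \<Longrightarrow> expectation (W N x0) \<le> moment_bound m"
    unfolding P_def by simp_all
  have W0: "0 \<le> W N x0 \<omega>" if "x0 \<in> Basis" for N x0 \<omega>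
    by (rule order_trans[OF _ W(2)[OF that, of 0]]) auto
  define H where "H N \<omega> = 1 + ?d ^ (4 * m) * (\<Sum>x0\<in>Basis. W N x0 \<omega>)" for N \<omega>
  have mb: "0 \<le> moment_bound m"
    unfolding moment_bound_def by (intro mult_nonneg_nonneg add_nonneg_nonneg) auto
  show ?thesis
  proof (rule Lp_norm_SUP_le[where H = H])
    show "integrable Q (H N)" for N
      unfolding H_def by (intro Bochner_Integration.integrable_add integrable_mult_right
          Bochner_Integration.integrable_sum W(1)) auto
    show "0 \<le> H N \<omega>" for N \<omega>
      unfolding H_def by (intro add_nonneg_nonneg mult_nonneg_nonneg sum_nonneg W0) auto
    show "expectation (H N) \<le> 1 + ?d ^ (4 * m) * (?d * moment_bound m)" for N
    proof -
      have "expectation (\<lambda>\<omega>. \<Sum>x0\<in>Basis. W N x0 \<omega>) = (\<Sum>x0\<in>Basis. expectation (W N x0))"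
        by (rule Bochner_Integration.integral_sum) (rule W(1))
      moreover have "integrable Q (\<lambda>\<omega>. \<Sum>x0\<in>Basis. W N x0 \<omega>)"
        by (intro Bochner_Integration.integrable_sum W(1))
      ultimately have "expectation (H N) = 1 + ?d ^ (4 * m) * (\<Sum>x0\<in>Basis. expectation (W N x0))"
        unfolding H_def by (simp add: prob_space)
      also have "\<dots> \<le> 1 + ?d ^ (4 * m) * (?d * moment_bound m)"
        by (intro add_left_mono mult_left_mono sum_bounded_above W(3)) auto
      finally show ?thesis .
    qed
    show "AE \<omega> in Q. \<forall>t\<in>{0..M}. \<exists>c. c \<longlonglongrightarrow> norm (U t \<omega>) powr p \<and> (\<forall>N. c N \<le> H N \<omega>)"
      using euler_x_converges
    proof eventually_elim
      case (elim \<omega>)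
      show ?case
      proof
        fix t assume t: "t \<in> {0..M}"
        let ?k = "\<lambda>N. nat \<lfloor>t / mesh (N + N0)\<rfloor>"
        let ?X = "\<lambda>x0. adjoint (blinfun_apply (U t \<omega>)) x0"
        define c where "c N = 1 + ?d ^ (4 * m) * (\<Sum>x0\<in>Basis. norm (euler_x (N + N0) x0 (?k N) \<omega>) ^ (4 * m))" for N
        define l where "l = 1 + ?d ^ (4 * m) * (\<Sum>x0\<in>Basis. norm (?X x0) ^ (4 * m))"
        have "(\<lambda>N. euler_x (N + N0) x0 (?k N) \<omega>) \<longlonglongrightarrow> ?X x0" if "x0 \<in> Basis" for x0
          using elim t that
          by (intro LIMSEQ_ignore_initial_segment[where f = "\<lambda>N. euler_x N x0 (nat \<lfloor>t / mesh N\<rfloor>) \<omega>"]) auto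
        then have "c \<longlonglongrightarrow> l"
          unfolding c_def l_def by (intro tendsto_intros)
        \<comment> \<open>The limit l of \<open>c\<close> may exceed the power of the norm.
          Subtracting the gap corrects the limit and, the gap being nonnegative, keeps the sequence
          below \<open>H\<close>.\<close>
        then have lim: "(\<lambda>N. c N - (l - norm (U t \<omega>) powr p)) \<longlonglongrightarrow> l - (l - norm (U t \<omega>) powr p)"
          by (intro tendsto_intros)
        have "norm (U t \<omega>) powr p \<le> 1 + norm (U t \<omega>) ^ (4 * m)"
          using p by (intro powr_le_one_plus_power) auto
        also have "\<dots> \<le> 1 + (\<Sum>x0\<in>Basis. norm (?X x0)) ^ (4 * m)"
          by (intro add_left_mono power_mono norm_blinfun_le_sum_adjoint) auto
        also have "\<dots> \<le> l"
          unfolding l_def by (intro add_left_mono sum_power_le_card_power) auto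
        finally have le: "norm (U t \<omega>) powr p \<le> l" .
        have "c N \<le> H N \<omega>" for N
        proof -
          have "t / mesh (N + N0) \<le> 2 ^ (N + N0)"
            using t M by (simp add: mesh_def field_simps)
          then have "?k N \<le> 2 ^ (N + N0)"
            by (simp add: nat_le_iff floor_le_iff)
          then show ?thesis unfolding c_def H_def
            by (intro add_left_mono mult_left_mono sum_mono W(2)) auto
        qed
        then have "c N - (l - norm (U t \<omega>) powr p) \<le> H N \<omega>" for N
          using le order_trans[of "c N - (l - norm (U t \<omega>) powr p)" "c N" "H N \<omega>"] by simp
        with lim show "\<exists>c. c \<longlonglongrightarrow> norm (U t \<omega>) powr p \<and> (\<forall>N. c N \<le> H N \<omega>)"
          by (intro exI[of _ "\<lambda>N. c N - (l - norm (U t \<omega>) powr p)"]) simp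
      qed
    qed
  qed (use p M mb in auto)
qed

text \<open>The moment bound is exponential in the weighted l1 size of the initial value, and
  \<open>wgt i * |z| \<le> 1 + wgt i * z^2\<close> turns it into the quadratic form of the theorem.
  The same weight on both sides preserves the factor cos \<phi>; the ones add up to the dimension,
  which goes into the constant.\<close>

lemma moment_bound_le:
  defines "S \<equiv> cos \<phi> * ip B \<theta> (pr_p \<theta> Y0) (pr_p \<theta> Y0) + ip B \<theta> (pr_k \<theta> Y0) (pr_k \<theta> Y0)"
  shows "0 \<le> S" and "moment_bound m \<le> 4 ^ m * (1 + 25 ^ m * (22 * (4 ^ Suc m *
     exp (real (6 * m) * (C * sqrt M * real CARD('n)) + real (20 * m\<^sup>2) * (C\<^sup>2 * (real CARD('n))\<^sup>2 * M)))))
     * exp (real (6 * m) * (C * sqrt M) * S)"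
proof -
  have S: "S = (\<Sum>i\<in>UNIV. wgt i * (ip B \<theta> (e i) Y0)\<^sup>2)"
    unfolding S_def weighted_size wgt_def ..
  have w: "0 \<le> wgt i" "wgt i \<le> 1" for i using cos_pos by (auto simp: wgt_def)
  show S0: "0 \<le> S" unfolding S using w by (intro sum_nonneg mult_nonneg_nonneg) auto
  have "wgt i * \<bar>z\<bar> \<le> 1 + wgt i * z\<^sup>2" for i z
  proof -
    have "\<bar>z\<bar> \<le> 1 + z\<^sup>2" using sum_squares_bound[of 1 "\<bar>z\<bar>"] by simp
    then have "wgt i * \<bar>z\<bar> \<le> wgt i * (1 + z\<^sup>2)" using w by (intro mult_left_mono)
    then show ?thesis using w(2)[of i] by (simp add: algebra_simps)
  qed
  then have "(\<Sum>i\<in>UNIV. wgt i * \<bar>ip B \<theta> (e i) Y0\<bar>) \<le> (\<Sum>i\<in>UNIV. 1 + wgt i * (ip B \<theta> (e i) Y0)\<^sup>2)"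
    by (intro sum_mono)
  also have "\<dots> = real CARD('n) + S" by (simp add: sum.distrib S)
  finally have sz: "(\<Sum>i\<in>UNIV. wgt i * \<bar>ip B \<theta> (e i) Y0\<bar>) \<le> real CARD('n) + S" .
  let ?K = "real (20 * m\<^sup>2) * (C\<^sup>2 * (real CARD('n))\<^sup>2 * M)"
  let ?e = "exp (real (6 * m) * (C * sqrt M) * S)"
  let ?A = "exp (real (6 * m) * (C * sqrt M * real CARD('n)) + ?K)"
  have "real (6 * m) * (C * sqrt M * (\<Sum>i\<in>UNIV. wgt i * \<bar>ip B \<theta> (e i) Y0\<bar>)) + ?K
      \<le> real (6 * m) * (C * sqrt M * (real CARD('n) + S)) + ?K"
    using C M by (intro add_right_mono mult_left_mono sz) auto
  also have "\<dots> = (real (6 * m) * (C * sqrt M * real CARD('n)) + ?K) + real (6 * m) * (C * sqrt M) * S"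
    by (simp add: algebra_simps)
  finally have "exp (real (6 * m) * (C * sqrt M * (\<Sum>i\<in>UNIV. wgt i * \<bar>ip B \<theta> (e i) Y0\<bar>)) + ?K) \<le> ?A * ?e"
    unfolding exp_add[symmetric] by simp
  then have "moment_bound m \<le> 4 ^ m * (1 + 25 ^ m * (22 * (4 ^ Suc m * (?A * ?e))))"
    unfolding moment_bound_def by (intro mult_left_mono add_left_mono) auto
  also have "\<dots> \<le> 4 ^ m * (?e + 25 ^ m * (22 * (4 ^ Suc m * (?A * ?e))))"
    using C M S0 by (intro mult_left_mono add_right_mono) auto
  also have "\<dots> = 4 ^ m * (1 + 25 ^ m * (22 * (4 ^ Suc m * ?A))) * ?e"
    by (simp add: algebra_simps)
  finally show "moment_bound m \<le> 4 ^ m * (1 + 25 ^ m * (22 * (4 ^ Suc m * ?A))) * ?e" .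
qed

end

section \<open>Choice of the constants\<close>

theorem theorem11p17:
  fixes G :: "'m::euclidean_space monoid" and K :: "'m set"
    and ex :: "'g::euclidean_space \<Rightarrow> 'm" and br :: "'g \<Rightarrow> 'g \<Rightarrow> 'g"
    and \<theta> :: "'g \<Rightarrow> 'g" and B :: "'g \<Rightarrow> 'g \<Rightarrow> real"
    and e :: "'n::{finite,linorder} \<Rightarrow> 'g" and cS :: "'g \<Rightarrow> complex^'s::finite^'s"
  assumes "real_reductive_group G K ex br \<theta> B"
    and "connected (carrier G)" and "simply_connected (carrier G)"
    and "odd (dim (p_part \<theta>))"
    and "adapted_basis B \<theta> e"
    and "spinor_module B \<theta> cS"
  shows "\<forall>p>2. \<forall>M>0. \<exists>C>0. \<exists>C'>0.
    \<forall>b \<phi> Y0 (Q :: 'w measure) wp wk Y (U :: real \<Rightarrow> 'w \<Rightarrow> ('n, 's) ext_op).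
      0 < b \<and> b \<le> 1 \<and> 0 \<le> \<phi> \<and> \<phi> < pi / 2 \<and>
      prob_space Q \<and>
      standard_brownian Q (p_part \<theta>) (ip B \<theta>) wp \<and>
      standard_brownian Q (k_part \<theta>) (ip B \<theta>) wk \<and>
      independent_processes Q wp wk \<and>
      solves_Y Q \<theta> b \<phi> wp wk Y0 Y \<and>
      solves_U Q br B \<theta> e cS b \<phi> Y U
      \<longrightarrow> Lp_norm Q p (\<lambda>\<omega>. SUP t\<in>{0..M}. ennreal (norm (U t \<omega>)))
          \<le> ennreal (C * exp (C' * (cos \<phi> * ip B \<theta> (pr_p \<theta> Y0) (pr_p \<theta> Y0)
                                     + ip B \<theta> (pr_k \<theta> Y0) (pr_k \<theta> Y0))))"
proof (intro allI impI, goal_cases)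
  case (1 p M)
  then have p: "2 < p" and M: "0 < M" by simp_all
  have "lie_algebra_of br ex G" and \<theta>: "linear \<theta>" "\<forall>x. \<theta> (\<theta> x) = x"
    and B: "\<forall>x. linear (B x)" "\<forall>x y. B x y = B y x" "\<forall>x y. B (\<theta> x) (\<theta> y) = B x y"
      "\<forall>x\<in>p_part \<theta>. x \<noteq> 0 \<longrightarrow> B x x > 0" "\<forall>x\<in>k_part \<theta>. x \<noteq> 0 \<longrightarrow> B x x < 0"
    using assms(1) unfolding real_reductive_group_def by - (elim conjE, assumption)+
  then have br: "\<forall>x. linear (br x)" "\<forall>y. linear (\<lambda>x. br x y)"
    unfolding lie_algebra_of_def lie_algebra_def by - (elim conjE, assumption)+
  \<comment> \<open>An odd dimension is not 0; a nonzero vector is needed for the reference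
    noise.\<close>
  have "p_part \<theta> \<noteq> {0}"
  proof
    assume "p_part \<theta> = {0}"
    then have "dim (p_part \<theta>) = 0" by simp
    with assms(4) show False by simp
  qed
  with \<theta> B br assms(5) interpret cartan_data br \<theta> B e cS
    by (intro cartan_data.intro; blast)
  obtain c where c: "0 < c" and R0: "\<And>\<phi> i. 0 \<le> \<phi> \<Longrightarrow> \<phi> < pi / 2 \<Longrightarrow>
    norm (R0 br B \<theta> e cS \<phi> (e i)) \<le> c * (if e i \<in> p_part \<theta> then cos \<phi> else sqrt (cos \<phi>))"
    using R0_bound by blast
  \<comment> \<open>At least 3 for the chaining series to converge, and with \<open>4 * m\<close> at
    least p, so that the moment of order 4 m controls the one of order p.\<close>
  define m where "m = max 3 (nat \<lceil>p\<rceil>)"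
  have m: "3 \<le> m" "p \<le> real (4 * m)"
  proof -
    have "p \<le> real (nat \<lceil>p\<rceil>)" by linarith
    also have "\<dots> \<le> real (4 * m)" unfolding m_def by simp
    finally show "p \<le> real (4 * m)" .
  qed (simp add: m_def)
  let ?d = "real DIM(('n, 's) ext_spin)"
  define a where "a = 4 ^ m * (1 + 25 ^ m * (22 * (4 ^ Suc m *
     exp (real (6 * m) * (c * sqrt M * real CARD('n)) + real (20 * m\<^sup>2) * (c\<^sup>2 * (real CARD('n))\<^sup>2 * M)))))"
  have a: "0 < a" unfolding a_def by (intro mult_pos_pos add_pos_nonneg) auto
  \<comment> \<open>The summand 1 takes care of the additive 1 in \<open>Lp_bound\<close>, as
    \<open>exp (C' * S)\<close> is at least 1 for the nonnegative quadratic form S in the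
    exponent.\<close>
  define C where "C = 1 + ?d ^ (4 * m) * (?d * a)"
  define C' where "C' = real (6 * m) * (c * sqrt M)"
  have C: "0 < C" unfolding C_def using a by (intro add_pos_nonneg) auto
  have C': "0 < C'" unfolding C'_def using m c M by simp
  show ?case
  proof (rule exI[of _ C], rule conjI[OF C], rule exI[of _ C'], rule conjI[OF C'], intro allI impI, goal_cases)
    case (1 b \<phi> Y0 Q wp wk Y U)
    interpret hypoelliptic_flow br \<theta> B e cS Q b \<phi> M c Y0 wp wk Y U
      using 1 R0 c M
      by (intro hypoelliptic_flow.intro hypoelliptic_flow_axioms.intro cartan_data_axioms) auto
    let ?S = "cos \<phi> * ip B \<theta> (pr_p \<theta> Y0) (pr_p \<theta> Y0) + ip B \<theta> (pr_k \<theta> Y0) (pr_k \<theta> Y0)"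
    have mb: "moment_bound m \<le> a * exp (C' * ?S)"
      using moment_bound_le(2)[of m] unfolding a_def C'_def .
    have e1: "1 \<le> exp (C' * ?S)" using moment_bound_le(1) C' by simp
    have "1 + ?d ^ (4 * m) * (?d * moment_bound m) \<le> exp (C' * ?S) + ?d ^ (4 * m) * (?d * (a * exp (C' * ?S)))"
      by (intro add_mono mult_left_mono mb e1) auto
    also have "\<dots> = C * exp (C' * ?S)" unfolding C_def by (simp add: algebra_simps)
    finally show ?case
      by (rule order_trans[OF Lp_bound[OF p m(2,1)] ennreal_leI])
  qed
qed

end
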